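(* Let $\Omega\subset\mathbb{R}^n$ be a domain and let $F=F(A,p,s,x)\in C^2(\mathrm{Sym}(n)\times\mathbb{R}^n\times\mathbb{R}\times\Omega)$ be a real-valued function such that for each $p\in\mathbb{R}^n$ the map $$(A,s,x)\in \mathrm{Sym}^+(n)\times\mathbb{R}\times\Omega\ \longmapsto\ F(A^{-1},p,s,x)$$ is locally convex. Let $u\in C^3(\Omega)$ be a convex solution of $$F(D^2u,Du,u,x)=0\quad\text{on }\Omega,$$ subject to the ellipticity condition $$F^{ij}(D^2u,Du,u,x)>0\quad\text{on }\Omega .$$ Then the Hessian $D^2u$ has constant rank in $\Omega$.
   Context: $\mathrm{Sym}(n)$ is the space of real symmetric $n\times n$ matrices and $\mathrm{Sym}^+(n)$ is the subset of strictly positive definite ones. A domain is a connected open set. $F^{ij}$ denotes the derivative of $F$ with respect to the $(i,j)$th entry $A_{ij}$ of the matrix argument $A$ (with the usual convention that the derivative of $F$ in the direction $X\in\mathrm{Sym}(n)$ is $\sum_{i,j}F^{ij}X_{ij}$, with $F^{ij}$ symmetric in $i,j$), and $F^{ij}>0$ means that the symmetric matrix $(F^{ij})$ is positive definite at each point of $\Omega$. *)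

theory Defs
  imports "HOL-Analysis.Analysis"
begin

definition Sym :: "(real^'n^'n) set" where
  "Sym = {A. transpose A = A}"

definition pos_def :: "real^'n^'n \<Rightarrow> bool" where
  "pos_def A \<longleftrightarrow> A \<in> Sym \<and> (\<forall>v. v \<noteq> 0 \<longrightarrow> v \<bullet> (A *v v) > 0)"

definition Sym_pos :: "(real^'n^'n) set" where
  "Sym_pos = {A. pos_def A}"

text \<open>
  \<open>C_k_on k V U f\<close>: the function \<open>f\<close> is of class \<open>C\<^sup>k\<close> on \<open>U\<close>, where \<open>U\<close> is meant to be
  a relatively open subset of the linear subspace \<open>V\<close> (for an ordinary open set, \<open>V = UNIV\<close>).
  At a point of such a \<open>U\<close> the derivative within \<open>U\<close> is uniquely determined on \<open>V\<close>
  only, so it is only evaluated in directions from \<open>V\<close>. Since \<open>V\<close> is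
  finite-dimensional, the derivative is of class \<open>C\<^sup>k\<close> iff each of its values in
  a fixed direction is.
\<close>

primrec C_k_on :: "nat \<Rightarrow> 'a::euclidean_space set \<Rightarrow> 'a set \<Rightarrow> ('a \<Rightarrow> real) \<Rightarrow> bool" where
  "C_k_on 0 V U f \<longleftrightarrow> continuous_on U f"
| "C_k_on (Suc k) V U f \<longleftrightarrow>
     (\<exists>f'. (\<forall>x\<in>U. (f has_derivative f' x) (at x within U)) \<and>
           (\<forall>v\<in>V. C_k_on k V U (\<lambda>x. f' x v)))"

definition locally_convex_on :: "'a::euclidean_space set \<Rightarrow> ('a \<Rightarrow> real) \<Rightarrow> bool" where
  "locally_convex_on S f \<longleftrightarrow> locally (\<lambda>T. convex_on T f) S"

text \<open>
  The library's \<open>convex_on S f\<close> requires \<open>S\<close> itself to be convex, which a domain need not be.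
  Convexity on a general domain means convexity on every convex subset
  (equivalently, along every line segment in the domain); for convex \<open>S\<close> the two notions agree.
\<close>

definition convex_fun_on :: "'a::euclidean_space set \<Rightarrow> ('a \<Rightarrow> real) \<Rightarrow> bool" where
  "convex_fun_on S f \<longleftrightarrow> (\<forall>T\<subseteq>S. convex T \<longrightarrow> convex_on T f)"

lemma convex_fun_on_iff_convex_on: "convex S \<Longrightarrow> convex_fun_on S f \<longleftrightarrow> convex_on S f"
  unfolding convex_fun_on_def using convex_on_subset by blast

definition partial :: "'n \<Rightarrow> (real^'n \<Rightarrow> real) \<Rightarrow> real^'n \<Rightarrow> real" where
  "partial i u x = deriv (\<lambda>t. u (x + t *\<^sub>R axis i 1)) 0"

definition grad :: "(real^'n \<Rightarrow> real) \<Rightarrow> real^'n \<Rightarrow> real^'n" where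
  "grad u x = (\<chi> i. partial i u x)"

definition hessian :: "(real^'n \<Rightarrow> real) \<Rightarrow> real^'n \<Rightarrow> real^'n^'n" where
  "hessian u x = (\<chi> i j. partial i (partial j u) x)"

text \<open>
  \<open>has_matrix_deriv F A p s x G\<close> says that \<open>G\<close> is the symmetric matrix \<open>F\<^sup>i\<^sup>j(A,p,s,x)\<close>. As \<open>F\<close>
  is only given for symmetric \<open>A\<close>, the entries cannot be varied independently.
\<close>

definition has_matrix_deriv ::
    "((real^'n^'n) \<times> (real^'n) \<times> real \<times> (real^'n) \<Rightarrow> real) \<Rightarrow>
     real^'n^'n \<Rightarrow> real^'n \<Rightarrow> real \<Rightarrow> real^'n \<Rightarrow> real^'n^'n \<Rightarrow> bool" where
  "has_matrix_deriv F A p s x G \<longleftrightarrow> G \<in> Sym \<and>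
     (\<forall>X\<in>Sym. ((\<lambda>t. F (A + t *\<^sub>R X, p, s, x)) has_real_derivative
                (\<Sum>i\<in>UNIV. \<Sum>j\<in>UNIV. G $ i $ j * X $ i $ j)) (at 0))"

definition matrix_deriv ::
    "((real^'n^'n) \<times> (real^'n) \<times> real \<times> (real^'n) \<Rightarrow> real) \<Rightarrow>
     real^'n^'n \<Rightarrow> real^'n \<Rightarrow> real \<Rightarrow> real^'n \<Rightarrow> real^'n^'n" where
  "matrix_deriv F A p s x = (THE G. has_matrix_deriv F A p s x G)"

lemma has_matrix_deriv_unique:
  assumes "has_matrix_deriv F A p s x G" and "has_matrix_deriv F A p s x H"
  shows "G = H"
proof -
  have sym: "G - H \<in> Sym"
    using assms by (simp add: has_matrix_deriv_def Sym_def transpose_def vec_eq_iff)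
  have "G \<bullet> (G - H) = H \<bullet> (G - H)"
    using assms sym unfolding has_matrix_deriv_def inner_vec_def inner_real_def
    by (blast intro: DERIV_unique)
  then have "(G - H) \<bullet> (G - H) = 0"
    by (simp add: inner_diff_left)
  then show ?thesis by simp
qed

lemma matrix_deriv_eqI: "has_matrix_deriv F A p s x G \<Longrightarrow> matrix_deriv F A p s x = G"
  unfolding matrix_deriv_def by (blast intro: has_matrix_deriv_unique)

end

theory Submission
  imports Defs
begin

text \<open>
  Near a point \<open>z\<close> the rank of \<open>A = D\<^sup>2u\<close> is read off from a Schur complement. If \<open>J\<close> is a maximal set of
  indices for which the block of \<open>A(z)\<close> on \<open>J\<close> is positive definite, then that block stays positive definite
  near \<open>z\<close>, and the rank of \<open>A(x)\<close> equals the cardinality of \<open>J\<close> exactly when the Schur complement \<open>S(x)\<close> of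
  the block vanishes. As \<open>S(z) = 0\<close> and \<open>S \<ge> 0\<close>, the theorem asks for a strong minimum principle for \<open>S\<close>.
  It is applied to the scalar function \<open>spread S = 2 tr S - |S|\<close>, which dominates \<open>|S|\<close> on positive
  semidefinite matrices.

  The differential inequality combines the equation with the convexity assumption. Differentiating the equation
  twice in a direction \<open>\<xi> = L c\<close>, where the columns of \<open>L\<close> are the minimisers that define \<open>S = L\<^sup>T A L\<close>, gives
  \<open>F\<^sup>i\<^sup>j D\<^sub>i\<^sub>j u\<^sub>\<xi>\<^sub>\<xi> + D\<^sup>2F(\<dots>) = \<dots>\<close>. Letting \<open>\<xi>\<close> vary linearly with \<open>x\<close> (the freedom in a Schur complement) adds the term
  \<open>- 2 F\<^sup>i\<^sup>j (A\<^sub>\<xi> H A\<^sub>\<xi>)\<^sub>i\<^sub>j\<close>, where \<open>H\<close> inverts the block. Convexity of \<open>F(A\<^sup>-\<^sup>1, p, s, x)\<close> says that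
  \<open>D\<^sup>2F(A K A, 0, \<dots>)\<^sup>2 + 2 F\<^sup>i\<^sup>j (A K A K A)\<^sub>i\<^sub>j \<ge> 0\<close>, and with \<open>K = H A\<^sub>\<xi> H\<close> the two expressions agree up to terms that
  contain a factor \<open>A\<^sub>\<xi> L\<close> or \<open>S\<close>. Total symmetry of the third derivatives makes the rows of \<open>A\<^sub>\<xi> L\<close> first
  derivatives of \<open>S\<close>, so the error is linear in \<open>|DS| + |S|\<close> (\<open>error_bound\<close>). The gradient \<open>D(spread S)\<close> alone does
  not control \<open>DS\<close>, but \<open>spread\<close> is concave: its second derivative yields \<open>|T|\<^sup>2 / |S|\<close>, where \<open>T\<close> is the part of \<open>DS\<close>
  orthogonal to \<open>S\<close>, and this absorbs \<open>|T|\<close> at the cost of a multiple of \<open>|S|\<close>. What remains is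
  \<open>F\<^sup>i\<^sup>j \<phi>\<^sub>i\<^sub>j \<le> C (|D\<phi>| + \<phi>)\<close> for every \<open>\<phi>\<close> that touches \<open>spread S\<close> from below (\<open>touching_estimate\<close>). Hopf's barrier
  violates it (\<open>degenerate_nearby\<close>), so \<open>S\<close> vanishes in a neighbourhood, the rank is locally constant, and
  connectedness finishes the proof.

  As \<open>u\<close> is only \<open>C\<^sup>3\<close>, the Hessian cannot be differentiated twice. Second derivatives of \<open>u\<^sub>\<xi>\<^sub>\<xi>\<close> are replaced
  by those of the difference quotient \<open>(u(x + h\<xi>) + u(x - h\<xi>) - 2u(x)) / h\<^sup>2\<close>, evaluated at minimum points that
  converge to the touching point (\<open>touching_inequality\<close>); there the equation at \<open>x\<close> and \<open>x \<plusminus> h\<xi>\<close> supplies what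
  the twice differentiated equation would.
\<close>

section \<open>Second-order expansions along sequences\<close>

text \<open>
  The first and second derivatives are arguments and not existentially quantified, because the gradient, the
  Hessian and the coefficients \<open>F\<^sup>i\<^sup>j\<close> are read off from them.
\<close>

definition C2_on :: "'a::euclidean_space set \<Rightarrow> ('a \<Rightarrow> real) \<Rightarrow> ('a \<Rightarrow> 'a \<Rightarrow> real) \<Rightarrow> ('a \<Rightarrow> 'a \<Rightarrow> 'a \<Rightarrow> real) \<Rightarrow> bool"
  where "C2_on S g g' g'' \<longleftrightarrow> open S \<and>
    (\<forall>x\<in>S. (g has_derivative g' x) (at x)) \<and>
    (\<forall>x\<in>S. \<forall>v. ((\<lambda>y. g' y v) has_derivative g'' x v) (at x)) \<and>
    (\<forall>v w. continuous_on S (\<lambda>x. g'' x v w))"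

lemma C2_onD:
  assumes "C2_on S g g' g''"
  shows "open S"
    and "x \<in> S \<Longrightarrow> (g has_derivative g' x) (at x)"
    and "x \<in> S \<Longrightarrow> ((\<lambda>y. g' y v) has_derivative g'' x v) (at x)"
    and "continuous_on S (\<lambda>x. g'' x v w)"
  using assms unfolding C2_on_def by auto

lemma C2_on_linear:
  assumes "C2_on S g g' g''" "x \<in> S"
  shows "linear (g' x)" "linear (g'' x v)" "linear (\<lambda>v. g'' x v w)"
proof -
  have l1: "linear (g' x)" if "x \<in> S" for x
    using C2_onD(2)[OF assms(1) that] has_derivative_linear by blast
  show "linear (g' x)" by (rule l1[OF assms(2)])
  show "linear (g'' x v)" for v
    using C2_onD(3)[OF assms] has_derivative_linear by blast
  note o = C2_onD(1)[OF assms(1)]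
  have add: "g'' x (v + v') w = g'' x v w + g'' x v' w" for v v'
  proof -
    have "((\<lambda>y. g' y v + g' y v') has_derivative (\<lambda>w. g'' x v w + g'' x v' w)) (at x)"
      by (intro derivative_intros C2_onD(3)[OF assms])
    then have "((\<lambda>y. g' y (v+v')) has_derivative (\<lambda>w. g'' x v w + g'' x v' w)) (at x)"
      by (rule has_derivative_transform_within_open[OF _ o assms(2)])
         (simp add: linear_add[OF l1])
    then show ?thesis using C2_onD(3)[OF assms, of "v+v'"] has_derivative_unique by metis
  qed
  have sc: "g'' x (c *\<^sub>R v) w = c * g'' x v w" for c v
  proof -
    have "((\<lambda>y. c * g' y v) has_derivative (\<lambda>w. c * g'' x v w)) (at x)"
      by (intro derivative_intros C2_onD(3)[OF assms])
    then have "((\<lambda>y. g' y (c *\<^sub>R v)) has_derivative (\<lambda>w. c * g'' x v w)) (at x)"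
      by (rule has_derivative_transform_within_open[OF _ o assms(2)])
         (simp add: linear_cmul[OF l1])
    then show ?thesis using C2_onD(3)[OF assms, of "c *\<^sub>R v"] has_derivative_unique by metis
  qed
  show "linear (\<lambda>v. g'' x v w)"
    by (rule linearI) (simp_all add: add sc)
qed

lemma C2_on_continuous:
  assumes "C2_on S g g' g''"
  shows "continuous_on S g" "continuous_on S (\<lambda>x. g' x v)"
  by (rule continuous_at_imp_continuous_on, rule ballI,
      erule has_derivative_continuous[OF C2_onD(2)[OF assms]] has_derivative_continuous[OF C2_onD(3)[OF assms]])+

lemma linear_basis_sum:
  fixes f :: "'a::euclidean_space \<Rightarrow> 'b::real_normed_vector"
  assumes "linear f"
  shows "f v = (\<Sum>b\<in>Basis. (v \<bullet> b) *\<^sub>R f b)"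
  using linear_sum[OF assms, of "\<lambda>b. (v \<bullet> b) *\<^sub>R b" Basis]
  by (simp add: euclidean_representation linear_cmul[OF assms])

text \<open>
  Linearity reduces joint continuity in a base point and direction vectors to continuity in the
  base point along each basis direction.
\<close>

lemma tendsto_linear_family:
  fixes g :: "'b::metric_space \<Rightarrow> 'a::euclidean_space \<Rightarrow> 'c::real_normed_vector"
  assumes lin: "\<And>x. x \<in> S \<Longrightarrow> linear (g x)" and cont: "\<And>v. v \<in> Basis \<Longrightarrow> continuous_on S (\<lambda>x. g x v)"
    and x: "(x \<longlongrightarrow> x0) \<F>" "x0 \<in> S" "\<forall>\<^sub>F n in \<F>. x n \<in> S" and v: "(v \<longlongrightarrow> v0) \<F>"
  shows "((\<lambda>n. g (x n) (v n)) \<longlongrightarrow> g x0 v0) \<F>"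
proof -
  have rep: "g y w = (\<Sum>b\<in>Basis. (w \<bullet> b) *\<^sub>R g y b)" if "y \<in> S" for y w
    by (rule linear_basis_sum[OF lin[OF that]])
  have "((\<lambda>n. \<Sum>b\<in>Basis. (v n \<bullet> b) *\<^sub>R g (x n) b) \<longlongrightarrow> (\<Sum>b\<in>Basis. (v0 \<bullet> b) *\<^sub>R g x0 b)) \<F>"
    by (intro tendsto_intros v continuous_on_tendsto_compose[OF cont x(1,2,3)])
  then show ?thesis
    unfolding rep[OF x(2), symmetric]
    by (rule Lim_transform_eventually) (rule eventually_mono[OF x(3) rep[symmetric]])
qed

lemma C2_on_tendsto:
  assumes C: "C2_on S g g' g''" and x: "(x \<longlongrightarrow> x0) \<F>" "x0 \<in> S" and v: "(v \<longlongrightarrow> v0) \<F>"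
  shows "((\<lambda>n. g' (x n) (v n)) \<longlongrightarrow> g' x0 v0) \<F>"
    and "(w \<longlongrightarrow> w0) \<F> \<Longrightarrow> ((\<lambda>n. g'' (x n) (v n) (w n)) \<longlongrightarrow> g'' x0 v0 w0) \<F>"
proof -
  have ev: "\<forall>\<^sub>F n in \<F>. x n \<in> S"
    using topological_tendstoD[OF x(1) C2_onD(1)[OF C] x(2)] .
  show "((\<lambda>n. g' (x n) (v n)) \<longlongrightarrow> g' x0 v0) \<F>"
    by (rule tendsto_linear_family[OF C2_on_linear(1)[OF C] C2_on_continuous(2)[OF C] x ev v])
  assume w: "(w \<longlongrightarrow> w0) \<F>"
  have rep: "g'' y v w = (\<Sum>b\<in>Basis. (v \<bullet> b) * g'' y b w)" if "y \<in> S" for y v w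
    using linear_basis_sum[OF C2_on_linear(3)[OF C that], of v] by simp
  have "((\<lambda>n. \<Sum>b\<in>Basis. (v n \<bullet> b) * g'' (x n) b (w n)) \<longlongrightarrow> (\<Sum>b\<in>Basis. (v0 \<bullet> b) * g'' x0 b w0)) \<F>"
    by (intro tendsto_intros v tendsto_linear_family[OF C2_on_linear(2)[OF C] C2_onD(4)[OF C] x ev w])
  then show "((\<lambda>n. g'' (x n) (v n) (w n)) \<longlongrightarrow> g'' x0 v0 w0) \<F>"
    unfolding rep[OF x(2), symmetric]
    by (rule Lim_transform_eventually) (rule eventually_mono[OF ev rep[symmetric]])
qed

lemma C2_on_Taylor:
  assumes C: "C2_on S g g' g''" and seg: "\<And>t. 0 \<le> t \<Longrightarrow> t \<le> 1 \<Longrightarrow> x + t *\<^sub>R k \<in> S"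
  obtains t where "0 < t" "t < 1" "g (x + k) = g x + g' x k + g'' (x + t *\<^sub>R k) k k / 2"
proof -
  define D where "D = (\<lambda>m::nat. if m = 0 then (\<lambda>t. g (x + t *\<^sub>R k)) else
      if m = 1 then (\<lambda>t. g' (x + t *\<^sub>R k) k) else (\<lambda>t. g'' (x + t *\<^sub>R k) k k))"
  have d: "((\<lambda>t. x + t *\<^sub>R k) has_derivative (\<lambda>s. s *\<^sub>R k)) (at t)" for t
    by (auto intro!: derivative_eq_intros)
  have "DERIV (D m) t :> D (Suc m) t" if "m < 2" "0 \<le> t" "t \<le> 1" for m t
  proof -
    note inS = seg[OF that(2,3)]
    have "(D 0 has_derivative (\<lambda>s. g' (x + t *\<^sub>R k) (s *\<^sub>R k))) (at t)"
      using has_derivative_compose[OF d C2_onD(2)[OF C inS]] by (simp add: D_def)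
    moreover have "(D 1 has_derivative (\<lambda>s. g'' (x + t *\<^sub>R k) k (s *\<^sub>R k))) (at t)"
      using has_derivative_compose[OF d C2_onD(3)[OF C inS]] by (simp add: D_def)
    moreover have "m = 0 \<or> m = 1" using that by auto
    ultimately show ?thesis
      by (auto simp: has_field_derivative_def D_def linear_cmul[OF C2_on_linear(1)[OF C inS]]
          linear_cmul[OF C2_on_linear(2)[OF C inS]] mult.commute elim!: has_derivative_eq_rhs)
  qed
  then obtain t where t: "0 < t" "t < 1" "D 0 1 = (\<Sum>m<2. D m 0 / fact m * (1 - 0) ^ m) + D 2 t / fact 2 * (1 - 0)^2"
    using Taylor_up[of 2 D "D 0" 0 1 0] by auto
  show ?thesis
    by (rule that[OF t(1,2)]) (use t(3) in \<open>simp add: D_def numeral_2_eq_2\<close>)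
qed

text \<open>
  The base points move with the step size, as they will be minimum points of functions that depend on it.
\<close>

lemma second_order_limit:
  fixes x k :: "nat \<Rightarrow> 'a::euclidean_space" and h :: "nat \<Rightarrow> real"
  assumes C: "C2_on S g g' g''" and x: "x \<longlonglongrightarrow> x0" "x0 \<in> S"
    and h: "h \<longlonglongrightarrow> 0" "\<And>n. h n \<noteq> 0" and k: "(\<lambda>n. k n /\<^sub>R h n) \<longlonglongrightarrow> k0"
  shows "(\<lambda>n. (g (x n + k n) - g (x n) - g' (x n) (k n)) / (h n)\<^sup>2) \<longlonglongrightarrow> g'' x0 k0 k0 / 2"
proof -
  obtain e where e: "e > 0" "ball x0 e \<subseteq> S"
    using C2_onD(1)[OF C] x(2) openE by blast
  have k0: "k \<longlonglongrightarrow> 0"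
  proof -
    have "(\<lambda>n. h n *\<^sub>R (k n /\<^sub>R h n)) \<longlonglongrightarrow> 0 *\<^sub>R k0" by (intro tendsto_intros h k)
    then show ?thesis using h(2) by simp
  qed
  have xk: "(\<lambda>n. x n + k n) \<longlonglongrightarrow> x0 + 0" by (intro tendsto_intros x k0)
  have "\<forall>\<^sub>F n in sequentially. x n \<in> ball x0 e \<and> x n + k n \<in> ball x0 e"
    using topological_tendstoD[OF x(1) open_ball, of x0 e] topological_tendstoD[OF xk open_ball, of x0 e] e
    by (simp add: eventually_conj)
  then have ev: "\<forall>\<^sub>F n in sequentially. \<exists>t. 0 < t \<and> t < 1 \<and> g (x n + k n) = g (x n) + g' (x n) (k n) + g'' (x n + t *\<^sub>R k n) (k n) (k n) / 2"
  proof (eventually_elim)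
    case (elim n)
    have "x n + t *\<^sub>R k n \<in> S" if "0 \<le> t" "t \<le> 1" for t
    proof -
      have "(1 - t) *\<^sub>R x n + t *\<^sub>R (x n + k n) \<in> ball x0 e"
        using elim that convex_ball[of x0 e] by (intro convexD) auto
      then show ?thesis using e by (auto simp: algebra_simps)
    qed
    from C2_on_Taylor[OF C this] show ?case by metis
  qed
  define t where "t n = (SOME t. 0 < t \<and> t < 1 \<and> g (x n + k n) = g (x n) + g' (x n) (k n) + g'' (x n + t *\<^sub>R k n) (k n) (k n) / 2)" for n
  have t: "\<forall>\<^sub>F n in sequentially. 0 < t n \<and> t n < 1 \<and> g (x n + k n) = g (x n) + g' (x n) (k n) + g'' (x n + t n *\<^sub>R k n) (k n) (k n) / 2"
    using ev by eventually_elim (unfold t_def, rule someI_ex)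
  have tk: "(\<lambda>n. t n *\<^sub>R k n) \<longlonglongrightarrow> 0"
  proof (rule Lim_null_comparison[OF _ tendsto_norm_zero[OF k0]])
    show "\<forall>\<^sub>F n in sequentially. norm (t n *\<^sub>R k n) \<le> norm (k n)"
      using t by eventually_elim (auto intro!: mult_left_le_one_le)
  qed
  have y: "(\<lambda>n. x n + t n *\<^sub>R k n) \<longlonglongrightarrow> x0"
    using tendsto_add[OF x(1) tk] by simp
  have "(\<lambda>n. g'' (x n + t n *\<^sub>R k n) (k n /\<^sub>R h n) (k n /\<^sub>R h n) / 2) \<longlonglongrightarrow> g'' x0 k0 k0 / 2"
    by (intro tendsto_intros C2_on_tendsto(2)[OF C y x(2)] k) auto
  moreover have "\<forall>\<^sub>F n in sequentially. g'' (x n + t n *\<^sub>R k n) (k n /\<^sub>R h n) (k n /\<^sub>R h n) / 2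
     = (g (x n + k n) - g (x n) - g' (x n) (k n)) / (h n)\<^sup>2"
    using t topological_tendstoD[OF y C2_onD(1)[OF C] x(2)]
  proof eventually_elim
    case (elim n)
    then show ?case
      using h(2)[of n]
      by (simp add: linear_cmul[OF C2_on_linear(2)[OF C]] linear_cmul[OF C2_on_linear(3)[OF C]] power2_eq_square divide_simps)
  qed
  ultimately show ?thesis by (rule Lim_transform_eventually)
qed

text \<open>
  Centred second differences cancel the first-order terms. They stand in for the second derivatives of
  quantities that are differentiable only once.
\<close>

lemma second_difference_limit:
  fixes x k :: "nat \<Rightarrow> 'a::euclidean_space" and h :: "nat \<Rightarrow> real"
  assumes C: "C2_on S g g' g''" and x: "x \<longlonglongrightarrow> x0" "x0 \<in> S"
    and h: "h \<longlonglongrightarrow> 0" "\<And>n. h n \<noteq> 0" and k: "k \<longlonglongrightarrow> k0"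
  shows "(\<lambda>n. (g (x n + h n *\<^sub>R k n) + g (x n - h n *\<^sub>R k n) - 2 * g (x n)) / (h n)\<^sup>2) \<longlonglongrightarrow> g'' x0 k0 k0"
proof -
  have 1: "(\<lambda>n. (g (x n + h n *\<^sub>R k n) - g (x n) - g' (x n) (h n *\<^sub>R k n)) / (h n)\<^sup>2) \<longlonglongrightarrow> g'' x0 k0 k0 / 2"
    by (rule second_order_limit[OF C x h]) (use h k in simp)
  have 2: "(\<lambda>n. (g (x n + (- h n) *\<^sub>R k n) - g (x n) - g' (x n) ((- h n) *\<^sub>R k n)) / (- h n)\<^sup>2) \<longlonglongrightarrow> g'' x0 k0 k0 / 2"
    by (rule second_order_limit[OF C x]) (use tendsto_minus[OF h(1)] h(2) k in simp_all)
  have ev: "\<forall>\<^sub>F n in sequentially. x n \<in> S" using topological_tendstoD[OF x(1) C2_onD(1)[OF C] x(2)] .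
  have "(\<lambda>n. (g (x n + h n *\<^sub>R k n) - g (x n) - g' (x n) (h n *\<^sub>R k n)) / (h n)\<^sup>2 +
     (g (x n + (- h n) *\<^sub>R k n) - g (x n) - g' (x n) ((- h n) *\<^sub>R k n)) / (- h n)\<^sup>2) \<longlonglongrightarrow> g'' x0 k0 k0"
    using tendsto_add[OF 1 2] by simp
  moreover have "\<forall>\<^sub>F n in sequentially. (g (x n + h n *\<^sub>R k n) - g (x n) - g' (x n) (h n *\<^sub>R k n)) / (h n)\<^sup>2 +
     (g (x n + (- h n) *\<^sub>R k n) - g (x n) - g' (x n) ((- h n) *\<^sub>R k n)) / (- h n)\<^sup>2
     = (g (x n + h n *\<^sub>R k n) + g (x n - h n *\<^sub>R k n) - 2 * g (x n)) / (h n)\<^sup>2"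
    using ev
  proof eventually_elim
    case (elim n)
    then show ?case
      by (simp add: linear_cmul[OF C2_on_linear(1)[OF C]] linear_neg[OF C2_on_linear(1)[OF C]] add_divide_distrib diff_divide_distrib)
  qed
  ultimately show ?thesis by (rule Lim_transform_eventually)
qed

lemma first_difference_limit:
  fixes x k :: "nat \<Rightarrow> 'a::euclidean_space" and h :: "nat \<Rightarrow> real" and g :: "'a \<Rightarrow> 'b::euclidean_space"
  assumes o: "open S" and d: "\<And>x. x \<in> S \<Longrightarrow> (g has_derivative g' x) (at x)"
    and c: "\<And>v. continuous_on S (\<lambda>x. g' x v)"
    and x: "x \<longlonglongrightarrow> x0" "x0 \<in> S"
    and h: "h \<longlonglongrightarrow> 0" "\<And>n. h n \<noteq> 0" and k: "k \<longlonglongrightarrow> k0"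
  shows "(\<lambda>n. (g (x n + h n *\<^sub>R k n) - g (x n)) /\<^sub>R h n) \<longlonglongrightarrow> g' x0 k0"
proof -
  have lin: "linear (g' y)" if "y \<in> S" for y using d[OF that] has_derivative_linear by blast
  obtain e where e: "e > 0" "ball x0 e \<subseteq> S" using o x(2) openE by blast
  have hk: "(\<lambda>n. h n *\<^sub>R k n) \<longlonglongrightarrow> 0" using tendsto_scaleR[OF h(1) k] by simp
  have xk: "(\<lambda>n. x n + h n *\<^sub>R k n) \<longlonglongrightarrow> x0 + 0" by (intro tendsto_intros x hk)
  let ?y = "\<lambda>n t. x n + t *\<^sub>R (h n *\<^sub>R k n)"
  have "\<forall>\<^sub>F n in sequentially. x n \<in> ball x0 e \<and> x n + h n *\<^sub>R k n \<in> ball x0 e"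
    using topological_tendstoD[OF x(1) open_ball, of x0 e] topological_tendstoD[OF xk open_ball, of x0 e] e
    by (simp add: eventually_conj)
  then have ev: "\<forall>\<^sub>F n in sequentially. \<exists>t. 0 < t \<and> t < 1 \<and>
      norm ((g (x n + h n *\<^sub>R k n) - g (x n)) /\<^sub>R h n - g' x0 k0) \<le> norm (g' (?y n t) (k n) - g' x0 k0)"
  proof eventually_elim
    case (elim n)
    have inS: "?y n t \<in> S" if "0 \<le> t" "t \<le> 1" for t
    proof -
      have "(1 - t) *\<^sub>R x n + t *\<^sub>R (x n + h n *\<^sub>R k n) \<in> ball x0 e"
        using elim that convex_ball[of x0 e] by (intro convexD) auto
      then show ?thesis using e by (auto simp: algebra_simps)
    qed
    have dt: "((\<lambda>t. g (?y n t) - t *\<^sub>R h n *\<^sub>R g' x0 k0) has_derivative (\<lambda>s. g' (?y n t) (s *\<^sub>R (h n *\<^sub>R k n)) - s *\<^sub>R h n *\<^sub>R g' x0 k0)) (at t)"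
      if "0 \<le> t" "t \<le> 1" for t
    proof -
      have "((\<lambda>t. ?y n t) has_derivative (\<lambda>s. s *\<^sub>R (h n *\<^sub>R k n))) (at t)"
        by (auto intro!: derivative_eq_intros)
      from has_derivative_compose[OF this d[OF inS[OF that]]] show ?thesis
        by (intro has_derivative_diff) (auto intro!: derivative_eq_intros)
    qed
    then have "continuous_on {0..1} (\<lambda>t. g (?y n t) - t *\<^sub>R h n *\<^sub>R g' x0 k0)"
      by (intro continuous_at_imp_continuous_on ballI has_derivative_continuous) auto
    from mvt_general[OF zero_less_one this dt] obtain t where t: "0 < t" "t < 1"
      "norm (g (?y n 1) - 1 *\<^sub>R h n *\<^sub>R g' x0 k0 - (g (?y n 0) - 0 *\<^sub>R h n *\<^sub>R g' x0 k0))
        \<le> norm (g' (?y n t) ((1 - 0) *\<^sub>R (h n *\<^sub>R k n)) - (1 - 0) *\<^sub>R h n *\<^sub>R g' x0 k0)" by auto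
    have "norm (h n *\<^sub>R ((g (x n + h n *\<^sub>R k n) - g (x n)) /\<^sub>R h n - g' x0 k0)) \<le> norm (h n *\<^sub>R (g' (?y n t) (k n) - g' x0 k0))"
      using t(3) h(2)[of n] inS[of t] t(1,2) by (simp add: linear_cmul[OF lin] scaleR_diff_right algebra_simps del: norm_scaleR)
    then show ?case using t(1,2) h(2)[of n] by (intro exI[of _ t]) simp
  qed
  define t where "t n = (SOME t. 0 < t \<and> t < 1 \<and>
      norm ((g (x n + h n *\<^sub>R k n) - g (x n)) /\<^sub>R h n - g' x0 k0) \<le> norm (g' (?y n t) (k n) - g' x0 k0))" for n
  have t: "\<forall>\<^sub>F n in sequentially. 0 < t n \<and> t n < 1 \<and>
      norm ((g (x n + h n *\<^sub>R k n) - g (x n)) /\<^sub>R h n - g' x0 k0) \<le> norm (g' (?y n (t n)) (k n) - g' x0 k0)"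
    using ev by eventually_elim (unfold t_def, rule someI_ex)
  have tk: "(\<lambda>n. t n *\<^sub>R (h n *\<^sub>R k n)) \<longlonglongrightarrow> 0"
  proof (rule Lim_null_comparison[OF _ tendsto_norm_zero[OF hk]])
    show "\<forall>\<^sub>F n in sequentially. norm (t n *\<^sub>R (h n *\<^sub>R k n)) \<le> norm (h n *\<^sub>R k n)"
      using t by eventually_elim (subst norm_scaleR, rule mult_left_le_one_le, auto)
  qed
  have y: "(\<lambda>n. ?y n (t n)) \<longlonglongrightarrow> x0" using tendsto_add[OF x(1) tk] by simp
  have "(\<lambda>n. g' (?y n (t n)) (k n)) \<longlonglongrightarrow> g' x0 k0"
    by (rule tendsto_linear_family[OF lin c y x(2) topological_tendstoD[OF y o x(2)] k])
  then have "(\<lambda>n. norm (g' (?y n (t n)) (k n) - g' x0 k0)) \<longlonglongrightarrow> 0" by (simp add: tendsto_norm_zero LIM_zero)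
  then have "(\<lambda>n. (g (x n + h n *\<^sub>R k n) - g (x n)) /\<^sub>R h n - g' x0 k0) \<longlonglongrightarrow> 0"
    by (rule Lim_null_comparison[rotated]) (use t in eventually_elim, simp)
  then show ?thesis by (simp add: LIM_zero_iff)
qed

text \<open>
  Expansions to second order in the direction \<open>v\<close> from \<open>x + h w\<close> and from \<open>x\<close> have the same quadratic term, so the
  mixed difference, which is symmetric in \<open>v\<close> and \<open>w\<close>, is asymptotic to \<open>h\<close> times the increment of \<open>\<lambda>x. g' x v\<close>.
\<close>

lemma C2_on_symmetric:
  assumes C: "C2_on S g g' g''" and x: "x \<in> S"
  shows "g'' x v w = g'' x w v"
proof -
  define h where "h n = inverse (real (Suc n))" for n
  have h: "h \<longlonglongrightarrow> 0" "h n \<noteq> 0" for n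
    unfolding h_def using LIMSEQ_inverse_real_of_nat by auto
  have key: "(\<lambda>n. (g (x + h n *\<^sub>R v + h n *\<^sub>R w) - g (x + h n *\<^sub>R v) - g (x + h n *\<^sub>R w) + g x) / (h n)\<^sup>2) \<longlonglongrightarrow> g'' x v w" for v w
  proof -
    have y: "(\<lambda>n. x + h n *\<^sub>R w) \<longlonglongrightarrow> x"
      using tendsto_add[OF tendsto_const[of x] tendsto_scaleR[OF h(1) tendsto_const[of w]]] by simp
    have k: "(\<lambda>n. (h n *\<^sub>R v) /\<^sub>R h n) \<longlonglongrightarrow> v" using h(2) by simp
    have d: "(\<lambda>n. (g' (x + h n *\<^sub>R w) v - g' x v) /\<^sub>R h n) \<longlonglongrightarrow> g'' x v w"
      by (rule first_difference_limit[OF C2_onD(1,3,4)[OF C] tendsto_const x h tendsto_const])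
    note lim = tendsto_add[OF tendsto_diff[OF second_order_limit[OF C y x h k] second_order_limit[OF C tendsto_const x h k]] d]
    have "\<forall>\<^sub>F n in sequentially. (g (x + h n *\<^sub>R w + h n *\<^sub>R v) - g (x + h n *\<^sub>R w) - g' (x + h n *\<^sub>R w) (h n *\<^sub>R v)) / (h n)\<^sup>2
        - (g (x + h n *\<^sub>R v) - g x - g' x (h n *\<^sub>R v)) / (h n)\<^sup>2 + (g' (x + h n *\<^sub>R w) v - g' x v) /\<^sub>R h n
        = (g (x + h n *\<^sub>R v + h n *\<^sub>R w) - g (x + h n *\<^sub>R v) - g (x + h n *\<^sub>R w) + g x) / (h n)\<^sup>2"
      using topological_tendstoD[OF y C2_onD(1)[OF C] x]
    proof eventually_elim
      case (elim n)
      have "(a - b - h n * p) / (h n)\<^sup>2 - (c - e - h n * q) / (h n)\<^sup>2 + (p - q) /\<^sub>R h n = (a - c - b + e) / (h n)\<^sup>2" for a b c e p q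
        using h(2)[of n] by (simp add: power2_eq_square field_simps)
      then show ?case
        by (simp add: linear_cmul[OF C2_on_linear(1)[OF C elim]] linear_cmul[OF C2_on_linear(1)[OF C x]] add.commute add.left_commute)
    qed
    from Lim_transform_eventually[OF lim this] show ?thesis by simp
  qed
  have "(\<lambda>n. (g (x + h n *\<^sub>R v + h n *\<^sub>R w) - g (x + h n *\<^sub>R v) - g (x + h n *\<^sub>R w) + g x) / (h n)\<^sup>2) \<longlonglongrightarrow> g'' x w v"
    using key[of w v] by (simp add: algebra_simps)
  then show ?thesis using key[of v w] LIMSEQ_unique by blast
qed

section \<open>Real matrices with the Frobenius inner product\<close>

lemma norm_sq_rows: "(norm (A::real^'n^'m))\<^sup>2 = (\<Sum>i\<in>UNIV. (norm (A$i))\<^sup>2)"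
  by (simp add: power2_norm_eq_inner inner_vec_def)

lemma inner_matrix_entries: "(A::real^'n^'m) \<bullet> B = (\<Sum>i\<in>UNIV. \<Sum>j\<in>UNIV. A$i$j * B$i$j)"
  by (simp add: inner_vec_def)

lemma inner_transpose: "transpose A \<bullet> transpose B = A \<bullet> (B::real^'n^'m)"
  unfolding inner_matrix_entries transpose_def by (simp, subst sum.swap, simp)

lemma norm_transpose: "norm (transpose A) = norm (A::real^'n^'m)"
  by (simp add: norm_eq_sqrt_inner inner_transpose)

lemma norm_matrix_vector_le: "norm (A *v x) \<le> norm (A::real^'n^'m) * norm x"
proof -
  have "(norm (A *v x))\<^sup>2 = (\<Sum>i\<in>UNIV. (A$i \<bullet> x)\<^sup>2)"
    by (subst power2_norm_eq_inner, subst inner_vec_def, simp only: matrix_vector_mul_component inner_real_def power2_eq_square)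
  also have "\<dots> \<le> (\<Sum>i\<in>UNIV. (norm (A$i))\<^sup>2 * (norm x)\<^sup>2)"
    by (intro sum_mono) (metis Cauchy_Schwarz_ineq power2_norm_eq_inner)
  also have "\<dots> = (norm A * norm x)\<^sup>2"
    by (simp add: norm_sq_rows power_mult_distrib sum_distrib_right)
  finally show ?thesis by (rule power2_le_imp_le) simp
qed

lemma norm_matrix_mult_le: "norm (A ** B) \<le> norm (A::real^'n^'m) * norm (B::real^'k^'n)"
proof -
  have row: "(A ** B)$i = transpose B *v (A$i)" for i
    by (simp add: vec_eq_iff matrix_matrix_mult_def vector_matrix_mult_def mult.commute)
  have "(norm (A ** B))\<^sup>2 \<le> (\<Sum>i\<in>UNIV. (norm B * norm (A$i))\<^sup>2)"
    unfolding norm_sq_rows[of "A ** B"]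
    using norm_matrix_vector_le[of "transpose B"] by (intro sum_mono power_mono) (simp_all only: row norm_transpose norm_ge_zero)
  also have "\<dots> = (norm A * norm B)\<^sup>2"
    by (simp add: norm_sq_rows[of A] power_mult_distrib sum_distrib_left mult.commute)
  finally show ?thesis by (rule power2_le_imp_le) simp
qed

lemma bounded_bilinear_matrix_vector: "bounded_bilinear ((*v) :: real^'n^'m \<Rightarrow> real^'n \<Rightarrow> real^'m)"
proof (rule bounded_bilinear.intro)
  show "\<exists>K. \<forall>a b. norm ((a::real^'n^'m) *v b) \<le> norm a * norm b * K"
    using norm_matrix_vector_le by (metis mult.right_neutral)
qed (simp_all add: vec_eq_iff matrix_vector_mult_def sum_distrib_left sum.distrib algebra_simps)

lemma bounded_bilinear_matrix_matrix: "bounded_bilinear ((**) :: real^'n^'m \<Rightarrow> real^'k^'n \<Rightarrow> real^'k^'m)"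
proof (rule bounded_bilinear.intro)
  show "\<exists>K. \<forall>a b. norm ((a::real^'n^'m) ** (b::real^'k^'n)) \<le> norm a * norm b * K"
    using norm_matrix_mult_le by (metis mult.right_neutral)
qed (simp_all add: vec_eq_iff matrix_matrix_mult_def sum_distrib_left sum.distrib algebra_simps)

lemmas tendsto_matrix_vector = bounded_bilinear.tendsto[OF bounded_bilinear_matrix_vector]
lemmas tendsto_matrix_matrix = bounded_bilinear.tendsto[OF bounded_bilinear_matrix_matrix]
lemmas continuous_on_matrix_vector = bounded_bilinear.continuous_on[OF bounded_bilinear_matrix_vector]
lemmas continuous_on_matrix_matrix = bounded_bilinear.continuous_on[OF bounded_bilinear_matrix_matrix]
lemmas has_derivative_matrix_matrix = bounded_bilinear.FDERIV[OF bounded_bilinear_matrix_matrix]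

lemmas matrix_bilinear_simps =
  bounded_bilinear.add_left[OF bounded_bilinear_matrix_matrix] bounded_bilinear.add_right[OF bounded_bilinear_matrix_matrix]
  bounded_bilinear.diff_left[OF bounded_bilinear_matrix_matrix] bounded_bilinear.diff_right[OF bounded_bilinear_matrix_matrix]
  bounded_bilinear.minus_left[OF bounded_bilinear_matrix_matrix] bounded_bilinear.minus_right[OF bounded_bilinear_matrix_matrix]
  bounded_bilinear.scaleR_left[OF bounded_bilinear_matrix_matrix] bounded_bilinear.scaleR_right[OF bounded_bilinear_matrix_matrix]
  bounded_bilinear.zero_left[OF bounded_bilinear_matrix_matrix] bounded_bilinear.zero_right[OF bounded_bilinear_matrix_matrix]

lemmas matrix_vector_bilinear_simps =
  bounded_bilinear.add_left[OF bounded_bilinear_matrix_vector] bounded_bilinear.add_right[OF bounded_bilinear_matrix_vector]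
  bounded_bilinear.diff_left[OF bounded_bilinear_matrix_vector] bounded_bilinear.diff_right[OF bounded_bilinear_matrix_vector]
  bounded_bilinear.minus_left[OF bounded_bilinear_matrix_vector] bounded_bilinear.minus_right[OF bounded_bilinear_matrix_vector]
  bounded_bilinear.scaleR_left[OF bounded_bilinear_matrix_vector] bounded_bilinear.scaleR_right[OF bounded_bilinear_matrix_vector]
  bounded_bilinear.zero_left[OF bounded_bilinear_matrix_vector] bounded_bilinear.zero_right[OF bounded_bilinear_matrix_vector]

lemma bounded_linear_transpose: "bounded_linear (transpose :: real^'n^'m \<Rightarrow> real^'m^'n)"
  by (rule bounded_linear_intro[where K=1]) (simp_all add: norm_transpose, simp_all add: transpose_def vec_eq_iff)

lemma transpose_simps:
  "transpose (A + B) = transpose A + transpose B" "transpose (A - B) = transpose A - transpose B"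
  "transpose (- A) = - transpose (A::real^'n^'m)" "transpose (0::real^'n^'m) = 0" "transpose (c *\<^sub>R A) = c *\<^sub>R transpose A"
  by (simp_all add: transpose_def vec_eq_iff)

lemma inner_matrix_vector: "x \<bullet> (A *v y) = (transpose A *v x) \<bullet> (y::real^'n)"
  by (simp add: dot_lmul_matrix)

lemma quadratic_congruence: "v \<bullet> ((transpose K ** A ** K) *v v) = (K *v v) \<bullet> (A *v (K *v v))" for A :: "real^'n^'n"
proof -
  have "v \<bullet> ((transpose K ** A ** K) *v v) = v \<bullet> (transpose K *v (A *v (K *v v)))"
    by (simp only: matrix_vector_mul_assoc matrix_mul_assoc)
  then show ?thesis by (simp only: inner_matrix_vector transpose_transpose)
qed

definition outer :: "real^'n \<Rightarrow> real^'n \<Rightarrow> real^'n^'n" where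
  "outer v w = (\<chi> i j. v$i * w$j)"

lemma inner_outer: "A \<bullet> outer v w = v \<bullet> (A *v w)"
  by (simp add: inner_matrix_entries outer_def inner_vec_def matrix_vector_mult_def sum_distrib_left mult_ac)

lemma outer_mult: "outer v w *v x = (w \<bullet> x) *\<^sub>R v"
  by (simp add: vec_eq_iff outer_def matrix_vector_mult_def inner_vec_def sum_distrib_right sum_distrib_left mult_ac)

lemma norm_outer: "norm (outer v w) = norm v * norm w"
proof -
  have "outer v w \<bullet> outer v w = (v \<bullet> v) * (w \<bullet> w)" by (simp add: inner_outer outer_mult)
  then show ?thesis by (simp add: norm_eq_sqrt_inner real_sqrt_mult)
qed

definition psd :: "real^'n^'n \<Rightarrow> bool" where
  "psd A \<longleftrightarrow> A \<in> Sym \<and> (\<forall>v. 0 \<le> v \<bullet> (A *v v))"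

lemma Sym_inner_commute:
  assumes "A \<in> Sym" shows "x \<bullet> (A *v y) = y \<bullet> (A *v x)"
proof -
  have "x \<bullet> (A *v y) = (transpose A *v x) \<bullet> y" by (rule inner_matrix_vector)
  then show ?thesis using assms by (simp only: Sym_def mem_Collect_eq inner_commute)
qed

text \<open>
  The restriction of the quadratic form to two coordinates has a nonpositive discriminant.
\<close>

lemma psd_entry:
  assumes "psd A"
  shows "(A$i$j)\<^sup>2 \<le> A$i$i * A$j$j"
proof -
  have e: "axis k 1 \<bullet> (A *v axis l 1) = A$k$l" for k l
    by (simp add: inner_axis' matrix_vector_mult_basis column_def)
  have sym: "A$i$j = A$j$i" using Sym_inner_commute[of A "axis i 1" "axis j 1"] assms e by (simp add: psd_def)
  have q: "0 \<le> s\<^sup>2 * A$i$i + 2 * s * t * A$i$j + t\<^sup>2 * A$j$j" for s t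
  proof -
    have "0 \<le> (s *\<^sub>R axis i 1 + t *\<^sub>R axis j 1) \<bullet> (A *v (s *\<^sub>R axis i 1 + t *\<^sub>R axis j 1))"
      using assms by (simp add: psd_def)
    also have "\<dots> = s\<^sup>2 * A$i$i + 2 * s * t * A$i$j + t\<^sup>2 * A$j$j"
      by (simp only: matrix_vector_right_distrib matrix_vector_bilinear_simps inner_add_left inner_add_right inner_scaleR_left inner_scaleR_right e sym)
         (simp add: power2_eq_square algebra_simps)
    finally show ?thesis .
  qed
  have nn: "A$i$i \<ge> 0" "A$j$j \<ge> 0" using q[of 1 0] q[of 0 1] by auto
  show ?thesis
  proof (cases "A$i$i = 0")
    case True
    have "A$i$j = 0"
    proof (rule ccontr)
      assume n: "A$i$j \<noteq> 0"
      have "0 \<le> 2 * (- (A$j$j + 1) / (2 * A$i$j)) * A$i$j + A$j$j"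
        using q[of "- (A$j$j + 1) / (2 * A$i$j)" 1] True by simp
      also have "\<dots> = -1" using n by (simp add: field_simps)
      finally show False by simp
    qed
    then show ?thesis using True by simp
  next
    case False
    have "0 \<le> A$i$i * (A$i$i * A$j$j - (A$i$j)\<^sup>2)"
      using q[of "- A$i$j" "A$i$i"] by (simp add: power2_eq_square algebra_simps)
    then show ?thesis using False nn by (simp add: zero_le_mult_iff)
  qed
qed

text \<open>
  Completing the square in one coordinate at a time writes a positive semidefinite matrix as a sum
  of squares.
\<close>

lemma psd_sum_outer_supported:
  assumes "finite I" "psd A" "\<And>i. i \<notin> I \<Longrightarrow> A$i = 0"
  shows "\<exists>c. A = (\<Sum>k\<in>I. outer (c k) (c k))"
  using assms
proof (induction I arbitrary: A rule: finite_induct)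
  case empty
  have "A $ i = 0" for i using empty(2)[of i] by simp
  then have "A = 0" by (subst vec_eq_iff) simp
  then show ?case by simp
next
  case (insert k I)
  note psd = insert.prems(1)
  have sym: "A$i$j = A$j$i" for i j
  proof -
    have "transpose A = A" using psd by (simp add: psd_def Sym_def)
    then have "A$i$j = transpose A$i$j" by simp
    then show ?thesis by (simp add: transpose_def)
  qed
  show ?case
  proof (cases "A$k$k = 0")
    case True
    have "A$k = 0" using psd_entry[OF psd, of k] True by (simp add: vec_eq_iff)
    then have "\<exists>c. A = (\<Sum>k\<in>I. outer (c k) (c k))" using insert by (metis insert_iff)
    then obtain c where c: "A = (\<Sum>k\<in>I. outer (c k) (c k))" ..
    have "A = (\<Sum>i\<in>insert k I. outer ((c(k:=0)) i) ((c(k:=0)) i))"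
    proof -
      have "(\<Sum>i\<in>I. outer ((c(k:=0)) i) ((c(k:=0)) i)) = A"
        unfolding c using insert(2) by (intro sum.cong) auto
      then show ?thesis using insert(1,2) by (simp add: outer_def vec_eq_iff)
    qed
    then show ?thesis by blast
  next
    case False
    have pos: "A$k$k > 0"
    proof -
      have "axis k 1 \<bullet> (A *v axis k 1) = A$k$k"
        by (simp add: inner_axis' matrix_vector_mult_basis column_def)
      then show ?thesis using psd False unfolding psd_def by (metis order_le_less)
    qed
    define b where "b = (1 / sqrt (A$k$k)) *\<^sub>R A$k"
    define A' where "A' = A - outer b b"
    have ob: "outer b b $ i $ j = A$k$i * A$k$j / A$k$k" for i j
      using pos by (simp add: outer_def b_def)
    have "psd A'"
      unfolding psd_def
    proof (intro conjI allI)
      show "A' \<in> Sym" unfolding Sym_def transpose_def A'_def by (simp add: vec_eq_iff ob sym mult.commute)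
      fix v
      define t where "t = (A$k \<bullet> v) / A$k$k"
      define w where "w = v - t *\<^sub>R axis k 1"
      have Ak: "axis k 1 \<bullet> (A *v x) = A$k \<bullet> x" for x by (simp add: inner_axis' matrix_vector_mul_component)
      have "A \<in> Sym" using psd by (simp add: psd_def)
      then have comm: "v \<bullet> (A *v axis k 1) = A$k \<bullet> v"
        using Sym_inner_commute[of A v "axis k 1"] Ak[of v] by simp
      have ax: "A$k \<bullet> axis k 1 = A$k$k" by (simp add: inner_axis)
      have "0 \<le> w \<bullet> (A *v w)" using psd by (simp add: psd_def)
      also have "\<dots> = v \<bullet> (A *v v) - 2 * t * (A$k \<bullet> v) + t\<^sup>2 * A$k$k"
        unfolding w_def matrix_vector_bilinear_simps inner_diff_left inner_diff_right inner_scaleR_left inner_scaleR_right comm Ak ax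
        by (simp add: power2_eq_square right_diff_distrib left_diff_distrib)
      also have "\<dots> = v \<bullet> (A *v v) - (A$k \<bullet> v)\<^sup>2 / A$k$k"
      proof -
        have "t\<^sup>2 * A$k$k = t * (t * A$k$k)" by (simp add: power2_eq_square)
        also have "t * A$k$k = A$k \<bullet> v" using pos by (simp add: t_def)
        finally have "t\<^sup>2 * A$k$k = t * (A$k \<bullet> v)" .
        moreover have "(A$k \<bullet> v)\<^sup>2 / A$k$k = t * (A$k \<bullet> v)" by (simp add: t_def power2_eq_square)
        ultimately show ?thesis by simp
      qed
      also have "\<dots> = v \<bullet> (A' *v v)"
      proof -
        have "v \<bullet> (A' *v v) = v \<bullet> (A *v v) - (b \<bullet> v)\<^sup>2"
          unfolding A'_def matrix_vector_bilinear_simps inner_diff_right outer_mult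
          by (simp add: inner_commute[of v b] power2_eq_square)
        also have "(b \<bullet> v)\<^sup>2 = (A$k \<bullet> v)\<^sup>2 / A$k$k"
          using pos by (simp add: b_def power_divide)
        finally show ?thesis by simp
      qed
      finally show "0 \<le> v \<bullet> (A' *v v)" .
    qed
    moreover have "A' $ i = 0" if "i \<notin> I" for i
    proof (cases "i = k")
      case True then show ?thesis using pos by (simp add: A'_def vec_eq_iff ob)
    next
      case False
      then have "A$i = 0" using insert.prems(2) that by auto
      then show ?thesis using sym[of k i] by (simp add: A'_def vec_eq_iff ob)
    qed
    ultimately obtain c where c: "A' = (\<Sum>k\<in>I. outer (c k) (c k))" using insert.IH by blast
    have "(\<Sum>i\<in>I. outer ((c(k:=b)) i) ((c(k:=b)) i)) = A'"
      unfolding c using insert(2) by (intro sum.cong) auto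
    then have "A = (\<Sum>i\<in>insert k I. outer ((c(k:=b)) i) ((c(k:=b)) i))"
      using insert(1,2) by (simp add: A'_def)
    then show ?thesis by blast
  qed
qed

lemma psd_sum_outer:
  assumes "psd A"
  obtains c :: "'n \<Rightarrow> real^'n" where "A = (\<Sum>k\<in>UNIV. outer (c k) (c k))"
  using psd_sum_outer_supported[OF finite assms] by auto

text \<open>
  Expanding the first factor as a sum of squares turns the pairing into values of the second quadratic form.
\<close>

lemma psd_inner_nonneg:
  fixes A B :: "real^'a^'a"
  assumes "psd A" "\<And>v. 0 \<le> v \<bullet> (B *v v)"
  shows "0 \<le> A \<bullet> B"
proof -
  obtain c :: "'a \<Rightarrow> real^'a" where "A = (\<Sum>k\<in>UNIV. outer (c k) (c k))" using psd_sum_outer[OF assms(1)] .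
  then show ?thesis using assms(2)
    by (simp add: inner_sum_left inner_commute[of "outer _ _"] inner_outer sum_nonneg)
qed

lemma psd_norm_le_trace:
  fixes A :: "real^'a^'a"
  assumes "psd A" shows "norm A \<le> mat 1 \<bullet> A"
proof -
  obtain c :: "'a \<Rightarrow> real^'a" where c: "A = (\<Sum>k\<in>UNIV. outer (c k) (c k))" using psd_sum_outer[OF assms] .
  have "norm A \<le> (\<Sum>k\<in>UNIV. norm (outer (c k) (c k)))" unfolding c by (rule norm_sum)
  also have "\<dots> = mat 1 \<bullet> A"
    unfolding c by (simp add: inner_sum_right inner_outer norm_outer power2_norm_eq_inner flip: power2_eq_square)
  finally show ?thesis .
qed

lemma psd_congruence: "psd A \<Longrightarrow> psd (transpose K ** A ** K)"
  by (simp add: psd_def Sym_def matrix_transpose_mul matrix_mul_assoc quadratic_congruence del: transpose_matrix_vector)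

lemma positive_on_subspace_coercive:
  fixes M :: "real^'n^'n"
  assumes V: "subspace V" and pos: "\<And>v. v \<in> V \<Longrightarrow> v \<noteq> 0 \<Longrightarrow> 0 < v \<bullet> (M *v v)"
  obtains c :: real where "c > 0" "\<And>v. v \<in> V \<Longrightarrow> c * (norm v)\<^sup>2 \<le> v \<bullet> (M *v v)"
proof (cases "V \<inter> sphere 0 1 = {}")
  case True
  have "v = 0" if "v \<in> V" for v
  proof (rule ccontr)
    assume "v \<noteq> 0"
    then have "v /\<^sub>R norm v \<in> V \<inter> sphere 0 1" using that V by (simp add: subspace_mul)
    then show False using True by auto
  qed
  then show thesis using that[of 1] by fastforce
next
  case False
  have "compact (V \<inter> sphere 0 1)" by (intro closed_Int_compact closed_subspace V compact_sphere)
  moreover have "continuous_on (V \<inter> sphere 0 1) (\<lambda>v. v \<bullet> (M *v v))"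
    by (intro continuous_intros continuous_on_matrix_vector)
  ultimately obtain w where w: "w \<in> V \<inter> sphere 0 1" "\<And>v. v \<in> V \<inter> sphere 0 1 \<Longrightarrow> w \<bullet> (M *v w) \<le> v \<bullet> (M *v v)"
    using continuous_attains_inf[of "V \<inter> sphere 0 1" "\<lambda>v. v \<bullet> (M *v v)"] False by metis
  show thesis
  proof (rule that)
    show "w \<bullet> (M *v w) > 0" using w(1) by (intro pos) auto
    fix v assume v: "v \<in> V"
    show "w \<bullet> (M *v w) * (norm v)\<^sup>2 \<le> v \<bullet> (M *v v)"
    proof (cases "v = 0")
      case False
      then have "v /\<^sub>R norm v \<in> V \<inter> sphere 0 1" using v V by (simp add: subspace_mul)
      from w(2)[OF this] have "w \<bullet> (M *v w) \<le> (v \<bullet> (M *v v)) / (norm v)\<^sup>2"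
        by (simp add: matrix_vector_bilinear_simps power2_eq_square field_simps)
      then show ?thesis using False by (simp add: pos_le_divide_eq)
    qed simp
  qed
qed

section \<open>The equation along second differences\<close>

text \<open>
  \<open>A\<close> is the Hessian of \<open>u\<close>, \<open>A'\<close> its derivative and \<open>a\<close> the matrix \<open>(F\<^sup>i\<^sup>j)\<close> along the solution. \<open>G\<close> is \<open>F\<close> made
  independent of the antisymmetric part of its matrix argument, so that it lives on an open set and has a
  full derivative. The last assumption is convexity of \<open>F(A\<^sup>-\<^sup>1, p, s, x)\<close> in infinitesimal form: a variation \<open>-K\<close> of
  \<open>A\<^sup>-\<^sup>1\<close> moves \<open>A\<close> with velocity \<open>A K A\<close> and acceleration \<open>2 A K A K A\<close>, and \<open>p\<close> is kept fixed.
\<close>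

locale elliptic_solution =
  fixes \<Omega> :: "(real^'n) set" and u :: "real^'n \<Rightarrow> real" and Du :: "real^'n \<Rightarrow> real^'n"
    and A :: "real^'n \<Rightarrow> real^'n^'n" and A' :: "real^'n \<Rightarrow> real^'n \<Rightarrow> real^'n^'n"
    and G :: "(real^'n^'n) \<times> (real^'n) \<times> real \<times> (real^'n) \<Rightarrow> real"
    and G' :: "(real^'n^'n) \<times> (real^'n) \<times> real \<times> (real^'n) \<Rightarrow> (real^'n^'n) \<times> (real^'n) \<times> real \<times> (real^'n) \<Rightarrow> real"
    and G'' :: "(real^'n^'n) \<times> (real^'n) \<times> real \<times> (real^'n) \<Rightarrow> (real^'n^'n) \<times> (real^'n) \<times> real \<times> (real^'n) \<Rightarrow> (real^'n^'n) \<times> (real^'n) \<times> real \<times> (real^'n) \<Rightarrow> real"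
    and a :: "real^'n \<Rightarrow> real^'n^'n"
  assumes open_dom: "open \<Omega>"
    and u: "C2_on \<Omega> u (\<lambda>x v. Du x \<bullet> v) (\<lambda>x v w. v \<bullet> (A x *v w))"
    and Du: "C2_on \<Omega> (\<lambda>x. Du x $ i) (\<lambda>x v. (A x *v v) $ i) (\<lambda>x v w. (A' x w *v v) $ i)"
    and A: "x \<in> \<Omega> \<Longrightarrow> (A has_derivative A' x) (at x)" "continuous_on \<Omega> (\<lambda>x. A' x v)"
    and A'_sym: "x \<in> \<Omega> \<Longrightarrow> A' x v \<in> Sym" "x \<in> \<Omega> \<Longrightarrow> A' x v *v w = A' x w *v v"
    and A_psd: "x \<in> \<Omega> \<Longrightarrow> psd (A x)"
    and G: "C2_on (UNIV \<times> UNIV \<times> UNIV \<times> \<Omega>) G G' G''"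
    and equation: "x \<in> \<Omega> \<Longrightarrow> G (A x, Du x, u x, x) = 0"
    and a: "x \<in> \<Omega> \<Longrightarrow> G' (A x, Du x, u x, x) (Y, 0, 0, 0) = a x \<bullet> Y"
    and elliptic: "x \<in> \<Omega> \<Longrightarrow> pos_def (a x)"
    and inverse_convex: "x \<in> \<Omega> \<Longrightarrow> K \<in> Sym \<Longrightarrow>
      0 \<le> 2 * (a x \<bullet> (A x ** K ** A x ** K ** A x)) +
        G'' (A x, Du x, u x, x) (A x ** K ** A x, 0, s, w) (A x ** K ** A x, 0, s, w)"
begin

abbreviation jet :: "real^'n \<Rightarrow> (real^'n^'n) \<times> (real^'n) \<times> real \<times> (real^'n)" where
  "jet x \<equiv> (A x, Du x, u x, x)"

abbreviation jet' :: "real^'n \<Rightarrow> real^'n \<Rightarrow> (real^'n^'n) \<times> (real^'n) \<times> real \<times> (real^'n)" where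
  "jet' x v \<equiv> (A' x v, A x *v v, Du x \<bullet> v, v)"

text \<open>
  The constants of the estimates depend on the solution only through \<open>B\<close>, which makes them uniform on compact sets.
\<close>

definition data_bound :: "real \<Rightarrow> real^'n \<Rightarrow> bool" where
  "data_bound B x \<longleftrightarrow> 1 \<le> B \<and> norm (A x) \<le> B \<and> (\<forall>v. norm (A' x v) \<le> B * norm v) \<and> norm (a x) \<le> B \<and> norm (Du x) \<le> B \<and>
    (\<forall>k. \<bar>G' (jet x) k\<bar> \<le> B * norm k) \<and> (\<forall>k l. \<bar>G'' (jet x) k l\<bar> \<le> B * norm k * norm l)"

lemma a_psd: "x \<in> \<Omega> \<Longrightarrow> psd (a x)"
  using elliptic[of x] unfolding pos_def_def psd_def by (metis inner_zero_left order_le_less)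

lemma A_linear: "x \<in> \<Omega> \<Longrightarrow> linear (A' x)"
  using A(1) has_derivative_linear by blast

lemma continuous_data:
  assumes "x \<in> \<Omega>" "(X \<longlongrightarrow> x) F"
  shows "((\<lambda>n. A (X n)) \<longlongrightarrow> A x) F" "((\<lambda>n. Du (X n)) \<longlongrightarrow> Du x) F" "((\<lambda>n. u (X n)) \<longlongrightarrow> u x) F"
proof -
  show "((\<lambda>n. A (X n)) \<longlongrightarrow> A x) F"
    using isCont_tendsto_compose[OF has_derivative_continuous[OF A(1)[OF assms(1)]] assms(2)] .
  have "((\<lambda>n. Du (X n) $ i) \<longlongrightarrow> Du x $ i) F" for i
    using isCont_tendsto_compose[OF has_derivative_continuous[OF C2_onD(2)[OF Du assms(1)]] assms(2)] .
  then show "((\<lambda>n. Du (X n)) \<longlongrightarrow> Du x) F" by (rule vec_tendstoI)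
  show "((\<lambda>n. u (X n)) \<longlongrightarrow> u x) F"
    using isCont_tendsto_compose[OF has_derivative_continuous[OF C2_onD(2)[OF u assms(1)]] assms(2)] .
qed

lemma jet_tendsto:
  assumes "x \<in> \<Omega>" "(X \<longlongrightarrow> x) F"
  shows "((\<lambda>n. jet (X n)) \<longlongrightarrow> jet x) F"
  by (intro tendsto_Pair continuous_data[OF assms] assms(2))

lemma a_tendsto:
  assumes "x \<in> \<Omega>" "(X \<longlongrightarrow> x) F"
  shows "((\<lambda>n. a (X n)) \<longlongrightarrow> a x) F"
proof -
  have "((\<lambda>n. a (X n) \<bullet> b) \<longlongrightarrow> a x \<bullet> b) F" for b
  proof -
    have "((\<lambda>n. G' (jet (X n)) (b, 0, 0, 0)) \<longlongrightarrow> G' (jet x) (b, 0, 0, 0)) F"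
      by (rule C2_on_tendsto(1)[OF G jet_tendsto[OF assms] _ tendsto_const]) (simp add: assms(1))
    then show ?thesis unfolding a[OF assms(1)]
      by (rule Lim_transform_eventually)
         (use topological_tendstoD[OF assms(2) open_dom assms(1)] in eventually_elim, rule a)
  qed
  then show ?thesis by (subst tendsto_componentwise_iff) auto
qed

lemma first_difference_jet:
  assumes x: "x \<longlonglongrightarrow> x0" "x0 \<in> \<Omega>" and t: "t \<longlonglongrightarrow> 0" "\<And>n. t n \<noteq> 0" and k: "k \<longlonglongrightarrow> k0"
  shows "(\<lambda>n. (jet (x n + t n *\<^sub>R k n) - jet (x n)) /\<^sub>R t n) \<longlonglongrightarrow> jet' x0 k0"
proof -
  have 1: "(\<lambda>n. (A (x n + t n *\<^sub>R k n) - A (x n)) /\<^sub>R t n) \<longlonglongrightarrow> A' x0 k0"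
    by (rule first_difference_limit[OF open_dom A x t k])
  have "(\<lambda>n. (Du (x n + t n *\<^sub>R k n) $ i - Du (x n) $ i) /\<^sub>R t n) \<longlonglongrightarrow> (A x0 *v k0) $ i" for i
  proof (rule first_difference_limit[OF open_dom C2_onD(2)[OF Du] _ x t k])
    show "continuous_on \<Omega> (\<lambda>x. (A x *v v) $ i)" for v
      by (rule C2_on_continuous(2)[OF Du])
  qed
  then have 2: "(\<lambda>n. (Du (x n + t n *\<^sub>R k n) - Du (x n)) /\<^sub>R t n) \<longlonglongrightarrow> A x0 *v k0"
    by (intro vec_tendstoI) simp
  have 3: "(\<lambda>n. (u (x n + t n *\<^sub>R k n) - u (x n)) /\<^sub>R t n) \<longlonglongrightarrow> Du x0 \<bullet> k0"
  proof (rule first_difference_limit[OF open_dom C2_onD(2)[OF u] _ x t k])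
    show "continuous_on \<Omega> (\<lambda>x. Du x \<bullet> v)" for v
      by (rule C2_on_continuous(2)[OF u])
  qed
  have 4: "(\<lambda>n. (x n + t n *\<^sub>R k n - x n) /\<^sub>R t n) \<longlonglongrightarrow> k0" using k t(2) by simp
  show ?thesis using tendsto_Pair[OF 1 tendsto_Pair[OF 2 tendsto_Pair[OF 3 4]]] by simp
qed

text \<open>
  The twice differentiated equation without fourth derivatives of \<open>u\<close>: expand \<open>G\<close> to second order from the jet at
  \<open>x\<close> to the jets at \<open>x \<plusminus> t k\<close>, all three of which are zeros of \<open>G\<close>, and add. The increments of the jet are of
  order \<open>t\<close>, and their sum is a second difference, whose \<open>Du\<close> and \<open>u\<close> components have limits.
\<close>

lemma equation_second_difference:
  assumes x: "x \<longlonglongrightarrow> x0" "x0 \<in> \<Omega>" and t: "t \<longlonglongrightarrow> 0" "\<And>n. t n \<noteq> 0" and k: "k \<longlonglongrightarrow> k0"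
  shows "(\<lambda>n. a (x n) \<bullet> ((A (x n + t n *\<^sub>R k n) + A (x n - t n *\<^sub>R k n) - 2 *\<^sub>R A (x n)) /\<^sub>R (t n)\<^sup>2))
     \<longlonglongrightarrow> - G'' (jet x0) (jet' x0 k0) (jet' x0 k0) - G' (jet x0) (0, A' x0 k0 *v k0, k0 \<bullet> (A x0 *v k0), 0)"
proof -
  have jet0: "jet x0 \<in> UNIV \<times> UNIV \<times> UNIV \<times> \<Omega>" using x by simp
  define P where "P n = jet (x n + t n *\<^sub>R k n) - jet (x n)" for n
  define N where "N n = jet (x n + (- t n) *\<^sub>R k n) - jet (x n)" for n
  have mt: "(\<lambda>n. - t n) \<longlonglongrightarrow> 0" "\<And>n. - t n \<noteq> 0" using tendsto_minus[OF t(1)] t(2) by auto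
  have tk: "(\<lambda>n. t n *\<^sub>R k n) \<longlonglongrightarrow> 0" using tendsto_scaleR[OF t(1) k] by simp
  have xp: "(\<lambda>n. x n + t n *\<^sub>R k n) \<longlonglongrightarrow> x0" using tendsto_add[OF x(1) tk] by simp
  have xm: "(\<lambda>n. x n - t n *\<^sub>R k n) \<longlonglongrightarrow> x0" using tendsto_diff[OF x(1) tk] by simp
  have ev: "\<forall>\<^sub>F n in sequentially. x n \<in> \<Omega> \<and> x n + t n *\<^sub>R k n \<in> \<Omega> \<and> x n - t n *\<^sub>R k n \<in> \<Omega>"
    using topological_tendstoD[OF x(1) open_dom x(2)] topological_tendstoD[OF xp open_dom x(2)]
      topological_tendstoD[OF xm open_dom x(2)] by (simp add: eventually_conj)
  have lP: "(\<lambda>n. (G (jet (x n) + P n) - G (jet (x n)) - G' (jet (x n)) (P n)) / (t n)\<^sup>2)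
     \<longlonglongrightarrow> G'' (jet x0) (jet' x0 k0) (jet' x0 k0) / 2"
    unfolding P_def by (rule second_order_limit[OF G jet_tendsto[OF x(2,1)] jet0 t first_difference_jet[OF x t k]])
  have lN: "(\<lambda>n. (G (jet (x n) + N n) - G (jet (x n)) - G' (jet (x n)) (N n)) / (- t n)\<^sup>2)
     \<longlonglongrightarrow> G'' (jet x0) (jet' x0 k0) (jet' x0 k0) / 2"
    unfolding N_def by (rule second_order_limit[OF G jet_tendsto[OF x(2,1)] jet0 mt first_difference_jet[OF x mt k]])
  define D where "D n = (Du (x n + t n *\<^sub>R k n) + Du (x n - t n *\<^sub>R k n) - 2 *\<^sub>R Du (x n)) /\<^sub>R (t n)\<^sup>2" for n
  define d where "d n = (u (x n + t n *\<^sub>R k n) + u (x n - t n *\<^sub>R k n) - 2 * u (x n)) / (t n)\<^sup>2" for n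
  define B where "B n = (A (x n + t n *\<^sub>R k n) + A (x n - t n *\<^sub>R k n) - 2 *\<^sub>R A (x n)) /\<^sub>R (t n)\<^sup>2" for n
  have "(\<lambda>n. D n $ i) \<longlonglongrightarrow> (A' x0 k0 *v k0) $ i" for i
    using second_difference_limit[OF Du x t k, of i] by (simp add: D_def divide_inverse mult.commute)
  then have D: "D \<longlonglongrightarrow> A' x0 k0 *v k0" by (rule vec_tendstoI)
  have d: "d \<longlonglongrightarrow> k0 \<bullet> (A x0 *v k0)"
    unfolding d_def by (rule second_difference_limit[OF u x t k])
  have lD: "(\<lambda>n. G' (jet (x n)) (0, D n, d n, 0)) \<longlonglongrightarrow> G' (jet x0) (0, A' x0 k0 *v k0, k0 \<bullet> (A x0 *v k0), 0)"
    by (intro C2_on_tendsto(1)[OF G jet_tendsto[OF x(2,1)] jet0] tendsto_Pair tendsto_const D d)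
  have "\<forall>\<^sub>F n in sequentially.
     - ((G (jet (x n) + P n) - G (jet (x n)) - G' (jet (x n)) (P n)) / (t n)\<^sup>2 +
       (G (jet (x n) + N n) - G (jet (x n)) - G' (jet (x n)) (N n)) / (- t n)\<^sup>2)
     - G' (jet (x n)) (0, D n, d n, 0) = a (x n) \<bullet> B n"
    using ev
  proof eventually_elim
    case (elim n)
    let ?L = "G' (jet (x n))"
    have lin: "linear ?L" using C2_on_linear(1)[OF G] elim by simp
    have PN: "(1 / (t n)\<^sup>2) *\<^sub>R (P n + N n) = (B n, 0, 0, 0) + (0, D n, d n, 0)"
      by (simp add: P_def N_def B_def D_def d_def divide_inverse scaleR_2 algebra_simps)
    have zero: "G (jet (x n) + P n) = 0" "G (jet (x n) + N n) = 0" "G (jet (x n)) = 0"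
      using equation elim by (simp_all add: P_def N_def)
    have "?L (P n) / (t n)\<^sup>2 + ?L (N n) / (t n)\<^sup>2 = ?L ((1 / (t n)\<^sup>2) *\<^sub>R (P n + N n))"
      by (simp only: linear_cmul[OF lin] linear_add[OF lin] real_scaleR_def add_divide_distrib distrib_left) simp
    also have "\<dots> = a (x n) \<bullet> B n + ?L (0, D n, d n, 0)"
      unfolding PN linear_add[OF lin] using a elim by simp
    finally show ?case unfolding zero by simp
  qed
  from Lim_transform_eventually[OF tendsto_diff[OF tendsto_minus[OF tendsto_add[OF lP lN]] lD] this]
  show ?thesis by (simp add: B_def)
qed

text \<open>
  If second derivatives of \<open>A\<close> existed, the right-hand side minus the left-hand side would be the pairing of \<open>a\<close> with
  the Hessian at its minimum \<open>x0\<close> of \<open>\<Sum>k. \<xi> k x \<bullet> (A x *v \<xi> k x) - \<psi> x\<close>, with \<open>D\<^sup>2A\<close> eliminated by the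
  equation. To make sense of this, the quadratic forms are replaced by second difference quotients of \<open>u\<close> with step
  \<open>h\<close>. The quotients are twice differentiable, and the margin \<open>\<kappa>\<close> forces their minimum points to converge to
  \<open>x0\<close>; the Hessian there is positive semidefinite, its pairing with \<open>a\<close> is nonnegative, and
  \<open>equation_second_difference\<close> gives the limit.
\<close>

lemma touching_inequality:
  fixes x0 :: "real^'n" and \<zeta> :: "'n \<Rightarrow> real^'n" and M :: "'n \<Rightarrow> real^'n^'n"
  defines "\<xi> \<equiv> \<lambda>k x. \<zeta> k + M k *v (x - x0)"
  assumes x0: "x0 \<in> \<Omega>" "x0 \<in> S" and \<psi>: "C2_on S \<psi> \<psi>' \<psi>''"
    and \<Psi>: "\<And>x v. x \<in> S \<Longrightarrow> \<psi>'' x v v = v \<bullet> (\<Psi> x *v v)" "continuous_on S \<Psi>"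
    and pos: "\<kappa> > 0"
    and above: "\<forall>\<^sub>F x in nhds x0. \<psi> x + \<kappa> * (norm (x - x0))\<^sup>2 \<le> (\<Sum>k\<in>UNIV. \<xi> k x \<bullet> (A x *v \<xi> k x))"
    and eq: "\<psi> x0 = (\<Sum>k\<in>UNIV. \<zeta> k \<bullet> (A x0 *v \<zeta> k))"
  shows "a x0 \<bullet> \<Psi> x0 \<le> (\<Sum>k\<in>UNIV. - G'' (jet x0) (jet' x0 (\<zeta> k)) (jet' x0 (\<zeta> k))
     - G' (jet x0) (0, A' x0 (\<zeta> k) *v \<zeta> k, \<zeta> k \<bullet> (A x0 *v \<zeta> k), 0)
     + 2 * (a x0 \<bullet> (transpose (M k) ** A' x0 (\<zeta> k) + A' x0 (\<zeta> k) ** M k + transpose (M k) ** A x0 ** M k)))"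
proof -
  note oS = C2_onD(1)[OF \<psi>]
  obtain r where r: "r > 0" "\<And>x. x \<in> ball x0 r \<Longrightarrow> \<psi> x + \<kappa> * (norm (x - x0))\<^sup>2 \<le> (\<Sum>k\<in>UNIV. \<xi> k x \<bullet> (A x *v \<xi> k x))"
    using above unfolding eventually_nhds_metric by (auto simp: dist_commute)
  obtain e where e: "e > 0" "ball x0 e \<subseteq> \<Omega> \<inter> S" using open_Int[OF open_dom oS] x0 openE by blast
  define \<rho> where "\<rho> = min r e / 3"
  have \<rho>: "\<rho> > 0" "2 * \<rho> < r" "2 * \<rho> < e" using r(1) e(1) by (auto simp: \<rho>_def min_def)
  have sub: "cball x0 \<rho> \<subseteq> ball x0 r" "cball x0 \<rho> \<subseteq> ball x0 e" "cball x0 (2 * \<rho>) \<subseteq> ball x0 e" using \<rho> by auto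
  \<comment> \<open>\<open>B\<close> bounds all \<open>\<xi> k\<close> near \<open>x0\<close>, so that steps of length \<open>h n\<close> stay in the domain\<close>
  define B where "B = 1 + (\<Sum>k\<in>UNIV. norm (\<zeta> k) + norm (M k) * \<rho>)"
  have B1: "B \<ge> 1" using \<rho>(1) by (simp add: B_def sum_nonneg)
  have \<xi>B: "norm (\<xi> k x) \<le> B" if "x \<in> cball x0 \<rho>" for k x
  proof -
    have "norm (\<xi> k x) \<le> norm (\<zeta> k) + norm (M k *v (x - x0))" unfolding \<xi>_def by (rule norm_triangle_ineq)
    also have "\<dots> \<le> norm (\<zeta> k) + norm (M k) * norm (x - x0)" using norm_matrix_vector_le by simp
    also have "\<dots> \<le> norm (\<zeta> k) + norm (M k) * \<rho>" using that by (simp add: mult_left_mono dist_norm norm_minus_commute)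
    also have "\<dots> \<le> (\<Sum>k\<in>UNIV. norm (\<zeta> k) + norm (M k) * \<rho>)"
      using \<rho>(1) by (intro member_le_sum) auto
    finally show ?thesis by (simp add: B_def)
  qed
  define h where "h n = \<rho> / B / (real n + 1)" for n
  have h: "h n > 0" for n using \<rho>(1) B1 by (simp add: h_def add_nonneg_pos)
  then have hne: "h n \<noteq> 0" for n by (metis less_irrefl)
  have hB: "h n * B \<le> \<rho>" for n
    using \<rho>(1) B1 by (simp add: h_def divide_le_eq mult_le_cancel_left1)
  have h0: "h \<longlonglongrightarrow> 0" unfolding h_def
    by (rule real_tendsto_divide_at_top[OF tendsto_const])
       (auto intro!: filterlim_tendsto_add_at_top filterlim_real_sequentially simp: add.commute[of _ 1])
  have in2: "x + h n *\<^sub>R \<xi> k x \<in> cball x0 (2 * \<rho>)" "x - h n *\<^sub>R \<xi> k x \<in> cball x0 (2 * \<rho>)" if "x \<in> cball x0 \<rho>" for x n k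
  proof -
    have "norm (h n *\<^sub>R \<xi> k x) \<le> h n * B" using h[of n] \<xi>B[OF that, of k] by (simp add: mult_left_mono)
    then have *: "norm (h n *\<^sub>R \<xi> k x) \<le> \<rho>" using hB[of n] by linarith
    have d: "norm (x0 - x) \<le> \<rho>" using that by (simp add: dist_norm)
    have "norm (x0 - x - h n *\<^sub>R \<xi> k x) \<le> \<rho> + \<rho>" "norm (x0 - x + h n *\<^sub>R \<xi> k x) \<le> \<rho> + \<rho>"
      using norm_triangle_le_diff[OF add_mono[OF d *]] norm_triangle_le[OF add_mono[OF d *]] by auto
    then show "x + h n *\<^sub>R \<xi> k x \<in> cball x0 (2 * \<rho>)" "x - h n *\<^sub>R \<xi> k x \<in> cball x0 (2 * \<rho>)"
      by (simp_all add: dist_norm algebra_simps)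
  qed
  have inO: "x + h n *\<^sub>R \<xi> k x \<in> \<Omega>" "x - h n *\<^sub>R \<xi> k x \<in> \<Omega>" "x \<in> \<Omega>" "x \<in> S" if "x \<in> cball x0 \<rho>" for x n k
    using in2[OF that, of n k] that sub e by blast+
  \<comment> \<open>the discretised function; its minimum points \<open>y n\<close> exist by compactness\<close>
  define Q where "Q n x = (\<Sum>k\<in>UNIV. (u (x + h n *\<^sub>R \<xi> k x) + u (x - h n *\<^sub>R \<xi> k x) - 2 * u x) / (h n)\<^sup>2) - \<psi> x" for n x
  have cu: "continuous_on \<Omega> u"
    by (rule C2_on_continuous(1)[OF u])
  have c\<psi>: "continuous_on S \<psi>"
    by (rule C2_on_continuous(1)[OF \<psi>])
  have c\<xi>: "continuous_on X (\<xi> k)" for k X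
    unfolding \<xi>_def by (intro continuous_intros continuous_on_matrix_vector)
  have "continuous_on (cball x0 \<rho>) (Q n)" for n
    unfolding Q_def
    by (intro continuous_intros continuous_on_compose2[OF cu] continuous_on_subset[OF c\<psi>] c\<xi>)
       (use inO hne in \<open>auto simp del: mem_cball\<close>)
  then have "\<exists>y. y \<in> cball x0 \<rho> \<and> (\<forall>x\<in>cball x0 \<rho>. Q n y \<le> Q n x)" for n
    using continuous_attains_inf[of "cball x0 \<rho>" "Q n"] \<rho>(1) by auto
  then obtain y where y: "\<And>n. y n \<in> cball x0 \<rho>" "\<And>n x. x \<in> cball x0 \<rho> \<Longrightarrow> Q n (y n) \<le> Q n x"
    by metis
  obtain l s where l: "l \<in> cball x0 \<rho>" and s: "strict_mono s" and yl: "(y \<circ> s) \<longlonglongrightarrow> l"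
    using compact_imp_seq_compact[OF compact_cball[of x0 \<rho>]] y(1) unfolding seq_compact_def by meson
  define x where "x n = y (s n)" for n
  define t where "t n = h (s n)" for n
  have xl: "x \<longlonglongrightarrow> l" proof -
    have "x = y \<circ> s" by (simp add: fun_eq_iff x_def)
    then show ?thesis using yl by simp
  qed
  have t0: "t \<longlonglongrightarrow> 0" proof -
    have "t = h \<circ> s" by (simp add: fun_eq_iff t_def)
    then show ?thesis using LIMSEQ_subseq_LIMSEQ[OF h0 s] by simp
  qed
  have tne: "t n \<noteq> 0" for n using hne by (simp add: t_def)
  have \<xi>lim: "(\<lambda>n. \<xi> k (w n)) \<longlonglongrightarrow> \<xi> k w0" if "w \<longlonglongrightarrow> w0" for k w w0
    unfolding \<xi>_def by (intro tendsto_intros tendsto_matrix_vector that)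
  have Qlim: "(\<lambda>n. Q (s n) (w n)) \<longlonglongrightarrow> (\<Sum>k\<in>UNIV. \<xi> k w0 \<bullet> (A w0 *v \<xi> k w0)) - \<psi> w0"
    if w: "w \<longlonglongrightarrow> w0" "w0 \<in> cball x0 \<rho>" for w w0
  proof -
    have w0: "w0 \<in> \<Omega>" "w0 \<in> S" using w(2) sub e by auto
    have "(\<lambda>n. \<psi> (w n)) \<longlonglongrightarrow> \<psi> w0"
      using isCont_tendsto_compose[OF has_derivative_continuous[OF C2_onD(2)[OF \<psi> w0(2)]] w(1)] .
    then show ?thesis unfolding Q_def t_def[symmetric]
      by (intro tendsto_intros second_difference_limit[OF u w(1) w0(1) t0 tne] \<xi>lim w)
  qed
  \<comment> \<open>the limit of minimum points minimises the limit function, and only \<open>x0\<close> does\<close>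
  have "(\<Sum>k\<in>UNIV. \<xi> k l \<bullet> (A l *v \<xi> k l)) - \<psi> l \<le> (\<Sum>k\<in>UNIV. \<xi> k x0 \<bullet> (A x0 *v \<xi> k x0)) - \<psi> x0"
    using \<rho>(1) y(2)[of x0] by (intro LIMSEQ_le[OF Qlim[OF xl l] Qlim[OF tendsto_const]]) (auto simp: x_def)
  also have "\<dots> = 0" unfolding eq \<xi>_def by simp
  finally have "\<kappa> * (norm (l - x0))\<^sup>2 \<le> 0" using r(2)[of l] l sub by fastforce
  then have l0: "l = x0" using pos by (simp add: mult_le_0_iff)
  note xl = xl[unfolded l0]
  have \<zeta>0: "\<xi> k x0 = \<zeta> k" for k by (simp add: \<xi>_def)
  have \<xi>x: "(\<lambda>n. \<xi> k (x n)) \<longlonglongrightarrow> \<zeta> k" for k using \<xi>lim[OF xl, of k] by (simp add: \<zeta>0)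
  have ev: "\<forall>\<^sub>F n in sequentially. x n \<in> ball x0 \<rho>"
    using topological_tendstoD[OF xl open_ball, of x0 \<rho>] \<rho>(1) by simp
  define Ap where "Ap k n = A (x n + t n *\<^sub>R \<xi> k (x n))" for k n
  define Am where "Am k n = A (x n - t n *\<^sub>R \<xi> k (x n))" for k n
  define Z where "Z k n = (1 / (t n)\<^sup>2) *\<^sub>R (transpose (mat 1 + t n *\<^sub>R M k) ** Ap k n ** (mat 1 + t n *\<^sub>R M k)
     + transpose (mat 1 - t n *\<^sub>R M k) ** Am k n ** (mat 1 - t n *\<^sub>R M k) - 2 *\<^sub>R A (x n))" for k n
  \<comment> \<open>the second difference of \<open>Q\<close> at its minimum is nonnegative; since \<open>\<xi> k\<close> is affine, it splits into second differences of \<open>u\<close> in the directions \<open>v \<plusminus> t M v\<close>\<close>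
  have Zpsd: "0 \<le> v \<bullet> (((\<Sum>k\<in>UNIV. Z k n) - \<Psi> (x n)) *v v)" if xn: "x n \<in> ball x0 \<rho>" for n v
  proof -
    have xnc: "x n \<in> cball x0 \<rho>" using xn by simp
    have xO: "x n \<in> \<Omega>" "x n \<in> S" using xnc sub e by auto
    have pmO: "x n + t n *\<^sub>R \<xi> k (x n) \<in> \<Omega>" "x n - t n *\<^sub>R \<xi> k (x n) \<in> \<Omega>" for k
      using in2[OF xnc, of "s n" k] sub e unfolding t_def by blast+
    define \<tau> where "\<tau> m = inverse (real (Suc m))" for m
    have \<tau>: "\<tau> \<longlonglongrightarrow> 0" "\<tau> m \<noteq> 0" for m unfolding \<tau>_def using LIMSEQ_inverse_real_of_nat by auto
    define q where "q m = (Q (s n) (x n + \<tau> m *\<^sub>R v) + Q (s n) (x n - \<tau> m *\<^sub>R v) - 2 * Q (s n) (x n)) / (\<tau> m)\<^sup>2" for m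
    have "\<forall>\<^sub>F m in sequentially. x n + \<tau> m *\<^sub>R v \<in> ball x0 \<rho> \<and> x n - \<tau> m *\<^sub>R v \<in> ball x0 \<rho>"
    proof -
      have "(\<lambda>m. x n + \<tau> m *\<^sub>R v) \<longlonglongrightarrow> x n + 0 *\<^sub>R v" "(\<lambda>m. x n - \<tau> m *\<^sub>R v) \<longlonglongrightarrow> x n - 0 *\<^sub>R v"
        by (intro tendsto_intros \<tau>)+
      then show ?thesis using xn topological_tendstoD[OF _ open_ball, of _ _ sequentially x0 \<rho>]
        by (simp add: eventually_conj)
    qed
    then have qnn: "\<forall>\<^sub>F m in sequentially. 0 \<le> q m"
    proof eventually_elim
      case (elim m)
      then have "Q (s n) (x n) \<le> Q (s n) (x n + \<tau> m *\<^sub>R v)" "Q (s n) (x n) \<le> Q (s n) (x n - \<tau> m *\<^sub>R v)"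
        using y(2)[of _ "s n"] unfolding x_def by auto
      then show ?case unfolding q_def by (intro divide_nonneg_nonneg) auto
    qed
    let ?p = "\<lambda>k. v + t n *\<^sub>R (M k *v v)" and ?m = "\<lambda>k. v - t n *\<^sub>R (M k *v v)"
    have q_eq: "q m = (\<Sum>k\<in>UNIV.
        ((u ((x n + t n *\<^sub>R \<xi> k (x n)) + \<tau> m *\<^sub>R ?p k) + u ((x n + t n *\<^sub>R \<xi> k (x n)) - \<tau> m *\<^sub>R ?p k) - 2 * u (x n + t n *\<^sub>R \<xi> k (x n))) / (\<tau> m)\<^sup>2
        + (u ((x n - t n *\<^sub>R \<xi> k (x n)) + \<tau> m *\<^sub>R ?m k) + u ((x n - t n *\<^sub>R \<xi> k (x n)) - \<tau> m *\<^sub>R ?m k) - 2 * u (x n - t n *\<^sub>R \<xi> k (x n))) / (\<tau> m)\<^sup>2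
        - 2 * ((u (x n + \<tau> m *\<^sub>R v) + u (x n - \<tau> m *\<^sub>R v) - 2 * u (x n)) / (\<tau> m)\<^sup>2)) / (t n)\<^sup>2)
        - (\<psi> (x n + \<tau> m *\<^sub>R v) + \<psi> (x n - \<tau> m *\<^sub>R v) - 2 * \<psi> (x n)) / (\<tau> m)\<^sup>2" for m
    proof -
      have \<xi>aff: "\<xi> k (x n + \<tau> m *\<^sub>R v) = \<xi> k (x n) + \<tau> m *\<^sub>R (M k *v v)"
         "\<xi> k (x n - \<tau> m *\<^sub>R v) = \<xi> k (x n) - \<tau> m *\<^sub>R (M k *v v)" for k
        unfolding \<xi>_def by (simp_all add: matrix_vector_bilinear_simps algebra_simps)
      have arg: "x n + \<tau> m *\<^sub>R v + t n *\<^sub>R (\<xi> k (x n) + \<tau> m *\<^sub>R (M k *v v)) = (x n + t n *\<^sub>R \<xi> k (x n)) + \<tau> m *\<^sub>R ?p k"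
        "x n + \<tau> m *\<^sub>R v - t n *\<^sub>R (\<xi> k (x n) + \<tau> m *\<^sub>R (M k *v v)) = (x n - t n *\<^sub>R \<xi> k (x n)) + \<tau> m *\<^sub>R ?m k"
        "x n - \<tau> m *\<^sub>R v + t n *\<^sub>R (\<xi> k (x n) - \<tau> m *\<^sub>R (M k *v v)) = (x n + t n *\<^sub>R \<xi> k (x n)) - \<tau> m *\<^sub>R ?p k"
        "x n - \<tau> m *\<^sub>R v - t n *\<^sub>R (\<xi> k (x n) - \<tau> m *\<^sub>R (M k *v v)) = (x n - t n *\<^sub>R \<xi> k (x n)) - \<tau> m *\<^sub>R ?m k" for k
        by (simp_all add: algebra_simps)
      show ?thesis
        unfolding q_def Q_def \<xi>aff arg t_def[symmetric]
        by (simp add: sum.distrib sum_subtractf sum_divide_distrib[symmetric] add_divide_distrib diff_divide_distrib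
              sum_distrib_left[symmetric] mult.commute) (simp add: distrib_left right_diff_distrib)
    qed
    have "q \<longlonglongrightarrow> (\<Sum>k\<in>UNIV. (?p k \<bullet> (Ap k n *v ?p k) + ?m k \<bullet> (Am k n *v ?m k) - 2 * (v \<bullet> (A (x n) *v v))) / (t n)\<^sup>2) - \<psi>'' (x n) v v"
      unfolding q_eq Ap_def Am_def
      by (intro tendsto_intros second_difference_limit[OF u] second_difference_limit[OF \<psi>] pmO xO \<tau>) (simp add: tne)
    also have "(\<Sum>k\<in>UNIV. (?p k \<bullet> (Ap k n *v ?p k) + ?m k \<bullet> (Am k n *v ?m k) - 2 * (v \<bullet> (A (x n) *v v))) / (t n)\<^sup>2) - \<psi>'' (x n) v v
       = v \<bullet> (((\<Sum>k\<in>UNIV. Z k n) - \<Psi> (x n)) *v v)"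
    proof -
      have pm: "(mat 1 + t n *\<^sub>R M k) *v v = ?p k" "(mat 1 - t n *\<^sub>R M k) *v v = ?m k" for k
        by (simp_all add: matrix_vector_bilinear_simps)
      have "v \<bullet> (Z k n *v v) = (?p k \<bullet> (Ap k n *v ?p k) + ?m k \<bullet> (Am k n *v ?m k) - 2 * (v \<bullet> (A (x n) *v v))) / (t n)\<^sup>2" for k
        unfolding Z_def matrix_vector_bilinear_simps inner_scaleR_right inner_add_right inner_diff_right quadratic_congruence
        unfolding matrix_vector_bilinear_simps(1,3,5,7)[symmetric] pm by simp
      moreover have "(\<Sum>k\<in>UNIV. Z k n) *v v = (\<Sum>k\<in>UNIV. Z k n *v v)"
        by (rule bounded_bilinear.sum_left[OF bounded_bilinear_matrix_vector])
      ultimately show ?thesis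
        by (simp add: matrix_vector_bilinear_simps inner_diff_right inner_sum_right \<Psi>(1)[OF xO(2)])
    qed
    finally have "q \<longlonglongrightarrow> v \<bullet> (((\<Sum>k\<in>UNIV. Z k n) - \<Psi> (x n)) *v v)" .
    from tendsto_lowerbound[OF this qnn] show ?thesis by simp
  qed
  have nn: "\<forall>\<^sub>F n in sequentially. 0 \<le> a (x n) \<bullet> ((\<Sum>k\<in>UNIV. Z k n) - \<Psi> (x n))"
    using ev
  proof eventually_elim
    case (elim n)
    then have "x n \<in> \<Omega>" by (intro inO(3)) simp
    from psd_inner_nonneg[OF a_psd[OF this] Zpsd[OF elim]] show ?case .
  qed
  \<comment> \<open>the terms are grouped by order: \<open>1 / t\<^sup>2\<close> (governed by the equation), \<open>1 / t\<close> and \<open>1\<close>\<close>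
  have Zexp: "Z k n = (Ap k n + Am k n - 2 *\<^sub>R A (x n)) /\<^sub>R (t n)\<^sup>2
      + (transpose (M k) ** (((Ap k n - A (x n)) /\<^sub>R t n) + ((Am k n - A (x n)) /\<^sub>R (- t n)))
        + (((Ap k n - A (x n)) /\<^sub>R t n) + ((Am k n - A (x n)) /\<^sub>R (- t n))) ** M k)
      + transpose (M k) ** (Ap k n + Am k n) ** M k" for k n
  proof -
    have r: "1 / (t n)\<^sup>2 * (t n * t n) = 1" "1 / (t n)\<^sup>2 * t n = inverse (t n)"
      using tne[of n] by (simp_all add: power2_eq_square field_simps)
    have "(1 / (t n)\<^sup>2) *\<^sub>R ((t n * t n) *\<^sub>R X) = X" "(1 / (t n)\<^sup>2) *\<^sub>R (t n *\<^sub>R X) = X /\<^sub>R t n" for X :: "real^'n^'n"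
      by (simp_all only: scaleR_scaleR r scaleR_one)
    note sc = this
    have *: "Z k n = (1 / (t n)\<^sup>2) *\<^sub>R (Ap k n + Am k n - 2 *\<^sub>R A (x n))
       + (1 / (t n)\<^sup>2) *\<^sub>R (t n *\<^sub>R (transpose (M k) ** (Ap k n - Am k n) + (Ap k n - Am k n) ** M k))
       + (1 / (t n)\<^sup>2) *\<^sub>R ((t n * t n) *\<^sub>R (transpose (M k) ** (Ap k n + Am k n) ** M k))"
      unfolding Z_def scaleR_add_right[symmetric]
      by (simp add: matrix_bilinear_simps transpose_simps matrix_mul_assoc algebra_simps)
    have "((Ap k n - A (x n)) /\<^sub>R t n) + ((Am k n - A (x n)) /\<^sub>R (- t n)) = (Ap k n - Am k n) /\<^sub>R t n"
      by (simp add: algebra_simps)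
    then show ?thesis unfolding * sc
      by (simp add: matrix_bilinear_simps divide_inverse scaleR_add_right)
  qed
  have lim1: "(\<lambda>n. a (x n) \<bullet> ((Ap k n + Am k n - 2 *\<^sub>R A (x n)) /\<^sub>R (t n)\<^sup>2)) \<longlonglongrightarrow>
      - G'' (jet x0) (jet' x0 (\<zeta> k)) (jet' x0 (\<zeta> k)) - G' (jet x0) (0, A' x0 (\<zeta> k) *v \<zeta> k, \<zeta> k \<bullet> (A x0 *v \<zeta> k), 0)" for k
    unfolding Ap_def Am_def by (rule equation_second_difference[OF xl x0(1) t0 tne \<xi>x])
  have mt: "(\<lambda>n. - t n) \<longlonglongrightarrow> 0" "\<And>n. - t n \<noteq> 0" using tendsto_minus[OF t0] tne by auto
  have dp: "(\<lambda>n. (Ap k n - A (x n)) /\<^sub>R t n) \<longlonglongrightarrow> A' x0 (\<zeta> k)" for k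
    unfolding Ap_def by (rule first_difference_limit[OF open_dom A xl x0(1) t0 tne \<xi>x])
  have dm: "(\<lambda>n. (Am k n - A (x n)) /\<^sub>R (- t n)) \<longlonglongrightarrow> A' x0 (\<zeta> k)" for k
    using first_difference_limit[OF open_dom A xl x0(1) mt \<xi>x[of k]] unfolding Am_def by simp
  have t\<xi>: "(\<lambda>n. t n *\<^sub>R \<xi> k (x n)) \<longlonglongrightarrow> 0" for k using tendsto_scaleR[OF t0 \<xi>x[of k]] by simp
  have Aplim: "Ap k \<longlonglongrightarrow> A x0" for k unfolding Ap_def
    by (rule continuous_data(1)[OF x0(1)]) (use tendsto_add[OF xl t\<xi>[of k]] in simp)
  have Amlim: "Am k \<longlonglongrightarrow> A x0" for k unfolding Am_def
    by (rule continuous_data(1)[OF x0(1)]) (use tendsto_diff[OF xl t\<xi>[of k]] in simp)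
  have \<Psi>lim: "(\<lambda>n. \<Psi> (x n)) \<longlonglongrightarrow> \<Psi> x0"
    using \<Psi>(2) oS x0(2) xl by (metis continuous_on_eq_continuous_at isCont_tendsto_compose)
  note alim = a_tendsto[OF x0(1) xl]
  have "(\<lambda>n. a (x n) \<bullet> ((\<Sum>k\<in>UNIV. Z k n) - \<Psi> (x n))) \<longlonglongrightarrow>
    (\<Sum>k\<in>UNIV. (- G'' (jet x0) (jet' x0 (\<zeta> k)) (jet' x0 (\<zeta> k)) - G' (jet x0) (0, A' x0 (\<zeta> k) *v \<zeta> k, \<zeta> k \<bullet> (A x0 *v \<zeta> k), 0))
      + a x0 \<bullet> (transpose (M k) ** (A' x0 (\<zeta> k) + A' x0 (\<zeta> k)) + ((A' x0 (\<zeta> k) + A' x0 (\<zeta> k)) ** M k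
      + transpose (M k) ** (A x0 + A x0) ** M k))) - a x0 \<bullet> \<Psi> x0"
    unfolding Zexp inner_diff_right inner_sum_right add.assoc[of "_ /\<^sub>R _" "_ + _" "_ ** _"] add.assoc[of "_ ** _" "_ ** _" "_ ** _"] inner_add_right[of "a _" "_ /\<^sub>R _" "_ + _"]
    by (intro tendsto_intros lim1 alim \<Psi>lim tendsto_matrix_matrix dp dm Aplim Amlim)
  from tendsto_lowerbound[OF this nn]
  show ?thesis
    unfolding scaleR_2[symmetric]
    by (simp add: matrix_bilinear_simps inner_add_right distrib_left add.assoc)
qed

end

section \<open>The differential inequality at a touching point\<close>

text \<open>
  Split \<open>f x = \<alpha> U + b\<close> with \<open>b\<close> orthogonal to \<open>U\<close>. Then \<open>norm (f x) - \<alpha> = |b|\<^sup>2 / (norm (f x) + \<alpha>)\<close>, where the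
  denominator tends to \<open>2 norm s0\<close> and \<open>b\<close> is, to first order, the orthogonal part of the derivative. Only one
  derivative of \<open>f\<close> enters this second-order bound.
\<close>

lemma norm_second_order_lower_bound:
  fixes f :: "'a::euclidean_space \<Rightarrow> 'b::euclidean_space"
  assumes f: "(f has_derivative f') (at x0)" and s0: "f x0 = s0" "s0 \<noteq> 0" and pos: "\<kappa> > 0"
  defines "U \<equiv> s0 /\<^sub>R norm s0"
  shows "\<forall>\<^sub>F x in nhds x0. norm s0 + U \<bullet> (f x - s0)
     + (norm (f' (x - x0) - (U \<bullet> f' (x - x0)) *\<^sub>R U))\<^sup>2 / (2 * norm s0) - \<kappa> * (norm (x - x0))\<^sup>2 \<le> norm (f x)"
proof -
  define r where "r = norm s0"
  have r: "r > 0" using s0 by (simp add: r_def)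
  have U1: "U \<bullet> U = 1" using s0(2) by (simp add: U_def dot_square_norm power2_eq_square)
  then have nU: "norm U = 1" by (simp add: norm_eq_sqrt_inner)
  have Us: "r *\<^sub>R U = s0" "U \<bullet> s0 = r" using s0(2) by (simp_all add: U_def r_def dot_square_norm power2_eq_square)
  define T where "T X = f' X - (U \<bullet> f' X) *\<^sub>R U" for X
  have bl: "bounded_linear f'" using f has_derivative_bounded_linear by blast
  then obtain K0 where K0: "\<And>X. norm (f' X) \<le> norm X * K0" "K0 \<ge> 0" using bounded_linear.nonneg_bounded by blast
  define K where "K = 2 * K0 + 1"
  have K: "K > 0" using K0 by (simp add: K_def)
  have proj: "norm (w - (U \<bullet> w) *\<^sub>R U) \<le> 2 * norm w" for w
  proof -
    have "norm (w - (U \<bullet> w) *\<^sub>R U) \<le> norm w + \<bar>U \<bullet> w\<bar>" using norm_triangle_ineq4[of w "(U \<bullet> w) *\<^sub>R U"] nU by simp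
    also have "\<bar>U \<bullet> w\<bar> \<le> norm w" using Cauchy_Schwarz_ineq2[of U w] nU by simp
    finally show ?thesis by simp
  qed
  have TK: "norm (T X) \<le> K * norm X" for X
  proof -
    have "norm (T X) \<le> 2 * (norm X * K0)" using proj[of "f' X"] K0(1)[of X] by (simp add: T_def)
    also have "\<dots> \<le> K * norm X" by (simp add: K_def algebra_simps)
    finally show ?thesis .
  qed
  define \<alpha> where "\<alpha> x = r + U \<bullet> (f x - s0)" for x
  define b where "b x = (f x - s0) - (U \<bullet> (f x - s0)) *\<^sub>R U" for x
  have sq: "(norm (f x))\<^sup>2 = (\<alpha> x)\<^sup>2 + (norm (b x))\<^sup>2" for x
  proof -
    have fx: "f x = \<alpha> x *\<^sub>R U + b x" using Us by (simp add: \<alpha>_def b_def algebra_simps)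
    have "U \<bullet> b x = 0" using U1 by (simp add: b_def inner_diff_right)
    then show ?thesis unfolding fx power2_norm_eq_inner
      using U1 by (simp add: inner_add_left inner_add_right inner_commute[of "b x" U] power2_eq_square)
  qed
  have cont: "isCont f x0" using f has_derivative_continuous by blast
  have fl: "(f \<longlongrightarrow> s0) (nhds x0)"
    using cont s0(1) unfolding isCont_def tendsto_at_iff_tendsto_nhds by simp
  have al: "(\<alpha> \<longlongrightarrow> r + U \<bullet> (s0 - s0)) (nhds x0)" unfolding \<alpha>_def by (intro tendsto_intros fl)
  have nl: "((\<lambda>x. norm (f x)) \<longlongrightarrow> r) (nhds x0)" unfolding r_def by (intro tendsto_intros fl)
  have gl: "((\<lambda>x. 1 / (norm (f x) + \<alpha> x)) \<longlongrightarrow> 1 / (2 * r)) (nhds x0)"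
    using tendsto_divide[OF tendsto_const tendsto_add[OF nl al], of 1] r by (simp)
  \<comment> \<open>the two sources of error get half of \<open>\<kappa>\<close> each\<close>
  define e1 where "e1 = \<kappa> / (2 * K\<^sup>2)"
  define e2 where "e2 = \<kappa> * r / (8 * K)"
  have e1: "e1 > 0" and e2: "e2 > 0" using pos K r by (simp_all add: e1_def e2_def)
  have ev1: "\<forall>\<^sub>F x in nhds x0. 1 / (2 * r) - e1 < 1 / (norm (f x) + \<alpha> x)"
    using gl e1 by (intro order_tendstoD) auto
  have ev2: "\<forall>\<^sub>F x in nhds x0. 1 / (norm (f x) + \<alpha> x) < 1 / r"
    using r by (intro order_tendstoD(2)[OF gl]) (simp add: field_simps)
  have ev3: "\<forall>\<^sub>F x in nhds x0. norm (f x) + \<alpha> x > 0"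
    using order_tendstoD(1)[OF tendsto_add[OF nl al], of 0] r by simp
  have ev4: "\<forall>\<^sub>F x in nhds x0. norm (f x - s0 - f' (x - x0)) \<le> e2 * norm (x - x0)"
    using f e2 s0(1) unfolding has_derivative_at_alt eventually_nhds_metric by (auto simp: dist_norm)
  show ?thesis
    using ev1 ev2 ev3 ev4
  proof eventually_elim
    case (elim x)
    let ?X = "x - x0" and ?g = "1 / (norm (f x) + \<alpha> x)"
    define e where "e = b x - T ?X"
    have "e = (f x - s0 - f' ?X) - (U \<bullet> (f x - s0 - f' ?X)) *\<^sub>R U"
      by (simp add: e_def b_def T_def inner_diff_right algebra_simps)
    then have ne: "norm e \<le> 2 * e2 * norm ?X" using proj[of "f x - s0 - f' ?X"] elim(4) by simp
    have "(norm (b x))\<^sup>2 = (norm (T ?X))\<^sup>2 + 2 * (T ?X \<bullet> e) + (norm e)\<^sup>2"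
      by (simp add: e_def power2_norm_eq_inner inner_diff_left inner_diff_right inner_commute algebra_simps)
    moreover have "\<bar>T ?X \<bullet> e\<bar> \<le> 2 * K * e2 * (norm ?X)\<^sup>2"
    proof -
      have "\<bar>T ?X \<bullet> e\<bar> \<le> norm (T ?X) * norm e" by (rule Cauchy_Schwarz_ineq2)
      also have "\<dots> \<le> (K * norm ?X) * (2 * e2 * norm ?X)" using K by (intro mult_mono TK ne) auto
      finally show ?thesis by (simp add: power2_eq_square mult_ac)
    qed
    ultimately have bsq: "(norm (b x))\<^sup>2 \<ge> (norm (T ?X))\<^sup>2 - 4 * K * e2 * (norm ?X)\<^sup>2"
      using zero_le_power2[of "norm e"] unfolding abs_le_iff by linarith
    have "norm (f x) - \<alpha> x = (norm (b x))\<^sup>2 * ?g"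
    proof -
      have "(norm (f x) - \<alpha> x) * (norm (f x) + \<alpha> x) = (norm (b x))\<^sup>2"
        using sq[of x] by (simp add: power2_eq_square algebra_simps)
      then show ?thesis using elim(3) by (simp add: eq_divide_eq)
    qed
    also have "\<dots> \<ge> ((norm (T ?X))\<^sup>2 - 4 * K * e2 * (norm ?X)\<^sup>2) * ?g"
      using bsq elim(3) by (intro mult_right_mono) auto
    finally have 1: "norm (f x) - \<alpha> x \<ge> (norm (T ?X))\<^sup>2 * ?g - (4 * K * e2 * (norm ?X)\<^sup>2) * ?g"
      by (simp only: left_diff_distrib)
    have 2: "(norm (T ?X))\<^sup>2 * ?g \<ge> (norm (T ?X))\<^sup>2 * (1 / (2 * r) - e1)"
      using elim(1) by (intro mult_left_mono) auto
    have "(norm (T ?X))\<^sup>2 * e1 \<le> (K * norm ?X)\<^sup>2 * e1"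
      using TK[of ?X] e1 by (intro mult_right_mono power_mono) auto
    also have "\<dots> = \<kappa> / 2 * (norm ?X)\<^sup>2" using K by (simp add: e1_def power_mult_distrib)
    finally have 3: "(norm (T ?X))\<^sup>2 * e1 \<le> \<kappa> / 2 * (norm ?X)\<^sup>2" .
    have "(4 * K * e2 * (norm ?X)\<^sup>2) * ?g \<le> (4 * K * e2 * (norm ?X)\<^sup>2) * (1 / r)"
      using elim(2) K e2 by (intro mult_left_mono) auto
    also have "\<dots> = \<kappa> / 2 * (norm ?X)\<^sup>2" using K r by (simp add: e2_def)
    finally have 4: "(4 * K * e2 * (norm ?X)\<^sup>2) * ?g \<le> \<kappa> / 2 * (norm ?X)\<^sup>2" .
    have "norm (f x) - \<alpha> x \<ge> (norm (T ?X))\<^sup>2 / (2 * r) - \<kappa> * (norm ?X)\<^sup>2"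
      using 1 2 3 4 by (simp add: right_diff_distrib)
    then show ?case by (simp add: \<alpha>_def r_def T_def)
  qed
qed

lemma norm_le_sum_rows: "norm (X :: real^'n^'m) \<le> (\<Sum>i\<in>UNIV. norm (X $ i))"
  unfolding norm_vec_def by (rule L2_set_le_sum) simp

text \<open>
  The constants are explicit in order to show that they do not depend on the touching function.
\<close>

definition error_const :: "real \<Rightarrow> real \<Rightarrow> real" where
  "error_const B l = B * ((3 + l) * ((B^5 + 6 * B) * l)) + B * (l + 1) + 2 * (B * ((2 + l) * (B * l * B)))"

definition touch_const :: "real \<Rightarrow> real \<Rightarrow> real \<Rightarrow> real \<Rightarrow> real" where
  "touch_const i n B \<theta> = (let C = error_const B (i + B * B) * 2 * n in C + n * ((C * (1 + 2 * i))\<^sup>2 / (4 * \<theta>)))"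

context elliptic_solution
begin

text \<open>
  Among the matrices with \<open>H A M = M\<close>, this \<open>M\<close> minimises the quadratic expression in \<open>M\<close>. It turns
  the last term into \<open>- 2 a \<bullet> W\<close> with \<open>W = A\<^sub>\<xi> H A\<^sub>\<xi>\<close>. The convexity inequality for \<open>K = H A\<^sub>\<xi> H\<close> has \<open>P A\<^sub>\<xi> P\<^sup>T\<close> and
  \<open>P W P\<^sup>T\<close> in place of \<open>A\<^sub>\<xi>\<close> and \<open>W\<close>, where \<open>P = A H = 1 - L\<^sup>T\<close>, and \<open>0\<close> in place of the gradient variation
  \<open>A \<xi> = S c\<close>. Each discrepancy has a factor \<open>A\<^sub>\<xi> L\<close> or \<open>S\<close>.
\<close>

lemma error_bound:
  fixes H :: "real^'n^'n" and c :: "real^'n"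
  assumes x0: "x0 \<in> \<Omega>" and H: "H \<in> Sym" "H ** A x0 ** H = H"
    and bound: "data_bound B x0" "norm H \<le> B"
  defines "L \<equiv> mat 1 - H ** A x0"
  defines "Sd \<equiv> \<lambda>X. transpose L ** A' x0 X ** L"
  defines "\<xi> \<equiv> L *v c" and "M \<equiv> - (H ** A' x0 (L *v c))"
  shows "- G'' (jet x0) (jet' x0 \<xi>) (jet' x0 \<xi>)
     - G' (jet x0) (0, A' x0 \<xi> *v \<xi>, \<xi> \<bullet> (A x0 *v \<xi>), 0)
     + 2 * (a x0 \<bullet> (transpose M ** A' x0 \<xi> + A' x0 \<xi> ** M + transpose M ** A x0 ** M))
     \<le> error_const B (norm (mat 1::real^'n^'n) + B * B) * (norm c)\<^sup>2 * ((\<Sum>i\<in>UNIV. norm (Sd (axis i 1))) + norm (A x0 - A x0 ** H ** A x0))"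
proof -
  have B: "B \<ge> 1" "norm (A x0) \<le> B" "\<And>v. norm (A' x0 v) \<le> B * norm v" "norm (a x0) \<le> B" "norm (Du x0) \<le> B"
      "\<And>k. \<bar>G' (jet x0) k\<bar> \<le> B * norm k" "\<And>k l. \<bar>G'' (jet x0) k l\<bar> \<le> B * norm k * norm l" "norm H \<le> B"
    using bound unfolding data_bound_def by blast+
  define l where "l = norm (mat 1::real^'n^'n) + B * B"
  define S0 where "S0 = A x0 - A x0 ** H ** A x0"
  define \<delta> where "\<delta> = (\<Sum>i\<in>UNIV. norm (Sd (axis i 1)))"
  define e where "e = \<delta> + norm S0"
  define A1 where "A1 = A' x0 \<xi>"
  let ?A = "A x0"
  have tA: "transpose ?A = ?A" using A_psd[OF x0] by (simp add: psd_def Sym_def)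
  have tH: "transpose H = H" using H(1) by (simp add: Sym_def)
  have tA': "transpose (A' x0 v) = A' x0 v" for v using A'_sym(1)[OF x0] by (simp add: Sym_def)
  have tA1: "transpose A1 = A1" by (simp add: A1_def tA')
  have tL: "transpose L = mat 1 - ?A ** H" by (simp add: L_def transpose_simps matrix_transpose_mul tA tH)
  have AL: "?A ** L = S0" by (simp add: L_def S0_def matrix_bilinear_simps matrix_mul_assoc)
  have \<delta>0: "\<delta> \<ge> 0" by (simp add: \<delta>_def sum_nonneg)
  have e0: "e \<ge> 0" "\<delta> \<le> e" "norm S0 \<le> e" using \<delta>0 by (simp_all add: e_def)
  have l0: "l \<ge> 0" using B(1) by (simp add: l_def)
  have nL: "norm L \<le> l"
  proof -
    have "norm L \<le> norm (mat 1::real^'n^'n) + norm (H ** ?A)" unfolding L_def by (rule norm_triangle_ineq4)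
    also have "norm (H ** ?A) \<le> B * B" using norm_matrix_mult_le[of H ?A] mult_mono[OF B(8,2)] B(1) by simp
    finally show ?thesis by (simp add: l_def)
  qed
  then have ntL: "norm (transpose L) \<le> l" by (simp add: norm_transpose)
  have n\<xi>: "norm \<xi> \<le> l * norm c"
    unfolding \<xi>_def using norm_matrix_vector_le[of L c] mult_right_mono[OF nL norm_ge_zero[of c]] by linarith
  have nA1: "norm A1 \<le> B * (l * norm c)"
    unfolding A1_def using B(3)[of \<xi>] mult_left_mono[OF n\<xi>, of B] B(1) by linarith
  \<comment> \<open>total symmetry of the third derivatives turns rows of \<open>A' \<xi> L\<close> into derivatives of the Schur complement\<close>
  have row: "(A1 ** L) $ i = Sd (axis i 1) *v c" for i
  proof -
    have "(A1 ** L) $ i \<bullet> d = (Sd (axis i 1) *v c) \<bullet> d" for d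
    proof -
      have "(A1 ** L) $ i \<bullet> d = axis i 1 \<bullet> ((A1 ** L) *v d)"
        by (simp add: inner_axis' matrix_vector_mul_component)
      also have "\<dots> = axis i 1 \<bullet> (A1 *v (L *v d))" by (simp only: matrix_vector_mul_assoc)
      also have "\<dots> = (A1 *v axis i 1) \<bullet> (L *v d)" by (simp only: inner_matrix_vector[of _ A1] tA1)
      also have "A1 *v axis i 1 = A' x0 (axis i 1) *v \<xi>" unfolding A1_def by (rule A'_sym(2)[OF x0])
      also have "(A' x0 (axis i 1) *v \<xi>) \<bullet> (L *v d) = (transpose L *v (A' x0 (axis i 1) *v (L *v c))) \<bullet> d"
        unfolding \<xi>_def by (rule inner_matrix_vector)
      also have "transpose L *v (A' x0 (axis i 1) *v (L *v c)) = Sd (axis i 1) *v c"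
        by (simp only: Sd_def matrix_vector_mul_assoc matrix_mul_assoc)
      finally show ?thesis .
    qed
    then show ?thesis by (rule vector_eq_rdot[THEN iffD1, rule_format])
  qed
  have nA1L: "norm (A1 ** L) \<le> norm c * \<delta>"
  proof -
    have "norm (A1 ** L) \<le> (\<Sum>i\<in>UNIV. norm (Sd (axis i 1) *v c))" using norm_le_sum_rows[of "A1 ** L"] by (simp only: row)
    also have "\<dots> \<le> (\<Sum>i\<in>UNIV. norm (Sd (axis i 1)) * norm c)" by (intro sum_mono norm_matrix_vector_le)
    also have "\<dots> = norm c * \<delta>" by (simp add: \<delta>_def sum_distrib_left mult.commute)
    finally show ?thesis .
  qed
  then have nA1Le: "norm (A1 ** L) \<le> norm c * e" using mult_left_mono[OF e0(2), of "norm c"] by simp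
  have ntLA1: "norm (transpose L ** A1) \<le> norm c * e"
    using nA1Le norm_transpose[of "A1 ** L"] by (simp add: matrix_transpose_mul tA1)
  \<comment> \<open>both discrepancies have the form \<open>Y - P Y P\<^sup>T\<close> with \<open>P = 1 - L\<^sup>T\<close>\<close>
  have two: "norm (transpose L ** W + W ** L - transpose L ** W ** L) \<le> (2 + l) * (m * (norm c * e))"
    if "norm (W ** L) \<le> m * (norm c * e)" "norm (transpose L ** W) \<le> m * (norm c * e)" for W m
  proof -
    have "norm (transpose L ** W ** L) \<le> l * (m * (norm c * e))"
      using norm_matrix_mult_le[of "transpose L" "W ** L"] mult_mono[OF ntL that(1)] l0 by (simp add: matrix_mul_assoc)
    then show ?thesis using that
      norm_triangle_ineq4[of "transpose L ** W + W ** L" "transpose L ** W ** L"] norm_triangle_ineq[of "transpose L ** W" "W ** L"]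
      by (simp add: algebra_simps)
  qed
  define K where "K = H ** A1 ** H"
  have KS: "K \<in> Sym" by (simp add: K_def Sym_def matrix_transpose_mul tA1 tH matrix_mul_assoc)
  have P: "?A ** H = mat 1 - transpose L" "H ** ?A = mat 1 - L" unfolding tL by (simp_all add: L_def)
  have AKA: "?A ** K ** ?A = A1 - (transpose L ** A1 + A1 ** L - transpose L ** A1 ** L)"
  proof -
    have "?A ** K ** ?A = (?A ** H) ** A1 ** (H ** ?A)" by (simp add: K_def matrix_mul_assoc)
    then show ?thesis unfolding P by (simp add: matrix_bilinear_simps)
  qed
  define W where "W = A1 ** H ** A1"
  have HAH: "X ** H ** ?A ** H = X ** H" for X :: "real^'n^'n" using H(2) by (metis matrix_mul_assoc)
  have AKAKA: "?A ** K ** ?A ** K ** ?A = W - (transpose L ** W + W ** L - transpose L ** W ** L)"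
  proof -
    have "?A ** K ** ?A ** K ** ?A = ((?A ** H ** A1) ** H ** ?A ** H) ** A1 ** (H ** ?A)" by (simp add: K_def matrix_mul_assoc)
    also have "\<dots> = (?A ** H) ** W ** (H ** ?A)" unfolding HAH by (simp add: W_def matrix_mul_assoc)
    finally show ?thesis unfolding P by (simp add: matrix_bilinear_simps)
  qed
  have Mterm: "transpose M ** A1 + A1 ** M + transpose M ** ?A ** M = - W"
  proof -
    have M: "M = - (H ** A1)" by (simp add: M_def A1_def \<xi>_def)
    have tM: "transpose M = - (A1 ** H)" by (simp add: M transpose_simps matrix_transpose_mul tA1 tH)
    have "transpose M ** ?A ** M = (A1 ** H ** ?A ** H) ** A1" unfolding tM unfolding M by (simp add: matrix_bilinear_simps matrix_mul_assoc)
    also have "\<dots> = W" unfolding HAH by (simp add: W_def)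
    finally have MAM: "transpose M ** ?A ** M = W" .
    show ?thesis unfolding MAM unfolding tM unfolding M by (simp add: matrix_bilinear_simps W_def matrix_mul_assoc)
  qed
  define j where "j = jet' x0 \<xi>"
  define j2 where "j2 = (?A ** K ** ?A, 0::real^'n, Du x0 \<bullet> \<xi>, \<xi>)"
  have conv: "0 \<le> 2 * (a x0 \<bullet> (?A ** K ** ?A ** K ** ?A)) + G'' (jet x0) j2 j2"
    unfolding j2_def by (rule inverse_convex[OF x0 KS])
  have A\<xi>: "?A *v \<xi> = S0 *v c" unfolding \<xi>_def matrix_vector_mul_assoc AL ..
  have nA\<xi>: "norm (?A *v \<xi>) \<le> norm c * e"
    unfolding A\<xi> using norm_matrix_vector_le[of S0 c] mult_right_mono[OF e0(3) norm_ge_zero[of c]] by (simp add: mult.commute)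
  have nP: "norm (?A ** H) \<le> B * B" "norm (H ** ?A) \<le> B * B"
    using norm_matrix_mult_le[of ?A H] norm_matrix_mult_le[of H ?A] mult_mono[OF B(2,8)] mult_mono[OF B(8,2)] B(1) by simp_all
  have nAKA: "norm (?A ** K ** ?A) \<le> B^5 * (l * norm c)"
  proof -
    have "norm (?A ** K ** ?A) = norm ((?A ** H) ** A1 ** (H ** ?A))" by (simp add: K_def matrix_mul_assoc)
    also have "\<dots> \<le> norm ((?A ** H) ** A1) * norm (H ** ?A)" by (rule norm_matrix_mult_le)
    also have "\<dots> \<le> (norm (?A ** H) * norm A1) * norm (H ** ?A)"
      by (intro mult_right_mono norm_matrix_mult_le) simp
    also have "\<dots> \<le> ((B * B) * (B * (l * norm c))) * (B * B)"
      using B(1) l0 by (intro mult_mono nP nA1) auto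
    finally show ?thesis by (simp add: power_def numeral_eq_Suc mult_ac)
  qed
  have n3: "norm (Du x0 \<bullet> \<xi>) \<le> B * (l * norm c)"
  proof -
    have "norm (Du x0 \<bullet> \<xi>) \<le> norm (Du x0) * norm \<xi>" using Cauchy_Schwarz_ineq2 by simp
    also have "\<dots> \<le> B * (l * norm c)" using B(1,5) n\<xi> by (intro mult_mono) auto
    finally show ?thesis .
  qed
  have n4: "norm \<xi> \<le> B * (l * norm c)" using n\<xi> mult_right_mono[OF B(1), of "l * norm c"] l0 by simp
  have n4': "norm (?A *v \<xi>) \<le> B * (l * norm c)"
    using norm_matrix_vector_le[of ?A \<xi>] mult_mono[OF B(2) n\<xi>] B(1) by simp
  have quad: "norm (p, q, s, y) \<le> norm p + norm q + norm s + norm y" for p :: "real^'n^'n" and q y :: "real^'n" and s :: real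
    using norm_Pair_le[of p "(q,s,y)"] norm_Pair_le[of q "(s,y)"] norm_Pair_le[of s y] by linarith
  have nj: "norm j \<le> 4 * B * (l * norm c)"
    unfolding j_def using quad[of "A' x0 \<xi>" "?A *v \<xi>" "Du x0 \<bullet> \<xi>" \<xi>] nA1[unfolded A1_def] n3 n4 n4' by simp
  have nj2: "norm j2 \<le> (B^5 + 2 * B) * (l * norm c)"
    unfolding j2_def using quad[of "?A ** K ** ?A" 0 "Du x0 \<bullet> \<xi>" \<xi>] nAKA n3 n4 by (simp add: distrib_right)
  have njj: "norm (j2 - j) \<le> (2 + l) * (norm c * e) + norm c * e"
  proof -
    have "norm (j2 - j) \<le> norm (?A ** K ** ?A - A1) + norm (0 - ?A *v \<xi>)"
      unfolding j_def j2_def A1_def using quad[of "?A ** K ** ?A - A' x0 \<xi>" "0 - ?A *v \<xi>" 0 0] by (simp add: zero_prod_def)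
    also have "norm (?A ** K ** ?A - A1) \<le> (2 + l) * (norm c * e)"
    proof -
      have "?A ** K ** ?A - A1 = - (transpose L ** A1 + A1 ** L - transpose L ** A1 ** L)" unfolding AKA by simp
      then show ?thesis using two[of A1 1] nA1Le ntLA1 by (simp only: norm_minus_cancel mult_1)
    qed
    finally show ?thesis using nA\<xi> by simp
  qed
  have inj: "jet x0 \<in> UNIV \<times> UNIV \<times> UNIV \<times> \<Omega>" using x0 by simp
  have dG: "G'' (jet x0) j2 j2 - G'' (jet x0) j j \<le> B * (((3 + l) * (norm c * e)) * ((B^5 + 6 * B) * (l * norm c)))"
  proof -
    have "G'' (jet x0) j2 j2 - G'' (jet x0) j j = G'' (jet x0) (j2 - j) j2 + G'' (jet x0) j (j2 - j)"
      by (simp add: linear_diff[OF C2_on_linear(2)[OF G inj]] linear_diff[OF C2_on_linear(3)[OF G inj]])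
    also have "\<dots> \<le> B * norm (j2 - j) * norm j2 + B * norm j * norm (j2 - j)"
      using B(7)[of "j2 - j" j2] B(7)[of j "j2 - j"] by linarith
    also have "\<dots> = B * (norm (j2 - j) * (norm j2 + norm j))" by (simp add: algebra_simps)
    also have "\<dots> \<le> B * (((3 + l) * (norm c * e)) * ((B^5 + 6 * B) * (l * norm c)))"
    proof -
      have "norm (j2 - j) \<le> (3 + l) * (norm c * e)" using njj by (simp add: algebra_simps)
      moreover have "norm j2 + norm j \<le> (B^5 + 6 * B) * (l * norm c)" using nj nj2 by (simp add: algebra_simps)
      ultimately show ?thesis using B(1) e0 l0 by (intro mult_left_mono mult_mono) auto
    qed
    finally show ?thesis .
  qed
  have g1: "- G' (jet x0) (0, A' x0 \<xi> *v \<xi>, \<xi> \<bullet> (A x0 *v \<xi>), 0) \<le> B * ((l + 1) * (norm c)\<^sup>2 * e)"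
  proof -
    have "norm (A' x0 \<xi> *v \<xi>) \<le> norm (A1 ** L) * norm c"
    proof -
      have "A' x0 \<xi> *v \<xi> = (A1 ** L) *v c" unfolding A1_def by (subst (2) \<xi>_def) (simp only: matrix_vector_mul_assoc)
      then show ?thesis using norm_matrix_vector_le[of "A1 ** L" c] by simp
    qed
    also have "\<dots> \<le> (norm c * e) * norm c" by (rule mult_right_mono[OF nA1Le]) simp
    finally have 1: "norm (A' x0 \<xi> *v \<xi>) \<le> (norm c)\<^sup>2 * e" by (simp add: power2_eq_square mult_ac)
    have "norm (\<xi> \<bullet> (?A *v \<xi>)) \<le> norm \<xi> * norm (?A *v \<xi>)" using Cauchy_Schwarz_ineq2 by simp
    also have "\<dots> \<le> (l * norm c) * (norm c * e)" using n\<xi> nA\<xi> l0 by (intro mult_mono) auto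
    finally have 2: "norm (\<xi> \<bullet> (?A *v \<xi>)) \<le> l * ((norm c)\<^sup>2 * e)" by (simp add: power2_eq_square mult_ac)
    have "norm (0::real^'n^'n, A' x0 \<xi> *v \<xi>, \<xi> \<bullet> (?A *v \<xi>), 0::real^'n) \<le> (l + 1) * ((norm c)\<^sup>2 * e)"
      using quad[of 0 "A' x0 \<xi> *v \<xi>" "\<xi> \<bullet> (?A *v \<xi>)" 0] 1 2 by (simp add: distrib_right)
    then have "B * norm (0::real^'n^'n, A' x0 \<xi> *v \<xi>, \<xi> \<bullet> (?A *v \<xi>), 0::real^'n) \<le> B * ((l + 1) * ((norm c)\<^sup>2 * e))"
      using B(1) by (intro mult_left_mono) auto
    then show ?thesis using B(6)[of "(0, A' x0 \<xi> *v \<xi>, \<xi> \<bullet> (?A *v \<xi>), 0)"] by (simp add: mult.assoc)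
  qed
  define m where "m = B * (l * norm c) * B"
  have wterm: "a x0 \<bullet> (?A ** K ** ?A ** K ** ?A) - a x0 \<bullet> W \<le> B * ((2 + l) * (m * (norm c * e)))"
  proof -
    have m0: "norm (A1 ** H) \<le> m"
      using norm_matrix_mult_le[of A1 H] mult_mono[OF nA1 B(8)] B(1) l0 unfolding m_def by simp
    have "norm (W ** L) \<le> norm (A1 ** H) * norm (A1 ** L)"
      using norm_matrix_mult_le[of "A1 ** H" "A1 ** L"] by (simp add: W_def matrix_mul_assoc)
    also have "\<dots> \<le> m * (norm c * e)" using B(1) l0 nA1Le m0 order_trans[OF norm_ge_zero m0] by (intro mult_mono) auto
    finally have WL: "norm (W ** L) \<le> m * (norm c * e)" .
    have "transpose (W ** L) = transpose L ** W"
      by (simp add: W_def matrix_transpose_mul tA1 tH matrix_mul_assoc)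
    then have LW: "norm (transpose L ** W) \<le> m * (norm c * e)" using WL norm_transpose[of "W ** L"] by simp
    have "a x0 \<bullet> (?A ** K ** ?A ** K ** ?A) - a x0 \<bullet> W = a x0 \<bullet> (- (transpose L ** W + W ** L - transpose L ** W ** L))"
      unfolding AKAKA by (simp add: inner_diff_right inner_add_right)
    also have "\<dots> \<le> norm (a x0) * norm (transpose L ** W + W ** L - transpose L ** W ** L)"
      using norm_cauchy_schwarz[of "a x0" "- (transpose L ** W + W ** L - transpose L ** W ** L)"] by (simp only: norm_minus_cancel)
    also have "\<dots> \<le> B * ((2 + l) * (m * (norm c * e)))"
      using B(1,4) two[OF WL LW] by (intro mult_mono) auto
    finally show ?thesis .
  qed
  have "- G'' (jet x0) j j - G' (jet x0) (0, A' x0 \<xi> *v \<xi>, \<xi> \<bullet> (A x0 *v \<xi>), 0) + 2 * (a x0 \<bullet> (- W))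
     \<le> B * (((3 + l) * (norm c * e)) * ((B^5 + 6 * B) * (l * norm c))) + B * ((l + 1) * (norm c)\<^sup>2 * e)
       + 2 * (B * ((2 + l) * (m * (norm c * e))))"
    using conv dG g1 wterm by (simp only: inner_minus_right)
  also have "\<dots> = error_const B l * (norm c)\<^sup>2 * e"
    unfolding error_const_def m_def power2_eq_square by algebra
  finally show ?thesis
    unfolding e_def \<delta>_def S0_def l_def j_def Mterm[unfolded A1_def] .
qed

text \<open>
  \<open>L - H A'(x - x0) L\<close> follows the true minimisers to first order, since \<open>H A L = 0\<close>; hence \<open>S\<close> has derivative
  \<open>L\<^sup>T A' L\<close> at \<open>x0\<close>. With \<open>U = S0 / |S0|\<close> the matrix \<open>2 - U\<close> is positive semidefinite and is written as \<open>\<Sum>k. c k c k\<^sup>T\<close>, so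
  that \<open>(2 - U) \<bullet> S\<close> is a sum of quadratic forms \<open>\<xi> \<bullet> A \<xi>\<close> to which \<open>touching_inequality\<close> applies. The lower
  bound for it contains the gain \<open>|T|\<^sup>2 / (2 |S0|)\<close> from the concavity of \<open>2 tr - norm\<close>. The first-order condition
  controls the component of \<open>DS\<close> along \<open>U\<close> by \<open>D\<phi>\<close> and \<open>T\<close>, because \<open>tr U \<ge> 1\<close>, and Young's inequality absorbs \<open>T\<close>.
\<close>

lemma touching_estimate:
  fixes H :: "real^'n^'n" and x0 :: "real^'n"
  defines "L \<equiv> mat 1 - H ** A x0" and "S0 \<equiv> A x0 - A x0 ** H ** A x0"
  defines "S \<equiv> \<lambda>x. transpose (L - H ** A' x0 (x - x0) ** L) ** A x ** (L - H ** A' x0 (x - x0) ** L)"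
  assumes x0: "x0 \<in> \<Omega>" and H: "H \<in> Sym" "H ** A x0 ** H = H"
    and bound: "data_bound B x0" "norm H \<le> B"
    and \<theta>: "\<theta> > 0" "\<And>v. \<theta> * (norm v)\<^sup>2 \<le> v \<bullet> (a x0 *v v)"
    and \<phi>: "C2_on X \<phi> \<phi>' \<phi>''" "x0 \<in> X"
    and \<Phi>: "\<And>x v. x \<in> X \<Longrightarrow> \<phi>'' x v v = v \<bullet> (\<Phi> x *v v)" "continuous_on X \<Phi>"
    and touch: "\<forall>\<^sub>F x in nhds x0. \<phi> x \<le> 2 * (mat 1 \<bullet> S x) - norm (S x)"
    and eq: "\<phi> x0 = 2 * (mat 1 \<bullet> S0) - norm S0" and S0: "S0 \<noteq> 0"
  shows "a x0 \<bullet> \<Phi> x0 \<le> touch_const (norm (mat 1::real^'n^'n)) (real CARD('n)) B \<theta> * ((\<Sum>i\<in>UNIV. \<bar>\<phi>' x0 (axis i 1)\<bar>) + \<phi> x0)"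
proof -
  let ?A = "A x0" and ?I = "mat 1 :: real^'n^'n" and ?N = "real CARD('n)"
  define r where "r = norm S0"
  have r: "r > 0" using S0 by (simp add: r_def)
  have B: "B \<ge> 1" using bound(1) by (simp add: data_bound_def)
  define U where "U = S0 /\<^sub>R r"
  have tA: "transpose ?A = ?A" using A_psd[OF x0] by (simp add: psd_def Sym_def)
  have tH: "transpose H = H" using H(1) by (simp add: Sym_def)
  have tL: "transpose L = ?I - ?A ** H" by (simp add: L_def transpose_simps matrix_transpose_mul tA tH)
  have HAH: "X ** H ** ?A ** H = X ** H" for X :: "real^'n^'n" using H(2) by (metis matrix_mul_assoc)
  have AL: "?A ** L = S0" by (simp add: L_def S0_def matrix_bilinear_simps matrix_mul_assoc)
  have tLA: "transpose L ** ?A = S0" by (simp add: tL S0_def matrix_bilinear_simps matrix_mul_assoc)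
  have HS0: "H ** S0 = 0" "S0 ** H = 0"
    using H(2) HAH[of ?A] by (simp_all add: S0_def matrix_bilinear_simps matrix_mul_assoc)
  have S0L: "transpose L ** ?A ** L = S0"
    unfolding tLA by (simp add: L_def matrix_bilinear_simps matrix_mul_assoc HS0)
  have S00: "S x0 = S0"
    using A_linear[OF x0] by (simp add: S_def linear_0 matrix_bilinear_simps S0L)
  have S0psd: "psd S0" using psd_congruence[OF A_psd[OF x0], of L] by (simp only: S0L)
  have nU: "norm U = 1" using r by (simp add: U_def r_def)
  have UU: "U \<bullet> U = 1" using nU by (simp add: dot_square_norm)
  have US0: "U \<bullet> S0 = r" using r by (simp add: U_def r_def dot_square_norm power2_eq_square)
  have trU: "1 \<le> ?I \<bullet> U" using psd_norm_le_trace[OF S0psd] r by (simp add: U_def r_def field_simps)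
  define Gm where "Gm = 2 *\<^sub>R ?I - U"
  have Gm: "psd Gm"
    unfolding psd_def
  proof (intro conjI allI)
    show "Gm \<in> Sym" using S0psd by (simp add: Gm_def U_def psd_def Sym_def transpose_simps)
    fix v :: "real^'n"
    have "v \<bullet> (U *v v) \<le> norm v * norm (U *v v)" by (rule norm_cauchy_schwarz)
    also have "\<dots> \<le> norm v * (norm U * norm v)" by (intro mult_left_mono norm_matrix_vector_le) simp
    also have "\<dots> = v \<bullet> v" by (simp add: nU dot_square_norm power2_eq_square)
    also have "\<dots> \<le> 2 * (v \<bullet> v)" by simp
    finally show "0 \<le> v \<bullet> (Gm *v v)"
      unfolding Gm_def matrix_vector_bilinear_simps inner_diff_right by simp
  qed
  obtain c :: "'n \<Rightarrow> real^'n" where c: "Gm = (\<Sum>k\<in>UNIV. outer (c k) (c k))" using psd_sum_outer[OF Gm] .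
  have GmX: "Gm \<bullet> Y = (\<Sum>k\<in>UNIV. c k \<bullet> (Y *v c k))" for Y
    unfolding c by (simp add: inner_sum_left inner_commute[of "outer _ _"] inner_outer)
  have II: "?I \<bullet> ?I = ?N"
    unfolding inner_matrix_entries mat_def by (simp add: if_distrib[of "\<lambda>x. x * _"] cong: if_cong)
  have c2: "(\<Sum>k\<in>UNIV. (norm (c k))\<^sup>2) \<le> 2 * ?N"
  proof -
    have "(\<Sum>k\<in>UNIV. (norm (c k))\<^sup>2) = Gm \<bullet> ?I" by (simp add: GmX power2_norm_eq_inner)
    also have "\<dots> = 2 * ?N - ?I \<bullet> U" by (simp add: Gm_def inner_diff_left II inner_commute[of U])
    finally show ?thesis using trU by simp
  qed
  define Sd where "Sd Y = transpose L ** A' x0 Y ** L" for Y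
  define T where "T Y = Sd Y - (U \<bullet> Sd Y) *\<^sub>R U" for Y
  note lA' = A_linear[OF x0]
  have blA': "bounded_linear (A' x0)" using lA' linear_conv_bounded_linear by blast
  have blSd: "bounded_linear Sd" unfolding Sd_def
    by (intro bounded_linear_compose[OF bounded_bilinear.bounded_linear_left[OF bounded_bilinear_matrix_matrix]]
              bounded_linear_compose[OF bounded_bilinear.bounded_linear_right[OF bounded_bilinear_matrix_matrix]] blA')
  have blT: "bounded_linear T" unfolding T_def
    by (intro bounded_linear_sub blSd bounded_linear_scaleR_const bounded_linear_inner_right_comp)
  have dS: "(S has_derivative Sd) (at x0)"
  proof -
    define Lx where "Lx x = L - H ** A' x0 (x - x0) ** L" for x
    have dA': "((\<lambda>x. A' x0 (x - x0)) has_derivative A' x0) (at x0)"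
      by (rule has_derivative_eq_rhs[OF bounded_linear.has_derivative[OF blA']]) (auto intro!: derivative_eq_intros)
    have dL: "(Lx has_derivative (\<lambda>X. - (H ** A' x0 X ** L))) (at x0)"
    proof -
      have "((\<lambda>x. H ** A' x0 (x - x0)) has_derivative (\<lambda>X. H ** A' x0 X)) (at x0)"
        by (rule has_derivative_eq_rhs[OF has_derivative_matrix_matrix[OF has_derivative_const dA']]) (simp add: matrix_bilinear_simps)
      from has_derivative_matrix_matrix[OF this has_derivative_const[of L]]
      have "((\<lambda>x. H ** A' x0 (x - x0) ** L) has_derivative (\<lambda>X. H ** A' x0 X ** L)) (at x0)"
        by (rule has_derivative_eq_rhs) (simp add: matrix_bilinear_simps)
      from has_derivative_diff[OF has_derivative_const this] show ?thesis unfolding Lx_def by simp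
    qed
    have dtL: "((\<lambda>x. transpose (Lx x)) has_derivative (\<lambda>X. - (transpose L ** A' x0 X ** H))) (at x0)"
      by (rule has_derivative_eq_rhs[OF bounded_linear.has_derivative[OF bounded_linear_transpose dL]])
         (use A'_sym(1)[OF x0] in \<open>simp add: transpose_simps matrix_transpose_mul tH Sym_def matrix_mul_assoc\<close>)
    have Lx0: "Lx x0 = L" using lA' by (simp add: Lx_def linear_0 matrix_bilinear_simps)
    have Seq: "S = (\<lambda>x. (transpose (Lx x) ** A x) ** Lx x)" by (simp add: S_def Lx_def)
    show ?thesis unfolding Seq
    proof (rule has_derivative_eq_rhs[OF has_derivative_matrix_matrix[OF has_derivative_matrix_matrix[OF dtL A(1)[OF x0]] dL]], rule ext)
      fix X
      have "transpose L ** ?A ** (H ** A' x0 X ** L) = (S0 ** H) ** A' x0 X ** L" by (simp add: tLA[symmetric] matrix_mul_assoc)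
      then have 1: "transpose L ** ?A ** (H ** A' x0 X ** L) = 0" by (simp add: HS0 matrix_bilinear_simps)
      have "transpose L ** A' x0 X ** H ** ?A ** L = transpose L ** A' x0 X ** (H ** S0)" by (simp add: AL[symmetric] matrix_mul_assoc)
      then have 2: "transpose L ** A' x0 X ** H ** ?A ** L = 0" by (simp add: HS0 matrix_bilinear_simps)
      show "(transpose (Lx x0) ** ?A) ** - (H ** A' x0 X ** L) + (transpose (Lx x0) ** A' x0 X + - (transpose L ** A' x0 X ** H) ** ?A) ** Lx x0 = Sd X"
        unfolding Lx0 using 1 2 by (simp add: matrix_bilinear_simps Sd_def)
    qed
  qed
  define \<xi> where "\<xi> k = L *v c k" for k
  define M where "M k = - (H ** A' x0 (L *v c k))" for k
  have \<xi>x: "(L - H ** A' x0 X ** L) *v c k = \<xi> k + M k *v X" for X k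
  proof -
    have "(H ** A' x0 X ** L) *v c k = H *v (A' x0 X *v (L *v c k))" by (simp only: matrix_vector_mul_assoc matrix_mul_assoc)
    also have "A' x0 X *v (L *v c k) = A' x0 (L *v c k) *v X" by (rule A'_sym(2)[OF x0])
    finally show ?thesis by (simp add: matrix_vector_bilinear_simps \<xi>_def M_def matrix_vector_mul_assoc)
  qed
  have GmS: "Gm \<bullet> S x = (\<Sum>k\<in>UNIV. (\<xi> k + M k *v (x - x0)) \<bullet> (A x *v (\<xi> k + M k *v (x - x0))))" for x
    unfolding GmX S_def by (simp only: \<xi>x quadratic_congruence)
  have \<phi>0: "\<phi> x0 = Gm \<bullet> S0" unfolding eq by (simp add: Gm_def inner_diff_left US0 r_def)
  have lower: "\<forall>\<^sub>F x in nhds x0. \<phi> x + (norm (T (x - x0)))\<^sup>2 / (2 * r) - \<kappa> * (norm (x - x0))\<^sup>2 \<le> Gm \<bullet> S x" if "\<kappa> > 0" for \<kappa>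
    using touch norm_second_order_lower_bound[OF dS S00 S0 that, folded r_def, folded U_def, folded T_def]
  proof eventually_elim
    case (elim x)
    then show ?case using US0 by (simp add: Gm_def inner_diff_left inner_diff_right)
  qed
  have first: "Gm \<bullet> Sd X = \<phi>' x0 X" for X
  proof -
    define f where "f x = Gm \<bullet> S x - \<phi> x + (x - x0) \<bullet> (x - x0)" for x
    have df: "(f has_derivative (\<lambda>X. Gm \<bullet> Sd X - \<phi>' x0 X)) (at x0)"
      unfolding f_def
      by (rule has_derivative_eq_rhs, (rule derivative_intros dS C2_onD(2)[OF \<phi>])+) simp
    have "\<forall>\<^sub>F x in nhds x0. f x0 \<le> f x"
      using lower[of 1, OF zero_less_one]
    proof eventually_elim
      case (elim x)
      have "0 \<le> (norm (T (x - x0)))\<^sup>2 / (2 * r)" using r by simp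
      then show ?case using elim by (simp add: f_def S00 \<phi>0 power2_norm_eq_inner)
    qed
    then obtain e where "e > 0" "\<forall>y\<in>ball x0 e. f x0 \<le> f y"
      unfolding eventually_nhds_metric by (auto simp: dist_commute)
    then have "(\<lambda>X. Gm \<bullet> Sd X - \<phi>' x0 X) = (\<lambda>v. 0)"
      using differential_zero_maxmin[of x0 "ball x0 e" f] df by auto
    then show ?thesis by (metis eq_iff_diff_eq_0)
  qed
  \<comment> \<open>the Hessian of \<open>|T(x - x0)|\<^sup>2 / 2\<close>\<close>
  define TT where "TT = (\<chi> i j. T (axis j 1) \<bullet> T (axis i 1))"
  have TTv: "v \<bullet> (TT *v v) = T v \<bullet> T v" for v
  proof -
    have "T v = T (\<Sum>i\<in>UNIV. v$i *\<^sub>R axis i 1)" by (simp add: basis_expansion[of v, unfolded scalar_mult_eq_scaleR])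
    also have "\<dots> = (\<Sum>i\<in>UNIV. v$i *\<^sub>R T (axis i 1))"
      using bounded_linear.linear[OF blT] by (simp add: linear_sum linear_cmul)
    finally have "T v = (\<Sum>i\<in>UNIV. v$i *\<^sub>R T (axis i 1))" .
    then show ?thesis
      by (simp add: TT_def inner_vec_def[of v] matrix_vector_mult_def inner_sum_left inner_sum_right sum_distrib_left mult_ac)
  qed
  define RHS where "RHS = (\<Sum>k\<in>UNIV. - G'' (jet x0) (jet' x0 (\<xi> k)) (jet' x0 (\<xi> k))
     - G' (jet x0) (0, A' x0 (\<xi> k) *v \<xi> k, \<xi> k \<bullet> (A x0 *v \<xi> k), 0)
     + 2 * (a x0 \<bullet> (transpose (M k) ** A' x0 (\<xi> k) + A' x0 (\<xi> k) ** M k + transpose (M k) ** A x0 ** M k)))"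
  have main\<kappa>: "a x0 \<bullet> \<Phi> x0 + (a x0 \<bullet> TT) / r - 4 * \<kappa> * (a x0 \<bullet> ?I) \<le> RHS" if \<kappa>: "\<kappa> > 0" for \<kappa>
  proof -
    define \<psi> where "\<psi> x = \<phi> x + (T (x - x0) \<bullet> T (x - x0)) / (2 * r) - 2 * \<kappa> * ((x - x0) \<bullet> (x - x0))" for x
    define \<psi>' where "\<psi>' x v = \<phi>' x v + (T (x - x0) \<bullet> T v) / r - 4 * \<kappa> * ((x - x0) \<bullet> v)" for x v
    define \<psi>'' where "\<psi>'' x v w = \<phi>'' x v w + (T w \<bullet> T v) / r - 4 * \<kappa> * (w \<bullet> v)" for x v w
    have dT: "((\<lambda>x. T (x - x0)) has_derivative T) (at x)" for x
      by (rule has_derivative_eq_rhs[OF bounded_linear.has_derivative[OF blT]]) (auto intro!: derivative_eq_intros)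
    have dI: "((\<lambda>x. x - x0) has_derivative (\<lambda>v. v)) (at x)" for x
      by (rule has_derivative_eq_rhs[OF has_derivative_diff[OF has_derivative_ident has_derivative_const]]) simp
    note dv = bounded_linear.has_derivative[OF bounded_linear_divide]
    have C: "C2_on X \<psi> \<psi>' \<psi>''"
      unfolding C2_on_def
    proof (intro conjI ballI allI)
      show "open X" by (rule C2_onD(1)[OF \<phi>(1)])
      fix x assume x: "x \<in> X"
      show "(\<psi> has_derivative \<psi>' x) (at x)"
        unfolding \<psi>_def \<psi>'_def
        by (rule has_derivative_eq_rhs[OF has_derivative_diff[OF has_derivative_add[OF C2_onD(2)[OF \<phi>(1) x]
                dv[OF has_derivative_inner[OF dT dT]]]
              has_derivative_mult_right[OF has_derivative_inner[OF dI dI]]]])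
           (use r in \<open>auto simp: fun_eq_iff inner_commute field_simps\<close>)
      fix v
      show "((\<lambda>y. \<psi>' y v) has_derivative \<psi>'' x v) (at x)"
        unfolding \<psi>'_def \<psi>''_def
        by (rule has_derivative_diff[OF has_derivative_add[OF C2_onD(3)[OF \<phi>(1) x]
                dv[OF has_derivative_inner_left[OF dT]]]
              has_derivative_mult_right[OF has_derivative_inner_left[OF dI]]])
    next
      fix v w
      show "continuous_on X (\<lambda>x. \<psi>'' x v w)" unfolding \<psi>''_def
        by (intro continuous_intros C2_onD(4)[OF \<phi>(1)]) (use r in auto)
    qed
    define \<Psi> where "\<Psi> x = \<Phi> x + (1 / r) *\<^sub>R TT - (4 * \<kappa>) *\<^sub>R ?I" for x
    have \<Psi>1: "\<psi>'' x v v = v \<bullet> (\<Psi> x *v v)" if "x \<in> X" for x v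
      unfolding \<Psi>_def matrix_vector_bilinear_simps inner_diff_right inner_add_right inner_scaleR_right TTv
      by (simp add: \<psi>''_def \<Phi>(1)[OF that])
    have \<Psi>2: "continuous_on X \<Psi>" unfolding \<Psi>_def by (intro continuous_intros \<Phi>(2))
    have "\<forall>\<^sub>F x in nhds x0. \<psi> x + \<kappa> * (norm (x - x0))\<^sup>2 \<le> (\<Sum>k\<in>UNIV. (\<xi> k + M k *v (x - x0)) \<bullet> (A x *v (\<xi> k + M k *v (x - x0))))"
      using lower[OF \<kappa>]
    proof eventually_elim
      case (elim x)
      then show ?case unfolding GmS[symmetric] by (simp add: \<psi>_def power2_norm_eq_inner)
    qed
    moreover have "\<psi> x0 = (\<Sum>k\<in>UNIV. \<xi> k \<bullet> (A x0 *v \<xi> k))"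
      using GmS[of x0] bounded_linear.linear[OF blT] by (simp add: \<psi>_def linear_0 \<phi>0 S00)
    ultimately have "a x0 \<bullet> \<Psi> x0 \<le> RHS"
      unfolding RHS_def using touching_inequality[where \<zeta>=\<xi> and M=M, OF x0 \<phi>(2) C \<Psi>1 \<Psi>2 \<kappa>] by fast
    then show ?thesis by (simp add: \<Psi>_def inner_diff_right inner_add_right)
  qed
  \<comment> \<open>the right-hand side does not involve \<open>\<kappa>\<close>\<close>
  have main: "a x0 \<bullet> \<Phi> x0 + (a x0 \<bullet> TT) / r \<le> RHS"
  proof (rule field_le_epsilon)
    fix e :: real assume e: "e > 0"
    define \<kappa> where "\<kappa> = e / (4 * (\<bar>a x0 \<bullet> ?I\<bar> + 1))"
    have \<kappa>: "\<kappa> > 0" using e by (simp add: \<kappa>_def add_nonneg_pos)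
    have "4 * \<kappa> * (a x0 \<bullet> ?I) \<le> 4 * \<kappa> * (\<bar>a x0 \<bullet> ?I\<bar> + 1)" using \<kappa> by (intro mult_left_mono) auto
    also have "\<dots> = e" by (simp add: \<kappa>_def field_simps)
    finally show "a x0 \<bullet> \<Phi> x0 + (a x0 \<bullet> TT) / r \<le> RHS + e" using main\<kappa>[OF \<kappa>] by linarith
  qed
  define l where "l = norm ?I + B * B"
  define \<delta> where "\<delta> = (\<Sum>i\<in>UNIV. norm (Sd (axis i 1)))"
  define C1 where "C1 = error_const B l * 2 * ?N"
  have l0: "l \<ge> 0" using B by (simp add: l_def)
  have ec: "error_const B l \<ge> 0" using B l0 by (simp add: error_const_def)
  then have C1: "C1 \<ge> 0" by (simp add: C1_def)
  have \<delta>0: "\<delta> \<ge> 0" by (simp add: \<delta>_def sum_nonneg)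
  have "RHS \<le> (\<Sum>k\<in>UNIV. error_const B l * (norm (c k))\<^sup>2 * (\<delta> + r))"
    unfolding RHS_def \<xi>_def M_def l_def \<delta>_def Sd_def r_def S0_def L_def
    by (intro sum_mono error_bound[OF x0 H bound])
  also have "\<dots> = error_const B l * (\<Sum>k\<in>UNIV. (norm (c k))\<^sup>2) * (\<delta> + r)"
    by (simp add: sum_distrib_left sum_distrib_right)
  also have "\<dots> \<le> error_const B l * (2 * ?N) * (\<delta> + r)"
    using c2 ec \<delta>0 r by (intro mult_right_mono mult_left_mono) auto
  finally have RHS: "RHS \<le> C1 * (\<delta> + r)" by (simp add: C1_def mult_ac)
  define \<tau> where "\<tau> = (\<Sum>i\<in>UNIV. (norm (T (axis i 1)))\<^sup>2)"
  have aTT: "\<theta> * \<tau> \<le> a x0 \<bullet> TT"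
  proof -
    have "psd (a x0 - \<theta> *\<^sub>R ?I)"
      unfolding psd_def
    proof (intro conjI allI)
      show "a x0 - \<theta> *\<^sub>R ?I \<in> Sym" using a_psd[OF x0] by (simp add: psd_def Sym_def transpose_simps)
      fix v
      show "0 \<le> v \<bullet> ((a x0 - \<theta> *\<^sub>R ?I) *v v)"
        unfolding matrix_vector_bilinear_simps inner_diff_right using \<theta>(2)[of v] by (simp add: power2_norm_eq_inner)
    qed
    from psd_inner_nonneg[OF this, of TT] have "0 \<le> (a x0 - \<theta> *\<^sub>R ?I) \<bullet> TT" by (simp add: TTv)
    moreover have "?I \<bullet> TT = \<tau>"
      by (subst inner_matrix_entries)
         (simp add: mat_def \<tau>_def TT_def if_distrib[of "\<lambda>x. x * _"] power2_norm_eq_inner cong: if_cong)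
    ultimately show ?thesis by (simp add: inner_diff_left)
  qed
  define q where "q = 1 + 2 * norm ?I"
  define D where "D = (\<Sum>i\<in>UNIV. \<bar>\<phi>' x0 (axis i 1)\<bar>)"
  \<comment> \<open>\<open>2 tr U - 1 \<ge> 1\<close> makes the component along \<open>U\<close> recoverable from the first-order condition\<close>
  have Sdb: "norm (Sd X) \<le> \<bar>\<phi>' x0 X\<bar> + q * norm (T X)" for X
  proof -
    define p where "p = U \<bullet> Sd X"
    have Sd: "Sd X = p *\<^sub>R U + T X" by (simp add: T_def p_def)
    have UT: "U \<bullet> T X = 0" by (simp add: T_def inner_diff_right UU)
    have "\<phi>' x0 X = p * (2 * (?I \<bullet> U) - 1) + 2 * (?I \<bullet> T X)"
      unfolding first[symmetric] Sd Gm_def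
      by (simp add: inner_diff_left inner_add_right UU UT algebra_simps)
    then have "\<bar>p * (2 * (?I \<bullet> U) - 1)\<bar> \<le> \<bar>\<phi>' x0 X\<bar> + 2 * \<bar>?I \<bullet> T X\<bar>" by linarith
    moreover have "\<bar>?I \<bullet> T X\<bar> \<le> norm ?I * norm (T X)" by (rule Cauchy_Schwarz_ineq2)
    moreover have "\<bar>p\<bar> * 1 \<le> \<bar>p\<bar> * (2 * (?I \<bullet> U) - 1)" using trU by (intro mult_left_mono) auto
    ultimately have "\<bar>p\<bar> \<le> \<bar>\<phi>' x0 X\<bar> + 2 * (norm ?I * norm (T X))" using trU by (simp add: abs_mult)
    moreover have "norm (Sd X) \<le> \<bar>p\<bar> + norm (T X)" unfolding Sd using norm_triangle_ineq[of "p *\<^sub>R U" "T X"] nU by simp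
    ultimately show ?thesis by (simp add: q_def algebra_simps)
  qed
  define C2 where "C2 = (C1 * q)\<^sup>2 / (4 * \<theta>)"
  have young: "C1 * q * y \<le> \<theta> * y\<^sup>2 / r + C2 * r" for y
  proof -
    have "0 \<le> (2 * \<theta> * y - C1 * q * r)\<^sup>2 / (4 * \<theta> * r)" using r \<theta>(1) by simp
    also have "\<dots> = \<theta> * y\<^sup>2 / r + C2 * r - C1 * q * y"
      using r \<theta>(1) by (simp add: C2_def power2_eq_square field_simps)
    finally show ?thesis by simp
  qed
  have "C1 * \<delta> \<le> C1 * (\<Sum>i\<in>UNIV. \<bar>\<phi>' x0 (axis i 1)\<bar> + q * norm (T (axis i 1)))"
    unfolding \<delta>_def using C1 by (intro mult_left_mono sum_mono Sdb) auto
  also have "\<dots> = C1 * D + (\<Sum>i\<in>UNIV. C1 * q * norm (T (axis i 1)))"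
    by (simp add: D_def sum.distrib sum_distrib_left distrib_left mult_ac)
  also have "\<dots> \<le> C1 * D + (\<Sum>i\<in>(UNIV::'n set). \<theta> * (norm (T (axis i 1)))\<^sup>2 / r + C2 * r)"
    by (intro add_left_mono sum_mono young)
  also have "\<dots> = C1 * D + \<theta> * \<tau> / r + ?N * (C2 * r)"
    by (simp add: \<tau>_def sum.distrib sum_distrib_left sum_divide_distrib)
  also have "\<theta> * \<tau> / r \<le> (a x0 \<bullet> TT) / r" using aTT r by (simp add: divide_right_mono)
  finally have "a x0 \<bullet> \<Phi> x0 \<le> C1 * D + (C1 + ?N * C2) * r"
    using main RHS by (simp add: algebra_simps)
  also have "\<dots> \<le> (C1 + ?N * C2) * (D + \<phi> x0)"
  proof -
    have "C2 \<ge> 0" using \<theta>(1) by (simp add: C2_def)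
    moreover have "D \<ge> 0" by (simp add: D_def sum_nonneg)
    moreover have "r \<le> \<phi> x0" unfolding eq using psd_norm_le_trace[OF S0psd] by (simp add: r_def)
    ultimately have "C1 * D \<le> (C1 + ?N * C2) * D" "(C1 + ?N * C2) * r \<le> (C1 + ?N * C2) * \<phi> x0"
      using C1 by (auto intro!: mult_right_mono mult_left_mono)
    then show ?thesis by (simp add: distrib_left)
  qed
  finally show ?thesis unfolding touch_const_def Let_def C1_def C2_def l_def q_def D_def by simp
qed

end

section \<open>Schur complements and rank\<close>

definition supported :: "'n set \<Rightarrow> real^'n \<Rightarrow> bool" where
  "supported J v \<longleftrightarrow> (\<forall>i. i \<notin> J \<longrightarrow> v $ i = 0)"

definition block_pos :: "real \<Rightarrow> 'n set \<Rightarrow> real^'n^'n \<Rightarrow> bool" where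
  "block_pos c J A \<longleftrightarrow> (\<forall>v. supported J v \<longrightarrow> c * (norm v)\<^sup>2 \<le> v \<bullet> (A *v v))"

text \<open>
  The columns of such a matrix with index outside \<open>J\<close> are the vectors \<open>e\<^sub>i + w\<close> with \<open>w\<close> supported on \<open>J\<close>, over which a
  Schur complement minimises the quadratic form of \<open>A\<close>.
\<close>

definition graph :: "'n set \<Rightarrow> real^'n^'n \<Rightarrow> bool" where
  "graph J K \<longleftrightarrow> (\<forall>i j. i \<notin> J \<longrightarrow> K $ i $ j = (if i = j then 1 else 0))"

text \<open>
  When the block on \<open>J\<close> is invertible, this says that its Schur complement vanishes.
\<close>

definition degenerate :: "'n set \<Rightarrow> real^'n^'n \<Rightarrow> bool" where
  "degenerate J A \<longleftrightarrow> (\<exists>K. graph J K \<and> A ** K = 0)"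

lemma graph_row: "graph J K \<Longrightarrow> i \<notin> J \<Longrightarrow> (K *v v) $ i = v $ i"
  by (simp add: graph_def matrix_vector_mult_def if_distrib[of "\<lambda>x. x * _"] cong: if_cong)

lemma graph_diff_supported: "graph J K \<Longrightarrow> graph J L \<Longrightarrow> supported J (K *v v - L *v v)"
  by (simp add: supported_def graph_row)

lemma graph_sub: "graph J K \<Longrightarrow> (\<And>i. i \<notin> J \<Longrightarrow> X $ i = 0) \<Longrightarrow> graph J (K - X)"
  by (simp add: graph_def)

lemma mult_row_zero: "X $ i = 0 \<Longrightarrow> (X ** Y) $ i = 0"
  by (simp add: vec_eq_iff matrix_matrix_mult_def)

lemma closed_graph: "closed {K. graph J K}"
proof -
  have "{K. graph J K} = (\<Inter>i\<in>-J. \<Inter>j. {K. K $ i $ j = (if i = j then 1 else 0)})"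
    by (auto simp: graph_def)
  also have "closed \<dots>"
    by (intro closed_INT ballI closed_Collect_eq continuous_intros)
  finally show ?thesis .
qed

text \<open>
  With \<open>p\<close> the coordinate projection to \<open>J\<close>, the matrix \<open>p A p + (1 - p)\<close> commutes with \<open>p\<close> and is invertible;
  \<open>H\<close> is \<open>p\<close> times its inverse.
\<close>

lemma block_inverse:
  fixes A :: "real^'n^'n"
  assumes A: "A \<in> Sym" and c: "c > 0" "block_pos c J A"
  obtains H where "H \<in> Sym" "H ** A ** H = H" "\<And>i. i \<notin> J \<Longrightarrow> H $ i = 0"
    "\<And>v. supported J v \<Longrightarrow> H *v (A *v v) = v" "norm H \<le> real CARD('n) / c"
proof -
  define p :: "real^'n^'n" where "p = (\<chi> i j. if i = j \<and> i \<in> J then 1 else 0)"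
  have pv: "(p *v v) $ i = (if i \<in> J then v $ i else 0)" for v i
    by (simp add: p_def matrix_vector_mult_def if_distrib[of "\<lambda>x. x * _"] cong: if_cong)
  have tp: "transpose p = p" by (auto simp: p_def transpose_def vec_eq_iff)
  have tA: "transpose A = A" using A by (simp add: Sym_def)
  have pp: "p ** p = p"
    by (subst matrix_eq) (simp add: vec_eq_iff pv flip: matrix_vector_mul_assoc)
  have psup: "supported J (p *v v)" for v by (simp add: supported_def pv)
  have supp: "p *v v = v" if "supported J v" for v
    using that by (simp add: vec_eq_iff pv supported_def)
  define D where "D = p ** A ** p + (mat 1 - p)"
  have Xpp: "X ** p ** p = X ** p" for X by (metis matrix_mul_assoc pp)
  have pD: "p ** D = p ** A ** p" by (simp add: D_def matrix_bilinear_simps matrix_mul_assoc pp)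
  have Dp: "D ** p = p ** A ** p" by (simp add: D_def matrix_bilinear_simps Xpp pp)
  have tD: "transpose D = D" by (simp add: D_def transpose_simps matrix_transpose_mul tp tA matrix_mul_assoc)
  have "x = 0" if "D *v x = 0" for x
  proof -
    have "(p ** A ** p) *v x = 0" using that by (simp flip: pD matrix_vector_mul_assoc)
    then have z: "p *v (A *v (p *v x)) = 0" by (simp add: matrix_vector_mul_assoc matrix_mul_assoc)
    have "(p *v x) \<bullet> (A *v (p *v x)) = x \<bullet> (p *v (A *v (p *v x)))"
      by (simp only: inner_matrix_vector[of x] tp)
    also have "\<dots> = 0" using z by simp
    finally have "c * (norm (p *v x))\<^sup>2 \<le> 0" using c(2) psup[of x] unfolding block_pos_def by metis
    then have px: "p *v x = 0" using c(1) by (simp add: mult_le_0_iff)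
    have "D *v x = p *v (A *v (p *v x)) + (x - p *v x)"
      unfolding D_def by (simp only: matrix_vector_bilinear_simps matrix_vector_mul_lid matrix_vector_mul_assoc matrix_mul_assoc)
    then show "x = 0" using that px z by simp
  qed
  then obtain E where ED: "E ** D = mat 1" using matrix_left_invertible_ker[of D] by blast
  then have DE: "D ** E = mat 1" by (simp add: matrix_left_right_inverse)
  have tE: "transpose E = E"
  proof -
    have "transpose E = transpose E ** (D ** E)" by (simp add: DE)
    also have "\<dots> = transpose (D ** E) ** E" by (simp add: matrix_transpose_mul tD matrix_mul_assoc)
    finally show ?thesis by (simp add: DE)
  qed
  have pE: "p ** E = E ** p"
  proof -
    have "p ** E = (E ** D) ** p ** E" by (simp add: ED)
    also have "\<dots> = E ** (D ** p) ** E" by (simp add: matrix_mul_assoc)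
    also have "\<dots> = E ** p ** (D ** E)" by (simp only: Dp pD[symmetric] matrix_mul_assoc)
    finally show ?thesis by (simp add: DE)
  qed
  define H where "H = p ** E"
  have HS: "H \<in> Sym" by (simp add: Sym_def H_def matrix_transpose_mul tp tE pE)
  have HAH: "H ** A ** H = H"
  proof -
    have "H ** A ** H = (E ** p) ** A ** (p ** E)" by (simp add: H_def pE[symmetric])
    also have "\<dots> = E ** (p ** A ** p) ** E" by (simp add: matrix_mul_assoc)
    also have "\<dots> = (E ** D) ** p ** E" by (simp only: Dp[symmetric] matrix_mul_assoc)
    finally show ?thesis by (simp add: ED H_def)
  qed
  have Hrow: "H $ i = 0" if "i \<notin> J" for i
    unfolding H_def by (rule mult_row_zero) (use that in \<open>simp add: p_def vec_eq_iff\<close>)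
  have HAv: "H *v (A *v v) = v" if "supported J v" for v
  proof -
    have "H *v (A *v v) = ((E ** p) ** A ** p) *v v"
      using supp[OF that] unfolding H_def pE by (metis matrix_vector_mul_assoc)
    also have "(E ** p) ** A ** p = (E ** D) ** p" by (simp only: Dp[symmetric] matrix_mul_assoc[symmetric]) (simp only: Dp matrix_mul_assoc)
    finally show ?thesis by (simp add: ED supp[OF that])
  qed
  have Hq: "norm (H *v q) \<le> norm q / c" for q
  proof -
    define w where "w = H *v q"
    have sw: "supported J w"
      unfolding w_def H_def by (metis psup matrix_vector_mul_assoc)
    have "w \<bullet> (A *v w) = w \<bullet> q"
    proof -
      have "p *v (A *v w) = (p ** A ** p ** E) *v q"
        unfolding w_def H_def by (simp add: matrix_vector_mul_assoc matrix_mul_assoc)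
      also have "p ** A ** p ** E = p ** (D ** E)" by (simp only: pD[symmetric] matrix_mul_assoc)
      finally have "p *v (A *v w) = p *v q" by (simp add: DE)
      then have "w \<bullet> (p *v (A *v w)) = w \<bullet> (p *v q)" by simp
      then show ?thesis unfolding inner_matrix_vector[of w p] tp supp[OF sw] .
    qed
    then have "c * (norm w)\<^sup>2 \<le> w \<bullet> q" using c(2) sw by (metis block_pos_def)
    also have "\<dots> \<le> norm w * norm q" by (rule norm_cauchy_schwarz)
    finally have "norm w * (c * norm w) \<le> norm w * norm q" by (simp add: power2_eq_square mult_ac)
    then have "c * norm w \<le> norm q" by (cases "norm w = 0") (auto simp: mult_le_cancel_left_pos)
    then show ?thesis using c(1) by (simp add: w_def field_simps)
  qed
  have "norm H \<le> (\<Sum>i\<in>UNIV. norm (H $ i))" by (rule norm_le_sum_rows)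
  also have "\<dots> \<le> (\<Sum>i\<in>(UNIV::'n set). 1 / c)"
  proof (rule sum_mono)
    fix i
    have "H $ i = transpose H *v axis i 1" by (simp add: matrix_vector_mult_basis column_def transpose_def vec_eq_iff del: transpose_matrix_vector)
    also have "transpose H = H" using HS by (simp add: Sym_def)
    finally have "H $ i = H *v axis i 1" .
    then show "norm (H $ i) \<le> 1 / c" using Hq[of "axis i 1"] by (simp add: norm_axis_1)
  qed
  also have "\<dots> = real CARD('n) / c" by simp
  finally have "norm H \<le> real CARD('n) / c" .
  from that[OF HS HAH Hrow HAv this] show thesis .
qed

text \<open>
  On positive semidefinite matrices this is monotone, homogeneous of degree one and comparable to the norm; it is
  also strictly concave transversally to rays and smooth away from \<open>0\<close>. The trace lacks
  the first property and the smallest eigenvalue the second.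
\<close>

definition spread :: "real^'n^'n \<Rightarrow> real" where
  "spread X = 2 * (mat 1 \<bullet> X) - norm X"

lemma spread_ge_norm: "psd X \<Longrightarrow> norm X \<le> spread X"
  using psd_norm_le_trace[of X] by (simp add: spread_def)

lemma spread_mono:
  assumes "psd X" "psd (Y - X)"
  shows "spread X \<le> spread Y"
proof -
  have "norm Y \<le> norm X + norm (Y - X)" using norm_triangle_ineq[of X "Y - X"] by simp
  moreover have "norm (Y - X) \<le> mat 1 \<bullet> (Y - X)" "0 \<le> mat 1 \<bullet> (Y - X)"
    using psd_norm_le_trace[OF assms(2)] norm_ge_zero[of "Y - X"] by linarith+
  ultimately show ?thesis by (simp add: spread_def inner_diff_right)
qed

text \<open>
  \<open>S w\<close> is orthogonal to all vectors supported on \<open>J\<close>, so replacing \<open>L\<close> by another matrix of the same type adds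
  the square of the difference and no cross term. This is the minimality of \<open>S\<close>.
\<close>

lemma schur_complement:
  fixes A H :: "real^'n^'n"
  assumes A: "psd A" and H: "H \<in> Sym" "H ** A ** H = H" "\<And>i. i \<notin> J \<Longrightarrow> H $ i = 0" "\<And>v. supported J v \<Longrightarrow> H *v (A *v v) = v"
  defines "L \<equiv> mat 1 - H ** A" and "S \<equiv> A - A ** H ** A"
  shows "graph J L" "A ** L = S" "transpose L ** A ** L = S" "psd S"
    and "graph J K \<Longrightarrow> spread S \<le> spread (transpose K ** A ** K)"
    and "degenerate J A \<longleftrightarrow> S = 0"
proof -
  have tA: "transpose A = A" using A by (simp add: psd_def Sym_def)
  have tH: "transpose H = H" using H(1) by (simp add: Sym_def)
  show gL: "graph J L" unfolding L_def
    by (rule graph_sub) (auto simp: graph_def mat_def intro!: mult_row_zero H(3))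
  show AL: "A ** L = S" by (simp add: L_def S_def matrix_bilinear_simps matrix_mul_assoc)
  show S: "transpose L ** A ** L = S"
  proof -
    have "transpose L ** A ** L = transpose L ** S" by (simp add: AL flip: matrix_mul_assoc)
    also have "\<dots> = S - A ** (H ** S)" by (simp add: L_def transpose_simps matrix_transpose_mul tA tH matrix_bilinear_simps matrix_mul_assoc)
    also have "H ** S = 0" using H(2) by (simp add: S_def matrix_bilinear_simps matrix_mul_assoc)
    finally show ?thesis by (simp add: matrix_bilinear_simps)
  qed
  show pS: "psd S" using psd_congruence[OF A, of L] by (simp only: S)
  have cross: "w \<bullet> (S *v v) = 0" if "supported J w" for w v
  proof -
    have "w \<bullet> (S *v v) = (transpose S *v w) \<bullet> v" by (rule inner_matrix_vector)
    also have "transpose S = S" using pS by (simp add: psd_def Sym_def)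
    also have "S *v w = A *v w - A *v (H *v (A *v w))"
      by (simp add: S_def matrix_vector_bilinear_simps matrix_vector_mul_assoc matrix_mul_assoc)
    also have "\<dots> = 0" using H(4)[OF that] by simp
    finally show ?thesis by simp
  qed
  have min: "v \<bullet> (S *v v) \<le> (K *v v) \<bullet> (A *v (K *v v))" if K: "graph J K" for K v
  proof -
    define w where "w = K *v v - L *v v"
    have w: "supported J w" unfolding w_def by (rule graph_diff_supported[OF K gL])
    have K: "K *v v = L *v v + w" by (simp add: w_def)
    have AS: "A *v (L *v v) = S *v v" by (simp add: matrix_vector_mul_assoc AL)
    have c2: "(L *v v) \<bullet> (A *v w) = w \<bullet> (S *v v)"
      using Sym_inner_commute[of A "L *v v" w] A by (simp add: psd_def AS)
    have "(K *v v) \<bullet> (A *v (K *v v)) = (L *v v) \<bullet> (A *v (L *v v)) + w \<bullet> (A *v w)"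
      unfolding K by (simp add: matrix_vector_bilinear_simps inner_add_left inner_add_right c2 AS cross[OF w])
    also have "(L *v v) \<bullet> (A *v (L *v v)) = v \<bullet> (S *v v)" by (simp add: S flip: quadratic_congruence)
    finally show ?thesis using A by (simp add: psd_def)
  qed
  show "spread S \<le> spread (transpose K ** A ** K)" if K: "graph J K"
  proof (rule spread_mono[OF pS])
    show "psd (transpose K ** A ** K - S)"
      unfolding psd_def
    proof (intro conjI allI)
      show "transpose K ** A ** K - S \<in> Sym"
        using psd_congruence[OF A, of K] pS by (simp add: psd_def Sym_def transpose_simps)
      show "0 \<le> v \<bullet> ((transpose K ** A ** K - S) *v v)" for v
        using min[OF K, of v] by (simp add: matrix_vector_bilinear_simps inner_diff_right quadratic_congruence)
    qed
  qed
  show "degenerate J A \<longleftrightarrow> S = 0"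
  proof
    assume "degenerate J A"
    then obtain K where K: "graph J K" "A ** K = 0" by (auto simp: degenerate_def)
    have "v \<bullet> (S *v v) \<le> 0" for v
      using min[OF K(1), of v] K(2) by (simp add: matrix_vector_mul_assoc)
    then have "psd (- S)" using pS by (simp add: psd_def Sym_def transpose_simps matrix_vector_bilinear_simps)
    from psd_norm_le_trace[OF this] have "norm S \<le> - (mat 1 \<bullet> S)" by simp
    then have "norm S + norm S \<le> 0" using psd_norm_le_trace[OF pS] by linarith
    then show "S = 0" by simp
  next
    assume "S = 0"
    then show "degenerate J A" using gL AL by (auto simp: degenerate_def)
  qed
qed

lemma supported_subspace: "subspace {v. supported J v}"
  by (auto simp: subspace_def supported_def)

lemma dim_supported: "dim {v::real^'n. supported J v} = card J"
  using dim_substandard_cart[where 'a=real and 'n='n, of J] by (simp add: supported_def dim_vec_eq)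

text \<open>
  \<open>A\<close> is injective on vectors supported on \<open>J\<close>, and degeneracy says that they already have the same image as the
  whole space.
\<close>

lemma rank_degenerate:
  fixes A :: "real^'n^'n"
  assumes "c > 0" "block_pos c J A" "degenerate J A"
  shows "rank A = card J"
proof (rule antisym)
  have lin: "linear ((*v) A)" by simp
  obtain K where K: "graph J K" "A ** K = 0" using assms(3) by (auto simp: degenerate_def)
  have "range ((*v) A) \<subseteq> (*v) A ` {v. supported J v}"
  proof
    fix y assume "y \<in> range ((*v) A)"
    then obtain v where y: "y = A *v v" by auto
    have "A *v (K *v v) = 0" by (simp add: matrix_vector_mul_assoc K(2))
    then have "y = A *v (v - K *v v)" by (simp add: y matrix_vector_bilinear_simps)
    moreover have "supported J (v - K *v v)" by (simp add: supported_def graph_row[OF K(1)])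
    ultimately show "y \<in> (*v) A ` {v. supported J v}" by blast
  qed
  then have "rank A \<le> dim ((*v) A ` {v. supported J v})" unfolding rank_dim_range by (rule dim_subset)
  also have "\<dots> \<le> card J" using dim_image_le[OF lin] dim_supported[of J] by metis
  finally show "rank A \<le> card J" .
  have inj: "inj_on ((*v) A) {v. supported J v}"
  proof (rule inj_onI)
    fix x y assume xy: "x \<in> {v. supported J v}" "y \<in> {v. supported J v}" "A *v x = A *v y"
    have "supported J (x - y)" using xy by (simp add: supported_def)
    moreover have "A *v (x - y) = 0" using xy by (simp add: matrix_vector_bilinear_simps)
    ultimately have "c * (norm (x - y))\<^sup>2 \<le> 0" using assms(2) unfolding block_pos_def by (metis inner_zero_right)
    then show "x = y" using assms(1) by (simp add: mult_le_0_iff)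
  qed
  have sp: "span {v::real^'n. supported J v} = {v. supported J v}" by (rule span_eq_iff[THEN iffD2, OF supported_subspace])
  have "card J = dim ((*v) A ` {v. supported J v})"
    using dim_image_eq[OF lin, of "{v. supported J v}"] inj sp dim_supported[of J] by simp
  also have "\<dots> \<le> rank A" unfolding rank_dim_range by (intro dim_subset) auto
  finally show "card J \<le> rank A" .
qed

lemma psd_zero_vector:
  fixes A :: "real^'n^'n"
  assumes "psd A" "v \<bullet> (A *v v) \<le> 0"
  shows "A *v v = 0"
proof -
  obtain c :: "'n \<Rightarrow> real^'n" where c: "A = (\<Sum>k\<in>UNIV. outer (c k) (c k))" using psd_sum_outer[OF assms(1)] .
  have Av: "A *v w = (\<Sum>k\<in>UNIV. (c k \<bullet> w) *\<^sub>R c k)" for w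
    unfolding c by (simp add: bounded_bilinear.sum_left[OF bounded_bilinear_matrix_vector] outer_mult)
  have "v \<bullet> (A *v v) = (\<Sum>k\<in>UNIV. (c k \<bullet> v)\<^sup>2)" unfolding Av by (simp add: inner_sum_right power2_eq_square inner_commute[of v])
  then have "(\<Sum>k\<in>UNIV. (c k \<bullet> v)\<^sup>2) = 0" using assms(2) by (simp add: sum_nonneg antisym)
  then have "c k \<bullet> v = 0" for k by (simp add: sum_nonneg_eq_0_iff)
  then show ?thesis by (simp add: Av)
qed

text \<open>
  Take \<open>J\<close> of maximal cardinality. Enlarging it by \<open>i\<close> produces a null vector of \<open>A\<close> with nonzero \<open>i\<close>-th coordinate,
  and these vectors, normalised, are the columns that degeneracy asks for.
\<close>

lemma maximal_positive_block:
  fixes A :: "real^'n^'n"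
  assumes A: "psd A"
  obtains J c where "c > 0" "block_pos c J A" "degenerate J A"
proof -
  define P where "P J \<longleftrightarrow> (\<forall>v. supported J v \<longrightarrow> v \<noteq> 0 \<longrightarrow> v \<bullet> (A *v v) > 0)" for J
  have "P {}" by (auto simp: P_def supported_def vec_eq_iff)
  then obtain J where J: "P J" and max: "\<And>J'. P J' \<Longrightarrow> card J' \<le> card J"
    using ex_has_greatest_nat[of P "{}" card "CARD('n) + 1"] card_mono[OF finite subset_UNIV] by (metis less_Suc_eq_le Suc_eq_plus1)
  obtain c :: real where c: "c > 0" "block_pos c J A"
    using positive_on_subspace_coercive[OF supported_subspace[of J], of A] J unfolding P_def block_pos_def by auto
  have "\<exists>w. A *v w = 0 \<and> (\<forall>j. j \<notin> J \<longrightarrow> w $ j = (if j = i then 1 else 0))" for i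
  proof (cases "i \<in> J")
    case True
    then show ?thesis by (intro exI[of _ 0]) auto
  next
    case False
    then have "\<not> P (insert i J)" using max[of "insert i J"] by auto
    then obtain v where v: "supported (insert i J) v" "v \<noteq> 0" "v \<bullet> (A *v v) \<le> 0" by (auto simp: P_def not_less)
    have Av: "A *v v = 0" by (rule psd_zero_vector[OF A v(3)])
    have "v $ i \<noteq> 0"
    proof
      assume "v $ i = 0"
      then have "supported J v" using v(1) by (auto simp: supported_def)
      then show False using J v(2,3) by (auto simp: P_def not_less)
    qed
    then show ?thesis using v(1) Av by (intro exI[of _ "v /\<^sub>R (v $ i)"]) (auto simp: matrix_vector_bilinear_simps supported_def)
  qed
  then obtain w where w: "\<And>i. A *v w i = 0" "\<And>i j. j \<notin> J \<Longrightarrow> w i $ j = (if j = i then 1 else 0)" by metis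
  define K where "K = (\<chi> j i. w i $ j)"
  have "graph J K" by (simp add: graph_def K_def w(2))
  moreover have "A ** K = 0"
  proof -
    have "(A ** K) $ j $ i = (A *v w i) $ j" for i j by (simp add: matrix_matrix_mult_def matrix_vector_mult_def K_def)
    then show ?thesis by (simp add: vec_eq_iff w(1))
  qed
  ultimately have "degenerate J A" by (auto simp: degenerate_def)
  from that[OF c this] show thesis .
qed

section \<open>The strong maximum principle for the Schur complement\<close>

lemma linear_family_bounded:
  fixes g :: "'b::metric_space \<Rightarrow> 'a::euclidean_space \<Rightarrow> 'c::real_normed_vector"
  assumes lin: "\<And>x. x \<in> K \<Longrightarrow> linear (g x)" and K: "compact K" and cont: "\<And>v. continuous_on K (\<lambda>x. g x v)"
  obtains B where "B \<ge> 0" "\<And>x v. x \<in> K \<Longrightarrow> norm (g x v) \<le> B * norm v"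
proof -
  have "\<exists>C. \<forall>x\<in>K. norm (g x b) \<le> C" for b
    using compact_imp_bounded[OF compact_continuous_image[OF cont K, of b]] unfolding bounded_iff by auto
  then obtain C where C: "\<And>x b. x \<in> K \<Longrightarrow> norm (g x b) \<le> C b" by metis
  define B where "B = (\<Sum>b\<in>Basis. \<bar>C b\<bar>)"
  show thesis
  proof (rule that)
    show "B \<ge> 0" by (simp add: B_def sum_nonneg)
    fix x v assume x: "x \<in> K"
    have "g x v = (\<Sum>b\<in>Basis. (v \<bullet> b) *\<^sub>R g x b)" by (rule linear_basis_sum[OF lin[OF x]])
    then have "norm (g x v) \<le> (\<Sum>b\<in>Basis. norm ((v \<bullet> b) *\<^sub>R g x b))" by (simp only: norm_sum)
    also have "\<dots> \<le> (\<Sum>b\<in>Basis. norm v * \<bar>C b\<bar>)"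
    proof (rule sum_mono)
      fix b :: 'a assume "b \<in> Basis"
      then have "\<bar>v \<bullet> b\<bar> \<le> norm v" by (rule Basis_le_norm)
      moreover have "norm (g x b) \<le> \<bar>C b\<bar>" using C[OF x, of b] by simp
      ultimately show "norm ((v \<bullet> b) *\<^sub>R g x b) \<le> norm v * \<bar>C b\<bar>" by (simp add: mult_mono)
    qed
    also have "\<dots> = B * norm v" by (simp add: B_def sum_distrib_left mult.commute)
    finally show "norm (g x v) \<le> B * norm v" .
  qed
qed

text \<open>
  Hopf's barrier for the ball of radius \<open>R\<close> about \<open>y\<close>: positive inside, zero on the sphere, with nonzero radial
  derivative there.
\<close>

definition barrier :: "real \<Rightarrow> real \<Rightarrow> 'a::euclidean_space \<Rightarrow> 'a \<Rightarrow> real" where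
  "barrier \<alpha> R y x = exp (- \<alpha> * ((x - y) \<bullet> (x - y))) - exp (- \<alpha> * R\<^sup>2)"

lemma barrier_C2:
  fixes y :: "real^'n" and \<alpha> :: real
  defines "E \<equiv> \<lambda>x. exp (- \<alpha> * ((x - y) \<bullet> (x - y)))"
  shows "C2_on UNIV (\<lambda>x. \<epsilon> * barrier \<alpha> R y x - \<mu>) (\<lambda>x v. \<epsilon> * (- 2 * \<alpha> * ((x - y) \<bullet> v) * E x))
      (\<lambda>x v w. \<epsilon> * ((4 * \<alpha>\<^sup>2 * ((x - y) \<bullet> w) * ((x - y) \<bullet> v) - 2 * \<alpha> * (w \<bullet> v)) * E x))"
proof -
  have dI: "((\<lambda>x. x - y) has_derivative (\<lambda>v. v)) (at x)" for x
    by (rule has_derivative_eq_rhs[OF has_derivative_diff[OF has_derivative_ident has_derivative_const]]) simp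
  have Ex: "exp (- \<alpha> * ((x - y) \<bullet> (x - y))) = E x" for x by (simp add: E_def)
  have dE: "(E has_derivative (\<lambda>v. - 2 * \<alpha> * ((x - y) \<bullet> v) * E x)) (at x)" for x
    unfolding E_def
    by (rule has_derivative_eq_rhs[OF has_derivative_exp[OF has_derivative_mult_right[OF has_derivative_inner[OF dI dI]]]])
       (auto simp: fun_eq_iff inner_commute)
  show ?thesis
    unfolding C2_on_def
  proof (intro conjI ballI allI open_UNIV)
    fix x v
    show "((\<lambda>x. \<epsilon> * barrier \<alpha> R y x - \<mu>) has_derivative (\<lambda>v. \<epsilon> * (- 2 * \<alpha> * ((x - y) \<bullet> v) * E x))) (at x)"
      unfolding barrier_def Ex
      by (rule has_derivative_eq_rhs[OF has_derivative_diff[OF has_derivative_mult_right[OF has_derivative_diff[OF dE has_derivative_const]] has_derivative_const]])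
         (simp add: fun_eq_iff)
    show "((\<lambda>x. \<epsilon> * (- 2 * \<alpha> * ((x - y) \<bullet> v) * E x)) has_derivative
        (\<lambda>w. \<epsilon> * ((4 * \<alpha>\<^sup>2 * ((x - y) \<bullet> w) * ((x - y) \<bullet> v) - 2 * \<alpha> * (w \<bullet> v)) * E x))) (at x)"
      by (rule has_derivative_eq_rhs[OF has_derivative_mult_right[OF has_derivative_mult[OF has_derivative_mult_right[OF has_derivative_inner_left[OF dI]] dE]]])
         (auto simp: fun_eq_iff power2_eq_square algebra_simps)
  next
    fix v w
    show "continuous_on UNIV (\<lambda>x. \<epsilon> * ((4 * \<alpha>\<^sup>2 * ((x - y) \<bullet> w) * ((x - y) \<bullet> v) - 2 * \<alpha> * (w \<bullet> v)) * E x))"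
      unfolding E_def by (intro continuous_intros)
  qed
qed

context elliptic_solution
begin

lemma uniform_bounds:
  assumes K: "compact K" "K \<subseteq> \<Omega>"
  obtains B \<theta> where "B \<ge> B0" "\<And>x. x \<in> K \<Longrightarrow> data_bound B x" "\<theta> > 0" "\<And>x v. x \<in> K \<Longrightarrow> \<theta> * (norm v)\<^sup>2 \<le> v \<bullet> (a x *v v)"
proof -
  have cA: "continuous_on \<Omega> A" "continuous_on \<Omega> Du" "continuous_on \<Omega> a" "continuous_on \<Omega> jet"
    using continuous_data(1,2)[OF _ tendsto_ident_at] a_tendsto[OF _ tendsto_ident_at] jet_tendsto[OF _ tendsto_ident_at]
    unfolding continuous_on_def by blast+
  have bd: "\<exists>C. \<forall>x\<in>K. norm (f x) \<le> C" if "continuous_on \<Omega> f" for f :: "real^'n \<Rightarrow> 'z::real_normed_vector"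
    using compact_imp_bounded[OF compact_continuous_image[OF continuous_on_subset[OF that K(2)] K(1)]] unfolding bounded_iff by auto
  obtain B1 where B1: "\<And>x. x \<in> K \<Longrightarrow> norm (A x) \<le> B1" using bd[OF cA(1)] by blast
  obtain B2 where B2: "\<And>x. x \<in> K \<Longrightarrow> norm (Du x) \<le> B2" using bd[OF cA(2)] by blast
  obtain B3 where B3: "\<And>x. x \<in> K \<Longrightarrow> norm (a x) \<le> B3" using bd[OF cA(3)] by blast
  obtain B4 where B4: "B4 \<ge> 0" "\<And>x v. x \<in> K \<Longrightarrow> norm (A' x v) \<le> B4 * norm v"
    using linear_family_bounded[of K A'] A_linear K continuous_on_subset[OF A(2) K(2)] by blast
  have jetK: "jet x \<in> UNIV \<times> UNIV \<times> UNIV \<times> \<Omega>" if "x \<in> K" for x using that K by auto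
  have cG': "continuous_on K (\<lambda>x. G' (jet x) k)" for k
    by (rule continuous_on_compose2[OF C2_on_continuous(2)[OF G] continuous_on_subset[OF cA(4) K(2)]]) (use jetK in auto)
  have cG'': "continuous_on K (\<lambda>x. G'' (jet x) k l)" for k l
    by (rule continuous_on_compose2[OF C2_onD(4)[OF G] continuous_on_subset[OF cA(4) K(2)]]) (use jetK in auto)
  obtain B5 where B5: "B5 \<ge> 0" "\<And>x k. x \<in> K \<Longrightarrow> norm (G' (jet x) k) \<le> B5 * norm k"
    using linear_family_bounded[of K "\<lambda>x. G' (jet x)"] C2_on_linear(1)[OF G jetK] K(1) cG' by blast
  have "\<exists>C\<ge>0. \<forall>x\<in>K. \<forall>l. norm (G'' (jet x) b l) \<le> C * norm l" for b
  proof -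
    show ?thesis
      by (rule linear_family_bounded[of K "\<lambda>x. G'' (jet x) b", OF C2_on_linear(2)[OF G jetK] K(1) cG'']) auto
  qed
  then obtain C where C: "\<And>b. C b \<ge> 0" "\<And>b x l. x \<in> K \<Longrightarrow> norm (G'' (jet x) b l) \<le> C b * norm l" by metis
  define B6 where "B6 = (\<Sum>b\<in>Basis. C b)"
  have B60: "B6 \<ge> 0" using C(1) by (simp add: B6_def sum_nonneg)
  have B6: "\<bar>G'' (jet x) k l\<bar> \<le> B6 * norm k * norm l" if x: "x \<in> K" for x k l
  proof -
    note lin = C2_on_linear(3)[OF G jetK[OF x], of l]
    have "G'' (jet x) k l = (\<Sum>b\<in>Basis. (k \<bullet> b) * G'' (jet x) b l)"
      using linear_basis_sum[OF lin, of k] by simp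
    then have "\<bar>G'' (jet x) k l\<bar> \<le> (\<Sum>b\<in>Basis. \<bar>k \<bullet> b\<bar> * \<bar>G'' (jet x) b l\<bar>)"
      by (simp add: sum_abs[THEN order_trans] abs_mult)
    also have "\<dots> \<le> (\<Sum>b\<in>Basis. norm k * (C b * norm l))"
    proof (rule sum_mono)
      fix b :: "(real^'n^'n) \<times> (real^'n) \<times> real \<times> (real^'n)" assume "b \<in> Basis"
      then have "\<bar>k \<bullet> b\<bar> \<le> norm k" by (rule Basis_le_norm)
      then show "\<bar>k \<bullet> b\<bar> * \<bar>G'' (jet x) b l\<bar> \<le> norm k * (C b * norm l)"
        using C(2)[OF x, of b l] by (intro mult_mono) auto
    qed
    also have "\<dots> = B6 * norm k * norm l" by (simp add: B6_def sum_distrib_left sum_distrib_right mult_ac)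
    finally show ?thesis .
  qed
  define B where "B = \<bar>B0\<bar> + 1 + \<bar>B1\<bar> + \<bar>B2\<bar> + \<bar>B3\<bar> + B4 + B5 + B6"
  have "\<exists>\<theta>>0. \<forall>x\<in>K. \<forall>v. \<theta> * (norm v)\<^sup>2 \<le> v \<bullet> (a x *v v)"
  proof (cases "K = {}")
    case True then show ?thesis by (intro exI[of _ 1]) simp
  next
    case False
    let ?P = "K \<times> sphere (0::real^'n) 1"
    have "axis undefined 1 \<in> sphere (0::real^'n) 1" by (simp add: norm_axis_1)
    then have ne: "?P \<noteq> {}" using False by blast
    have comp: "compact ?P" using K(1) by (intro compact_Times compact_sphere)
    have ca: "continuous_on ?P (\<lambda>p. snd p \<bullet> (a (fst p) *v snd p))"
      by (intro continuous_intros continuous_on_matrix_vector continuous_on_compose2[OF cA(3)]) (use K in auto)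
    obtain p where p: "p \<in> ?P" "\<And>q. q \<in> ?P \<Longrightarrow> snd p \<bullet> (a (fst p) *v snd p) \<le> snd q \<bullet> (a (fst q) *v snd q)"
      using continuous_attains_inf[OF comp ne ca] by blast
    let ?t = "snd p \<bullet> (a (fst p) *v snd p)"
    have "snd p \<noteq> 0" using p(1) by auto
    then have "?t > 0" using elliptic[of "fst p"] p(1) K(2) unfolding pos_def_def by auto
    moreover have "?t * (norm v)\<^sup>2 \<le> v \<bullet> (a x *v v)" if "x \<in> K" for x v
    proof (cases "v = 0")
      case False
      then have "(x, v /\<^sub>R norm v) \<in> ?P" using that by simp
      from p(2)[OF this] have "?t \<le> (v \<bullet> (a x *v v)) / (norm v)\<^sup>2"
        by (simp add: matrix_vector_bilinear_simps power2_eq_square field_simps)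
      then show ?thesis using False by (simp add: pos_le_divide_eq)
    qed simp
    ultimately show ?thesis by blast
  qed
  then obtain \<theta> where \<theta>: "\<theta> > 0" "\<And>x v. x \<in> K \<Longrightarrow> \<theta> * (norm v)\<^sup>2 \<le> v \<bullet> (a x *v v)" by blast
  have le: "y \<le> B' * z \<Longrightarrow> B' \<le> B \<Longrightarrow> 0 \<le> z \<Longrightarrow> y \<le> B * z" for y z B' by (meson mult_right_mono order_trans)
  show thesis
  proof (rule that[of B \<theta>])
    show "data_bound B x" if x: "x \<in> K" for x
      unfolding data_bound_def
    proof (intro conjI allI)
      show "1 \<le> B" "norm (A x) \<le> B" "norm (a x) \<le> B" "norm (Du x) \<le> B"
        using B1[OF x] B2[OF x] B3[OF x] B4(1) B5(1) B60 unfolding B_def by linarith+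
      show "norm (A' x v) \<le> B * norm v" for v
        by (rule le[OF B4(2)[OF x]]) (use B5(1) B60 in \<open>auto simp: B_def\<close>)
      show "\<bar>G' (jet x) k\<bar> \<le> B * norm k" for k
        by (rule le[OF B5(2)[OF x, unfolded real_norm_def]]) (use B4(1) B60 in \<open>auto simp: B_def\<close>)
      show "\<bar>G'' (jet x) k l\<bar> \<le> B * norm k * norm l" for k l
        using le[OF B6[OF x, of k l, unfolded mult.assoc]] B4(1) B5(1) by (simp add: B_def mult.assoc)
    qed
    show "\<theta> * (norm v)\<^sup>2 \<le> v \<bullet> (a x *v v)" if "x \<in> K" for x v by (rule \<theta>(2)[OF that])
  qed (use \<theta> B4(1) B5(1) B60 in \<open>auto simp: B_def\<close>)
qed

text \<open>
  Otherwise there is a closed ball that meets the set where \<open>S = 0\<close> in a single boundary point \<open>z\<close>, with \<open>z\<close> near \<open>xh\<close>. A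
  small multiple of the barrier lies below \<open>spread S\<close> on the boundary of a small ball about \<open>z\<close>. It does so inside as
  well: at an interior minimum of the difference with a negative value, a translate of the barrier would touch
  \<open>spread S\<close> from below and contradict \<open>touching_estimate\<close>. But \<open>S \<ge> 0\<close> vanishes to first order at \<open>z\<close>, and the
  barrier does not.
\<close>

lemma degenerate_nearby:
  assumes xh: "xh \<in> \<Omega>" and c0: "c0 > 0" "block_pos c0 J (A xh)" and deg: "degenerate J (A xh)"
  shows "\<exists>\<delta>>0. \<exists>c>0. ball xh \<delta> \<subseteq> \<Omega> \<and> (\<forall>x\<in>ball xh \<delta>. block_pos c J (A x) \<and> degenerate J (A x))"
proof -
  define c where "c = c0 / 2"
  have c: "c > 0" using c0 by (simp add: c_def)
  have "(A \<longlongrightarrow> A xh) (nhds xh)" using continuous_data(1)[OF xh, of "\<lambda>x. x" "nhds xh"] by (simp add: filterlim_def)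
  then have "\<forall>\<^sub>F x in nhds xh. dist (A x) (A xh) < c" using c by (rule tendstoD)
  then obtain d1 where d1: "d1 > 0" "\<And>x. x \<in> ball xh d1 \<Longrightarrow> dist (A x) (A xh) < c"
    unfolding eventually_nhds_metric by (auto simp: dist_commute)
  obtain d2 where d2: "d2 > 0" "ball xh d2 \<subseteq> \<Omega>" using open_dom xh openE by blast
  define \<delta> where "\<delta> = min d1 d2 / 2"
  have \<delta>: "\<delta> > 0" "cball xh \<delta> \<subseteq> ball xh d1" "cball xh \<delta> \<subseteq> \<Omega>" using d1 d2 by (auto simp: \<delta>_def)
  let ?K = "cball xh \<delta>"
  have bp: "block_pos c J (A x)" if "x \<in> ?K" for x
    unfolding block_pos_def
  proof (intro allI impI)
    fix v assume v: "supported J v"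
    have "norm (A x - A xh) \<le> c" using d1(2)[of x] that \<delta>(2) by (auto simp: dist_norm less_imp_le)
    then have "norm ((A x - A xh) *v v) \<le> c * norm v"
      using norm_matrix_vector_le[of "A x - A xh" v] mult_right_mono[of _ c "norm v"] by fastforce
    then have "\<bar>v \<bullet> ((A x - A xh) *v v)\<bar> \<le> norm v * (c * norm v)"
      using Cauchy_Schwarz_ineq2[of v "(A x - A xh) *v v"] mult_left_mono[of _ "c * norm v" "norm v"] by fastforce
    then have "v \<bullet> (A xh *v v) - c * (norm v)\<^sup>2 \<le> v \<bullet> (A x *v v)"
      by (simp add: matrix_vector_bilinear_simps inner_diff_right power2_eq_square abs_le_iff mult_ac)
    moreover have "c0 * (norm v)\<^sup>2 \<le> v \<bullet> (A xh *v v)" using c0(2) v by (simp add: block_pos_def)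
    moreover have "c0 * (norm v)\<^sup>2 - c * (norm v)\<^sup>2 = c * (norm v)\<^sup>2" by (simp add: c_def field_simps)
    ultimately show "c * (norm v)\<^sup>2 \<le> v \<bullet> (A x *v v)" by linarith
  qed
  let ?N = "real CARD('n)" and ?I = "mat 1 :: real^'n^'n"
  obtain B \<theta> where B1: "B \<ge> ?N / c" and bound: "\<And>x. x \<in> ?K \<Longrightarrow> data_bound B x"
    and \<theta>: "\<theta> > 0" "\<And>x v. x \<in> ?K \<Longrightarrow> \<theta> * (norm v)\<^sup>2 \<le> v \<bullet> (a x *v v)"
    using uniform_bounds[OF compact_cball \<delta>(3), of "?N / c"] by blast
  have B: "1 \<le> B" "\<And>x. x \<in> ?K \<Longrightarrow> norm (A x) \<le> B" "\<And>x. x \<in> ?K \<Longrightarrow> norm (a x) \<le> B"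
    using bound[of xh] bound \<delta>(1) by (simp_all add: data_bound_def)
  have "\<exists>H. H \<in> Sym \<and> H ** A x ** H = H \<and> (\<forall>i. i \<notin> J \<longrightarrow> H $ i = 0) \<and> (\<forall>v. supported J v \<longrightarrow> H *v (A x *v v) = v) \<and> norm H \<le> B" if x: "x \<in> ?K" for x
  proof -
    have "A x \<in> Sym" using A_psd[of x] x \<delta>(3) by (auto simp: psd_def)
    from block_inverse[OF this c bp[OF x]] show ?thesis using B1 by (metis order_trans)
  qed
  then have "\<exists>H. \<forall>x\<in>?K. H x \<in> Sym \<and> H x ** A x ** H x = H x \<and> (\<forall>i. i \<notin> J \<longrightarrow> H x $ i = 0) \<and>
     (\<forall>v. supported J v \<longrightarrow> H x *v (A x *v v) = v) \<and> norm (H x) \<le> B"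
    by (intro bchoice ballI)
  then obtain H where HH: "\<forall>x\<in>?K. H x \<in> Sym \<and> H x ** A x ** H x = H x \<and> (\<forall>i. i \<notin> J \<longrightarrow> H x $ i = 0) \<and>
     (\<forall>v. supported J v \<longrightarrow> H x *v (A x *v v) = v) \<and> norm (H x) \<le> B" by (elim exE)
  have H: "\<And>x. x \<in> ?K \<Longrightarrow> H x \<in> Sym" "\<And>x. x \<in> ?K \<Longrightarrow> H x ** A x ** H x = H x"
     "\<And>x i. x \<in> ?K \<Longrightarrow> i \<notin> J \<Longrightarrow> H x $ i = 0" "\<And>x v. x \<in> ?K \<Longrightarrow> supported J v \<Longrightarrow> H x *v (A x *v v) = v"
     "\<And>x. x \<in> ?K \<Longrightarrow> norm (H x) \<le> B"
    using HH by (blast+)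
  define L where "L x = ?I - H x ** A x" for x
  define S where "S x = A x - A x ** H x ** A x" for x
  have psdK: "psd (A x)" if "x \<in> ?K" for x using A_psd that \<delta>(3) by blast
  have sc: "graph J (L x)" "A x ** L x = S x" "transpose (L x) ** A x ** L x = S x" "psd (S x)"
     "\<And>K. graph J K \<Longrightarrow> spread (S x) \<le> spread (transpose K ** A x ** K)" "degenerate J (A x) \<longleftrightarrow> S x = 0"
    if x: "x \<in> ?K" for x
    using schur_complement[OF psdK[OF x] H(1,2)[OF x] H(3)[OF x] H(4)[OF x], folded L_def S_def] by auto
  \<comment> \<open>the extra \<open>1\<close> in the radius of \<open>\<L>\<close> leaves room to vary \<open>L x0\<close>\<close>
  define R0 where "R0 = norm ?I + B * B"
  have LR: "norm (L x) \<le> R0" if x: "x \<in> ?K" for x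
  proof -
    have "norm (L x) \<le> norm ?I + norm (H x ** A x)" unfolding L_def by (rule norm_triangle_ineq4)
    also have "norm (H x ** A x) \<le> B * B"
      using norm_matrix_mult_le[of "H x" "A x"] mult_mono[OF H(5)[OF x] B(2)[OF x]] B(1) by simp
    finally show ?thesis by (simp add: R0_def)
  qed
  define \<L> where "\<L> = {K::real^'n^'n. graph J K} \<inter> cball 0 (R0 + 1)"
  have c\<L>: "compact \<L>" unfolding \<L>_def by (intro closed_Int_compact closed_graph compact_cball)
  have L\<L>: "L x \<in> \<L>" if "x \<in> ?K" for x using sc(1)[OF that] LR[OF that] by (simp add: \<L>_def)
  have cA: "continuous_on ?K A"
    using continuous_data(1)[OF _ tendsto_ident_at] \<delta>(3) unfolding continuous_on_def
    by (meson in_mono tendsto_within_subset)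
  define f where "f p = spread (transpose (snd p) ** A (fst p) ** snd p)" for p :: "(real^'n) \<times> (real^'n^'n)"
  have tr_cont: "continuous_on X (\<lambda>p. transpose (g p))" if "continuous_on X g" for X and g :: "(real^'n) \<times> (real^'n^'n) \<Rightarrow> real^'n^'n"
    by (rule bounded_linear.continuous_on[OF bounded_linear_transpose that])
  have cf: "continuous_on (?K \<times> \<L>) f"
    unfolding f_def spread_def
    by (intro continuous_intros continuous_on_matrix_matrix tr_cont continuous_on_compose2[OF cA]) auto
  have fpsd: "psd (transpose K ** A x ** K)" if "x \<in> ?K" for x K by (rule psd_congruence[OF psdK[OF that]])
  have f0: "f (x, K) \<ge> 0" if "x \<in> ?K" for x K
    using spread_ge_norm[OF fpsd[OF that, of K]] norm_ge_zero[of "transpose K ** A x ** K"]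
    unfolding f_def fst_conv snd_conv by linarith
  have fS: "f (x, L x) = spread (S x)" "\<And>K. K \<in> \<L> \<Longrightarrow> spread (S x) \<le> f (x, K)" if "x \<in> ?K" for x
    using sc(3,5)[OF that] by (auto simp: f_def \<L>_def)
  have Spos: "spread (S x) > 0" if "x \<in> ?K" "\<not> degenerate J (A x)" for x
    using spread_ge_norm[OF sc(4)[OF that(1)]] sc(6)[OF that(1)] that(2) by (smt (verit) norm_le_zero_iff)
  define Z where "Z = {x \<in> cball xh (\<delta> / 2). degenerate J (A x)}"
  have Kh: "cball xh (\<delta> / 2) \<subseteq> ?K" using \<delta>(1) by auto
  have Zc: "compact Z"
  proof -
    have "Z = fst ` ({p \<in> cball xh (\<delta> / 2) \<times> \<L>. A (fst p) ** snd p = 0})"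
    proof (intro equalityI subsetI)
      fix x assume x: "x \<in> Z"
      then have "x \<in> cball xh (\<delta> / 2)" "degenerate J (A x)" by (auto simp: Z_def)
      moreover from this Kh have xK: "x \<in> ?K" by blast
      ultimately have "A x ** L x = 0" using sc(2,6) by metis
      then have "(x, L x) \<in> {p \<in> cball xh (\<delta> / 2) \<times> \<L>. A (fst p) ** snd p = 0}"
        using x L\<L>[OF xK] by (simp add: Z_def)
      then show "x \<in> fst ` ({p \<in> cball xh (\<delta> / 2) \<times> \<L>. A (fst p) ** snd p = 0})" by force
    next
      fix x assume "x \<in> fst ` ({p \<in> cball xh (\<delta> / 2) \<times> \<L>. A (fst p) ** snd p = 0})"
      then show "x \<in> Z" by (auto simp: Z_def degenerate_def \<L>_def)
    qed
    moreover have "closed {p \<in> cball xh (\<delta> / 2) \<times> \<L>. A (fst p) ** snd p = 0}"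
    proof -
      have "continuous_on (cball xh (\<delta> / 2) \<times> \<L>) (\<lambda>p. A (fst p) ** snd p)"
        by (intro continuous_intros continuous_on_matrix_matrix continuous_on_compose2[OF cA]) (use Kh in auto)
      from continuous_closed_preimage_constant[OF this] show ?thesis
        using c\<L> by (simp add: closed_Times compact_imp_closed)
    qed
    then have "compact {p \<in> cball xh (\<delta> / 2) \<times> \<L>. A (fst p) ** snd p = 0}"
      by (rule compact_eq_bounded_closed[THEN iffD2, OF conjI, rotated])
         (rule bounded_subset[OF compact_imp_bounded[OF compact_Times[OF compact_cball c\<L>]]], auto)
    then have "compact (fst ` {p \<in> cball xh (\<delta> / 2) \<times> \<L>. A (fst p) ** snd p = 0})"
      by (intro compact_continuous_image continuous_intros)
    ultimately show ?thesis by simp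
  qed
  have xhZ: "xh \<in> Z" using deg \<delta>(1) by (simp add: Z_def)
  have "degenerate J (A x1)" if x1: "x1 \<in> ball xh (\<delta> / 4)" for x1
  proof (rule ccontr)
    assume nd: "\<not> degenerate J (A x1)"
    obtain z where z: "z \<in> Z" "\<And>w. w \<in> Z \<Longrightarrow> dist x1 z \<le> dist x1 w"
      using distance_attains_inf[of Z x1] Zc xhZ compact_imp_closed by blast
    \<comment> \<open>half of the ball about \<open>x1\<close> with \<open>z\<close> on its boundary: tangent at \<open>z\<close>, and no other degenerate point in its closure\<close>
    define R where "R = dist x1 z / 2"
    define y where "y = midpoint x1 z"
    have zx1: "z \<noteq> x1" using z(1) nd by (auto simp: Z_def)
    have R: "R > 0" using zx1 by (simp add: R_def)
    have d4: "2 * R < \<delta> / 4" using z(2)[OF xhZ] x1 by (simp add: R_def dist_commute)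
    have zy: "dist z y = R" "dist x1 y = R" by (simp_all add: y_def R_def dist_midpoint dist_commute)
    have zh: "dist xh z < \<delta> / 2"
      using dist_triangle[of xh z x1] x1 d4 by (simp add: R_def dist_commute)
    have inball: "\<not> degenerate J (A x)" if x: "dist x y \<le> R" "x \<noteq> z" for x
    proof
      assume dx: "degenerate J (A x)"
      have tri: "dist x1 x \<le> 2 * R" using dist_triangle[of x1 x y] x(1) zy(2) by (simp add: dist_commute)
      then have "dist xh x \<le> \<delta> / 2" using dist_triangle[of xh x x1] x1 d4 by simp
      then have "x \<in> Z" using dx by (simp add: Z_def)
      then have "2 * R \<le> dist x1 x" using z(2)[of x] by (simp add: R_def)
      then have e: "norm ((x - y) - (x1 - y)) = 2 * R" using tri by (simp add: dist_norm norm_minus_commute)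
      have "(norm ((x - y) + (x1 - y)))\<^sup>2 = 2 * (norm (x - y))\<^sup>2 + 2 * (norm (x1 - y))\<^sup>2 - (norm ((x - y) - (x1 - y)))\<^sup>2"
        by (simp only: power2_norm_eq_inner inner_add_left inner_add_right inner_diff_left inner_diff_right inner_commute)
          (simp add: algebra_simps)
      also have "\<dots> \<le> 2 * R\<^sup>2 + 2 * R\<^sup>2 - (2 * R)\<^sup>2"
        unfolding e using x(1) zy(2) R by (intro diff_mono add_mono mult_left_mono power_mono) (auto simp: dist_norm)
      also have "\<dots> = 0" by (simp add: power2_eq_square)
      finally have "(x - y) + (x1 - y) = 0" by simp
      then have "x = 2 *\<^sub>R y - x1" by (simp add: scaleR_2 algebra_simps)
      also have "\<dots> = z" by (simp add: y_def midpoint_def)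
      finally show False using x(2) by simp
    qed
    define \<rho> where "\<rho> = min (R / 2) (\<delta> / 2 - dist xh z)"
    have \<rho>: "\<rho> > 0" "\<rho> \<le> R / 2" using R zh by (auto simp: \<rho>_def min_def)
    have subK: "cball z \<rho> \<subseteq> ?K"
    proof
      fix x assume "x \<in> cball z \<rho>"
      then have "dist z x \<le> \<delta> / 2 - dist xh z" by (simp add: \<rho>_def)
      then have "dist xh x \<le> \<delta> / 2" using dist_triangle[of xh x z] by linarith
      then show "x \<in> ?K" using \<delta>(1) by simp
    qed
    have far: "R / 2 \<le> norm (x - y)" "norm (x - y) \<le> 3 * R / 2" if "x \<in> cball z \<rho>" for x
      using dist_triangle[of z y x] dist_triangle[of x y z] that \<rho>(2) zy(1) by (auto simp: dist_norm norm_minus_commute)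
    define C where "C = touch_const (norm ?I) ?N B \<theta>"
    have C0: "C \<ge> 0"
      using B(1) \<theta>(1) by (simp add: C_def touch_const_def Let_def error_const_def)
    \<comment> \<open>in the elliptic operator applied to the barrier, \<open>\<alpha>\<^sup>2\<close> has a coefficient of at least \<open>\<theta> R\<^sup>2 exp (\<dots>)\<close>; all other terms are at most linear in \<open>\<alpha>\<close>\<close>
    define \<alpha> where "\<alpha> = (2 * B * norm ?I + 3 * C * R * ?N + C + 1) / (\<theta> * R\<^sup>2) + 1"
    have num0: "2 * B * norm ?I + 3 * C * R * ?N + C + 1 > 0" using B(1) C0 R by (simp add: add_nonneg_pos)
    then have \<alpha>1: "\<alpha> \<ge> 1" using \<theta>(1) R by (simp add: \<alpha>_def)
    have \<alpha>: "\<alpha> * (\<theta> * R\<^sup>2) > 2 * B * norm ?I + 3 * C * R * ?N + C"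
    proof -
      have "\<alpha> * (\<theta> * R\<^sup>2) = 2 * B * norm ?I + 3 * C * R * ?N + C + 1 + \<theta> * R\<^sup>2"
      proof -
        have "(m / q + 1) * q = m + q" if "q \<noteq> 0" for m q :: real using that by (simp add: distrib_right)
        from this[of "\<theta> * R\<^sup>2"] show ?thesis using \<theta>(1) R unfolding \<alpha>_def by simp
      qed
      then show ?thesis using \<theta>(1) R by (simp add: add_pos_nonneg)
    qed
    define v where "v = barrier \<alpha> R y"
    define E where "E x = exp (- \<alpha> * ((x - y) \<bullet> (x - y)))" for x
    have vE: "v x \<le> E x" "E x > 0" "E x \<le> 1" for x using \<alpha>1 by (simp_all add: v_def barrier_def E_def)
    have vpos: "v x > 0 \<longleftrightarrow> norm (x - y) < R" "v x = 0 \<longleftrightarrow> norm (x - y) = R" for x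
    proof -
      have "v x > 0 \<longleftrightarrow> (norm (x - y))\<^sup>2 < R\<^sup>2" "v x = 0 \<longleftrightarrow> (norm (x - y))\<^sup>2 = R\<^sup>2"
        using \<alpha>1 by (simp_all add: v_def barrier_def power2_norm_eq_inner)
      then show "v x > 0 \<longleftrightarrow> norm (x - y) < R" "v x = 0 \<longleftrightarrow> norm (x - y) = R"
        using R power_less_imp_less_base[of "norm (x - y)" 2 R] power_strict_mono[of "norm (x - y)" R 2]
        by (auto simp: power2_eq_iff_nonneg)
    qed
    have cv: "continuous_on X v" for X unfolding v_def barrier_def by (intro continuous_intros)
    let ?Q = "(sphere z \<rho> \<inter> cball y R) \<times> \<L>"
    have "\<exists>\<epsilon>>0. \<forall>p\<in>?Q. \<epsilon> \<le> f p"
    proof (cases "?Q = {}")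
      case True
      show ?thesis unfolding True by (intro exI[of _ 1]) simp
    next
      case False
      have "compact ?Q" by (intro compact_Times c\<L> compact_Int compact_sphere compact_cball)
      moreover have "continuous_on ?Q f"
        by (rule continuous_on_subset[OF cf]) (use subK in \<open>auto simp: subset_iff\<close>)
      ultimately obtain p where p: "p \<in> ?Q" "\<And>q. q \<in> ?Q \<Longrightarrow> f p \<le> f q"
        using continuous_attains_inf[of ?Q f] False by blast
      obtain x K where pxK: "p = (x, K)" by fastforce
      have x: "x \<in> sphere z \<rho>" "x \<in> cball y R" "K \<in> \<L>" using p(1) pxK by auto
      have xK: "x \<in> ?K" using x(1) subK by auto
      have "x \<noteq> z" using x(1) \<rho>(1) by auto
      then have "\<not> degenerate J (A x)" using x(2) by (intro inball) (auto simp: dist_commute)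
      from Spos[OF xK this] fS(2)[OF xK x(3)] have "f p > 0" by (simp add: pxK)
      then show ?thesis using p(2) by blast
    qed
    then obtain \<epsilon> where \<epsilon>: "\<epsilon> > 0" "\<And>p. p \<in> ?Q \<Longrightarrow> \<epsilon> \<le> f p" by blast
    have nonneg: "0 \<le> f p - \<epsilon> * v (fst p)" if p: "p \<in> cball z \<rho> \<times> \<L>" for p
    proof -
      have cF: "continuous_on (cball z \<rho> \<times> \<L>) (\<lambda>p. f p - \<epsilon> * v (fst p))"
        by (intro continuous_intros continuous_on_subset[OF cf] continuous_on_compose2[OF cv[of UNIV]]) (use subK in auto)
      obtain q where q: "q \<in> cball z \<rho> \<times> \<L>" "\<And>p. p \<in> cball z \<rho> \<times> \<L> \<Longrightarrow> f q - \<epsilon> * v (fst q) \<le> f p - \<epsilon> * v (fst p)"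
        using continuous_attains_inf[OF compact_Times[OF compact_cball c\<L>] _ cF] p by blast
      obtain x0 K0 where qx: "q = (x0, K0)" by fastforce
      have x0: "x0 \<in> cball z \<rho>" and K0: "K0 \<in> \<L>" using q(1) qx by auto
      have x0K: "x0 \<in> ?K" using x0 subK by blast
      have x0O: "x0 \<in> \<Omega>" using x0K \<delta>(3) by blast
      define \<mu> where "\<mu> = \<epsilon> * v x0 - f (x0, K0)"
      have "\<mu> \<le> 0"
      proof (rule ccontr)
        assume "\<not> \<mu> \<le> 0"
        then have \<mu>: "\<mu> > 0" by simp
        have "\<epsilon> * v x0 > 0" using \<mu> f0[OF x0K, of K0] by (simp add: \<mu>_def)
        then have vx0: "v x0 > 0" using \<epsilon>(1) by (simp add: zero_less_mult_iff)
        then have nx0: "norm (x0 - y) < R" by (simp add: vpos)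
        have "x0 \<noteq> z" using nx0 zy(1) by (auto simp: dist_norm)
        then have nd0: "\<not> degenerate J (A x0)" using nx0 by (intro inball) (auto simp: dist_norm)
        have "x0 \<notin> sphere z \<rho>"
        proof
          assume "x0 \<in> sphere z \<rho>"
          then have "(x0, K0) \<in> ?Q" using nx0 K0 by (simp add: dist_norm norm_minus_commute)
          from \<epsilon>(2)[OF this] have "\<epsilon> \<le> f (x0, K0)" .
          moreover have "\<epsilon> * v x0 \<le> \<epsilon> * 1" using \<epsilon>(1) vE(1,3)[of x0] by (intro mult_left_mono) auto
          ultimately show False using \<mu> by (simp add: \<mu>_def)
        qed
        then have x0b: "x0 \<in> ball z \<rho>" using x0 by (auto simp: less_le)
        define \<phi> where "\<phi> x = \<epsilon> * barrier \<alpha> R y x - \<mu>" for x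
        have S0: "S x0 \<noteq> 0" using nd0 sc(6)[OF x0K] by simp
        have eq: "\<phi> x0 = 2 * (?I \<bullet> S x0) - norm (S x0)"
        proof -
          have "f (x0, K0) - \<epsilon> * v x0 \<le> f (x0, L x0) - \<epsilon> * v x0" using q(2)[of "(x0, L x0)"] x0 L\<L>[OF x0K] qx by simp
          then have "f (x0, K0) = spread (S x0)" using fS[OF x0K] K0 by (simp add: order.antisym)
          then show ?thesis by (simp add: \<phi>_def \<mu>_def v_def spread_def)
        qed
        define Lx where "Lx x = L x0 - H x0 ** A' x0 (x - x0) ** L x0" for x
        have touch: "\<forall>\<^sub>F x in nhds x0. \<phi> x \<le> 2 * (?I \<bullet> (transpose (Lx x) ** A x ** Lx x)) - norm (transpose (Lx x) ** A x ** Lx x)"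
        proof -
          have blA': "bounded_linear (A' x0)" using A_linear[OF x0O] linear_conv_bounded_linear by blast
          have "(Lx \<longlongrightarrow> L x0 - H x0 ** A' x0 (x0 - x0) ** L x0) (nhds x0)"
            unfolding Lx_def
            by (intro tendsto_intros tendsto_matrix_matrix bounded_linear.tendsto[OF blA']) (simp_all add: filterlim_def)
          then have "(Lx \<longlongrightarrow> L x0) (nhds x0)" using A_linear[OF x0O] by (simp add: linear_0 matrix_bilinear_simps)
          then have "\<forall>\<^sub>F x in nhds x0. dist (Lx x) (L x0) < 1" by (rule tendstoD) simp
          moreover have "\<forall>\<^sub>F x in nhds x0. x \<in> ball z \<rho>" using x0b by (intro eventually_nhds_in_open) auto
          ultimately show ?thesis
          proof eventually_elim
            case (elim x)
            have "norm (Lx x) \<le> norm (L x0) + dist (Lx x) (L x0)" using norm_triangle_sub[of "Lx x" "L x0"] by (simp add: dist_norm)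
            then have n: "norm (Lx x) \<le> R0 + 1" using elim(1) LR[OF x0K] by simp
            have "graph J (Lx x)" unfolding Lx_def
              by (rule graph_sub[OF sc(1)[OF x0K]]) (simp add: mult_row_zero H(3)[OF x0K])
            then have "(x, Lx x) \<in> cball z \<rho> \<times> \<L>" using n elim(2) by (simp add: \<L>_def)
            from q(2)[OF this] show ?case by (simp add: qx \<mu>_def \<phi>_def f_def spread_def v_def)
          qed
        qed
        define \<Phi> where "\<Phi> x = (\<epsilon> * (4 * \<alpha>\<^sup>2 * E x)) *\<^sub>R outer (x - y) (x - y) - (\<epsilon> * (2 * \<alpha> * E x)) *\<^sub>R ?I" for x
        have \<Phi>1: "\<epsilon> * ((4 * \<alpha>\<^sup>2 * ((x - y) \<bullet> w) * ((x - y) \<bullet> w) - 2 * \<alpha> * (w \<bullet> w)) * exp (- \<alpha> * ((x - y) \<bullet> (x - y)))) = w \<bullet> (\<Phi> x *v w)" for x w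
        proof -
          have "w \<bullet> ((p *\<^sub>R outer d d - q *\<^sub>R ?I) *v w) = p * ((d \<bullet> w) * (d \<bullet> w)) - q * (w \<bullet> w)" for p q d
            by (simp add: matrix_vector_bilinear_simps outer_mult inner_diff_right inner_commute[of w d])
          then show ?thesis unfolding \<Phi>_def E_def
            by (simp only: left_diff_distrib right_diff_distrib mult_ac)
        qed
        have \<Phi>2: "continuous_on UNIV \<Phi>"
        proof -
          have "continuous_on UNIV (\<lambda>x. outer (x - y) (x - y))"
            unfolding outer_def by (intro continuous_on_vec_lambda continuous_intros)
          then show ?thesis unfolding \<Phi>_def E_def by (intro continuous_intros)
        qed
        note est = touching_estimate[OF x0O H(1,2)[OF x0K] bound[OF x0K] H(5)[OF x0K]
            \<theta>(1) \<theta>(2)[OF x0K] barrier_C2[of \<epsilon> \<alpha> R y \<mu>, folded \<phi>_def] UNIV_I \<Phi>1 \<Phi>2]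
        have est: "a x0 \<bullet> \<Phi> x0 \<le> C * ((\<Sum>i\<in>UNIV. \<bar>\<epsilon> * (- 2 * \<alpha> * ((x0 - y) \<bullet> axis i 1) * E x0)\<bar>) + \<phi> x0)"
          unfolding C_def E_def
          by (rule est) (use touch eq S0 in \<open>simp_all add: Lx_def L_def S_def\<close>)
        have "(\<Sum>i\<in>UNIV. \<bar>\<epsilon> * (- 2 * \<alpha> * ((x0 - y) \<bullet> axis i 1) * E x0)\<bar>) \<le> (\<Sum>i\<in>(UNIV::'n set). \<epsilon> * E x0 * (3 * \<alpha> * R))"
        proof (rule sum_mono)
          fix i :: 'n
          have "\<bar>(x0 - y) \<bullet> axis i 1\<bar> \<le> 3 * R / 2"
            using Cauchy_Schwarz_ineq2[of "x0 - y" "axis i 1"] far(2)[OF x0] by (simp add: norm_axis_1)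
          then have "(\<epsilon> * E x0 * (2 * \<alpha>)) * \<bar>(x0 - y) \<bullet> axis i 1\<bar> \<le> (\<epsilon> * E x0 * (2 * \<alpha>)) * (3 * R / 2)"
            using \<epsilon>(1) vE(2)[of x0] \<alpha>1 by (intro mult_left_mono) auto
          then show "\<bar>\<epsilon> * (- 2 * \<alpha> * ((x0 - y) \<bullet> axis i 1) * E x0)\<bar> \<le> \<epsilon> * E x0 * (3 * \<alpha> * R)"
            using \<epsilon>(1) vE(2)[of x0] \<alpha>1 by (simp add: abs_mult mult_ac)
        qed
        also have "\<dots> = \<epsilon> * E x0 * (3 * \<alpha> * R * ?N)" by simp
        finally have sum_le: "(\<Sum>i\<in>UNIV. \<bar>\<epsilon> * (- 2 * \<alpha> * ((x0 - y) \<bullet> axis i 1) * E x0)\<bar>) \<le> \<epsilon> * E x0 * (3 * \<alpha> * R * ?N)" .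
        have "\<phi> x0 \<le> \<epsilon> * E x0"
          using \<mu> mult_left_mono[OF vE(1)[of x0] less_imp_le[OF \<epsilon>(1)]] unfolding \<phi>_def v_def by linarith
        then have "a x0 \<bullet> \<Phi> x0 \<le> C * (\<epsilon> * E x0 * (3 * \<alpha> * R * ?N) + \<epsilon> * E x0)"
          using sum_le C0 by (intro order_trans[OF est] mult_left_mono add_mono) auto
        also have "\<dots> = \<epsilon> * E x0 * (\<alpha> * (3 * C * R * ?N) + C)" by (simp add: algebra_simps)
        also have "\<dots> \<le> \<epsilon> * E x0 * (\<alpha> * (3 * C * R * ?N) + \<alpha> * C)"
          using \<epsilon>(1) vE(2)[of x0] \<alpha>1 C0 by (intro mult_left_mono add_left_mono) (auto simp: mult_le_cancel_right1)
        finally have upper: "a x0 \<bullet> \<Phi> x0 \<le> \<epsilon> * E x0 * (\<alpha> * (3 * C * R * ?N + C))" by (simp add: algebra_simps)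
        have "a x0 \<bullet> \<Phi> x0 = \<epsilon> * E x0 * (4 * \<alpha>\<^sup>2 * ((x0 - y) \<bullet> (a x0 *v (x0 - y))) - 2 * \<alpha> * (a x0 \<bullet> ?I))"
          unfolding \<Phi>_def by (simp add: inner_diff_right inner_outer algebra_simps)
        also have "\<dots> \<ge> \<epsilon> * E x0 * (4 * \<alpha>\<^sup>2 * (\<theta> * (R / 2)\<^sup>2) - 2 * \<alpha> * (B * norm ?I))"
        proof (intro mult_left_mono diff_mono)
          have "\<theta> * (R / 2)\<^sup>2 \<le> \<theta> * (norm (x0 - y))\<^sup>2" using far(1)[OF x0] R \<theta>(1) by (intro mult_left_mono power_mono) auto
          then show "\<theta> * (R / 2)\<^sup>2 \<le> (x0 - y) \<bullet> (a x0 *v (x0 - y))" using \<theta>(2)[OF x0K, of "x0 - y"] by linarith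
          show "a x0 \<bullet> ?I \<le> B * norm ?I"
            using norm_cauchy_schwarz[of "a x0" ?I] mult_right_mono[OF B(3)[OF x0K], of "norm ?I"] by simp
        qed (use \<epsilon>(1) vE(2)[of x0] \<alpha>1 in auto)
        also have "\<epsilon> * E x0 * (4 * \<alpha>\<^sup>2 * (\<theta> * (R / 2)\<^sup>2) - 2 * \<alpha> * (B * norm ?I)) = \<epsilon> * E x0 * (\<alpha> * (\<alpha> * (\<theta> * R\<^sup>2) - 2 * B * norm ?I))"
          by (simp add: power2_eq_square algebra_simps)
        finally have "\<epsilon> * E x0 * (\<alpha> * (\<alpha> * (\<theta> * R\<^sup>2) - 2 * B * norm ?I)) \<le> \<epsilon> * E x0 * (\<alpha> * (3 * C * R * ?N + C))" using upper by linarith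
        then have "\<alpha> * (\<theta> * R\<^sup>2) - 2 * B * norm ?I \<le> 3 * C * R * ?N + C"
          using \<epsilon>(1) vE(2)[of x0] \<alpha>1 by (simp add: mult_le_cancel_left_pos)
        then show False using \<alpha> by linarith
      qed
      then show ?thesis using q(2)[OF p] by (simp add: qx \<mu>_def)
    qed
    have zK: "z \<in> ?K" using subsetD[OF subK, of z] \<rho>(1) by simp
    have zO: "z \<in> \<Omega>" using zK \<delta>(3) by blast
    have dz: "degenerate J (A z)" using z(1) by (simp add: Z_def)
    let ?Lz = "L z"
    \<comment> \<open>with \<open>L\<close> frozen at \<open>z\<close>, the trace is differentiable, nonnegative and zero at \<open>z\<close>\<close>
    define T where "T x = ?I \<bullet> (transpose ?Lz ** A x ** ?Lz)" for x
    have Sz: "transpose ?Lz ** A z ** ?Lz = 0" using sc(3,6)[OF zK] dz by simp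
    have T0: "T z = 0" unfolding T_def Sz by simp
    have dT: "(T has_derivative (\<lambda>X. ?I \<bullet> (transpose ?Lz ** A' z X ** ?Lz))) (at z)"
      unfolding T_def
      by (rule has_derivative_eq_rhs[OF has_derivative_inner_right[OF has_derivative_matrix_matrix[OF has_derivative_matrix_matrix[OF has_derivative_const A(1)[OF zO]] has_derivative_const]]])
         (simp add: matrix_bilinear_simps)
    have "\<forall>x\<in>ball z \<rho>. T z \<le> T x"
    proof
      fix x assume "x \<in> ball z \<rho>"
      then have "x \<in> ?K" by (intro subsetD[OF subK]) simp
      from psd_norm_le_trace[OF fpsd[OF this, of ?Lz]] norm_ge_zero[of "transpose ?Lz ** A x ** ?Lz"]
      show "T z \<le> T x" unfolding T0 unfolding T_def by linarith
    qed
    then have T': "(\<lambda>X. ?I \<bullet> (transpose ?Lz ** A' z X ** ?Lz)) = (\<lambda>v. 0)"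
      using differential_zero_maxmin[OF _ open_ball dT, of z \<rho>] \<rho>(1) by auto
    define g where "g x = 2 * T x - (\<epsilon> * barrier \<alpha> R y x - 0)" for x
    have dg: "(g has_derivative (\<lambda>w. 2 * 0 - \<epsilon> * (- 2 * \<alpha> * ((z - y) \<bullet> w) * exp (- \<alpha> * ((z - y) \<bullet> (z - y)))))) (at z)"
      unfolding g_def
      by (rule has_derivative_diff[OF has_derivative_mult_right[OF dT[unfolded T']] C2_onD(2)[OF barrier_C2 UNIV_I]])
    have vz: "v z = 0" using zy(1) by (simp add: vpos dist_norm)
    have "\<forall>x\<in>ball z \<rho>. g z \<le> g x"
    proof
      fix x assume x: "x \<in> ball z \<rho>"
      have "0 \<le> f (x, ?Lz) - \<epsilon> * v x" using nonneg[of "(x, ?Lz)"] x L\<L>[OF zK] by simp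
      moreover have "f (x, ?Lz) \<le> 2 * T x" by (simp add: f_def spread_def T_def)
      ultimately show "g z \<le> g x" using vz by (simp add: g_def T0 v_def)
    qed
    then have "(\<lambda>w. 2 * 0 - \<epsilon> * (- 2 * \<alpha> * ((z - y) \<bullet> w) * exp (- \<alpha> * ((z - y) \<bullet> (z - y))))) = (\<lambda>v. 0)"
      using differential_zero_maxmin[OF _ open_ball dg, of z \<rho>] \<rho>(1) by auto
    then have "\<epsilon> * (2 * \<alpha> * ((z - y) \<bullet> (z - y))) = 0" by (auto dest: fun_cong[of _ _ "z - y"])
    moreover have "(z - y) \<bullet> (z - y) = R\<^sup>2" using zy(1) by (simp add: dist_norm flip: power2_norm_eq_inner)
    ultimately show False using \<epsilon>(1) \<alpha>1 R by simp
  qed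
  moreover have "ball xh (\<delta> / 4) \<subseteq> ?K" using \<delta>(1) by auto
  ultimately show ?thesis using bp c \<delta>
    by (intro exI[of _ "\<delta> / 4"] conjI exI[of _ c]) auto
qed

text \<open>
  Every point has its own maximal block, and near it the rank is the size of that block.
\<close>

theorem constant_rank:
  assumes "connected \<Omega>"
  shows "(\<lambda>x. rank (A x)) constant_on \<Omega>"
proof (rule locally_constant_imp_constant[OF assms])
  fix x assume x: "x \<in> \<Omega>"
  obtain J c0 where "c0 > 0" "block_pos c0 J (A x)" "degenerate J (A x)"
    using maximal_positive_block[OF A_psd[OF x]] .
  from degenerate_nearby[OF x this] obtain \<delta> c where \<delta>: "\<delta> > 0" "c > 0" "ball x \<delta> \<subseteq> \<Omega>"
    "\<And>w. w \<in> ball x \<delta> \<Longrightarrow> block_pos c J (A w) \<and> degenerate J (A w)" by blast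
  have rk: "rank (A w) = card J" if "w \<in> ball x \<delta>" for w using rank_degenerate[OF \<delta>(2)] \<delta>(4)[OF that] by blast
  show "\<exists>T. openin (top_of_set \<Omega>) T \<and> x \<in> T \<and> (\<forall>w\<in>T. rank (A w) = rank (A x))"
    using \<delta>(1,3) rk by (intro exI[of _ "ball x \<delta>"]) (auto simp: openin_open_eq[OF open_dom])
qed

end

section \<open>From inverse convexity to the structure inequality\<close>

lemma pos_def_perturb:
  fixes M K :: "real^'n^'n"
  assumes M: "pos_def M" and K: "K \<in> Sym"
  shows "\<forall>\<^sub>F t in nhds 0. pos_def (M + t *\<^sub>R K)"
proof -
  obtain c :: real where c: "c > 0" "\<And>v. c * (norm v)\<^sup>2 \<le> v \<bullet> (M *v v)" 
    using positive_on_subspace_coercive[OF subspace_UNIV, of M] M unfolding pos_def_def by auto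
  have "((\<lambda>t. \<bar>t\<bar> * norm K) \<longlongrightarrow> \<bar>0\<bar> * norm K) (nhds 0)"
    by (intro tendsto_intros) (simp add: filterlim_def)
  then have "\<forall>\<^sub>F t in nhds 0. \<bar>t\<bar> * norm K < c" using c(1) by (intro order_tendstoD(2)) auto
  then show ?thesis
  proof eventually_elim
    case (elim t)
    have "0 < v \<bullet> ((M + t *\<^sub>R K) *v v)" if v: "v \<noteq> 0" for v
    proof -
      have "\<bar>v \<bullet> (K *v v)\<bar> \<le> norm v * (norm K * norm v)"
        using Cauchy_Schwarz_ineq2[of v "K *v v"] mult_left_mono[OF norm_matrix_vector_le[of K v], of "norm v"] by simp
      then have "\<bar>t\<bar> * \<bar>v \<bullet> (K *v v)\<bar> \<le> \<bar>t\<bar> * (norm v * (norm K * norm v))" by (intro mult_left_mono) auto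
      also have "\<dots> = (\<bar>t\<bar> * norm K) * (norm v)\<^sup>2" by (simp add: power2_eq_square)
      also have "\<dots> < c * (norm v)\<^sup>2" using elim v by (intro mult_strict_right_mono) auto
      finally have "\<bar>t * (v \<bullet> (K *v v))\<bar> < v \<bullet> (M *v v)" using c(2)[of v] by (simp add: abs_mult)
      then show ?thesis by (simp add: matrix_vector_bilinear_simps inner_add_right abs_less_iff)
    qed
    then show ?case using M K by (simp add: pos_def_def Sym_def transpose_simps)
  qed
qed

lemma pos_def_inverse:
  fixes M :: "real^'n^'n"
  assumes M: "pos_def M"
  shows "M ** matrix_inv M = mat 1" "matrix_inv M ** M = mat 1" "pos_def (matrix_inv M)"
proof -
  have "x = 0" if "M *v x = 0" for x
    using M that unfolding pos_def_def by (metis inner_zero_right less_irrefl)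
  then obtain E where "E ** M = mat 1" using matrix_left_invertible_ker[of M] by blast
  then have "\<exists>E. M ** E = mat 1 \<and> E ** M = mat 1" using matrix_left_right_inverse by blast
  then have inv: "M ** matrix_inv M = mat 1 \<and> matrix_inv M ** M = mat 1"
    unfolding matrix_inv_def by (rule someI_ex)
  then show i: "M ** matrix_inv M = mat 1" "matrix_inv M ** M = mat 1" by auto
  let ?B = "matrix_inv M"
  have tM: "transpose M = M" using M by (simp add: pos_def_def Sym_def)
  have tB: "transpose ?B = ?B"
  proof -
    have "transpose ?B = transpose ?B ** (M ** ?B)" by (simp add: i)
    also have "\<dots> = transpose (M ** ?B) ** ?B" by (simp add: matrix_transpose_mul tM matrix_mul_assoc)
    finally show ?thesis by (simp add: i)
  qed
  have "0 < v \<bullet> (?B *v v)" if v: "v \<noteq> 0" for v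
  proof -
    have MB: "M *v (?B *v v) = v" by (simp add: matrix_vector_mul_assoc i)
    then have "?B *v v \<noteq> 0" using v by auto
    then have "0 < (?B *v v) \<bullet> (M *v (?B *v v))" using M unfolding pos_def_def by blast
    then show ?thesis unfolding MB by (simp add: inner_commute)
  qed
  then show "pos_def ?B" using tB by (simp add: pos_def_def Sym_def)
qed

lemma diff_eq_minus: "a = m - x \<Longrightarrow> a - m = - x" for a m x :: "'a::ab_group_add"
  by simp

text \<open>
  The resolvent identity expresses the increment of the inverse through the inverse itself; it bounds the perturbed
  inverses and yields their first and second differences.
\<close>

lemma inverse_perturb_tendsto:
  fixes M B K :: "real^'n^'n"
  assumes MB: "M ** B = mat 1" and t: "t \<longlonglongrightarrow> 0" and R: "\<forall>\<^sub>F n in sequentially. (B + t n *\<^sub>R K) ** R n = mat 1"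
  shows "\<forall>\<^sub>F n in sequentially. R n = M - t n *\<^sub>R (M ** K ** R n)" "R \<longlonglongrightarrow> M"
proof -
  show eq: "\<forall>\<^sub>F n in sequentially. R n = M - t n *\<^sub>R (M ** K ** R n)"
    using R
  proof eventually_elim
    case (elim n)
    have "M = M ** ((B + t n *\<^sub>R K) ** R n)" by (simp add: elim)
    also have "\<dots> = (M ** B) ** R n + t n *\<^sub>R (M ** K ** R n)" by (simp add: matrix_bilinear_simps matrix_mul_assoc)
    finally have "M = R n + t n *\<^sub>R (M ** K ** R n)" by (simp add: MB)
    then show ?case by (simp add: algebra_simps)
  qed
  define m where "m = norm (M ** K)"
  have "(\<lambda>n. \<bar>t n\<bar> * m) \<longlonglongrightarrow> \<bar>0\<bar> * m" by (intro tendsto_intros t)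
  then have "\<forall>\<^sub>F n in sequentially. \<bar>t n\<bar> * m < 1 / 2" by (intro order_tendstoD(2)) auto
  with eq have bd: "\<forall>\<^sub>F n in sequentially. norm (R n - M) \<le> (\<bar>t n\<bar> * m) * (2 * norm M)"
  proof eventually_elim
    case (elim n)
    have d: "norm (R n - M) \<le> \<bar>t n\<bar> * m * norm (R n)"
    proof -
      have "norm (R n - M) = norm (- (t n *\<^sub>R (M ** K ** R n)))" by (simp only: diff_eq_minus[OF elim(1)])
      also have "\<dots> = \<bar>t n\<bar> * norm (M ** K ** R n)" by simp
      also have "\<dots> \<le> \<bar>t n\<bar> * (m * norm (R n))" unfolding m_def by (intro mult_left_mono norm_matrix_mult_le) auto
      finally show ?thesis by (simp add: mult.assoc)
    qed
    also have "\<bar>t n\<bar> * m * norm (R n) \<le> 1 / 2 * norm (R n)" using elim(2) by (intro mult_right_mono) auto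
    finally have "norm (R n) \<le> 2 * norm M" using norm_triangle_sub[of "R n" M] by simp
    then have "\<bar>t n\<bar> * m * norm (R n) \<le> \<bar>t n\<bar> * m * (2 * norm M)" by (intro mult_left_mono) (auto simp: m_def)
    then show ?case using d by linarith
  qed
  have "(\<lambda>n. (\<bar>t n\<bar> * m) * (2 * norm M)) \<longlonglongrightarrow> (\<bar>0\<bar> * m) * (2 * norm M)" by (intro tendsto_intros t)
  then have "(\<lambda>n. R n - M) \<longlonglongrightarrow> 0" by (intro Lim_null_comparison[OF bd]) simp
  then show "R \<longlonglongrightarrow> M" by (simp add: LIM_zero_iff)
qed

text \<open>
  Along the line \<open>B \<plusminus> t K\<close> through \<open>B = M\<^sup>-\<^sup>1\<close>, midpoint convexity gives a nonnegative second difference of \<open>F\<close>. Its limit is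
  computed from the second-order expansion of \<open>G\<close>: the inverses of \<open>B \<plusminus> t K\<close> have first differences \<open>\<mp> t M K M\<close> and
  second difference \<open>2 t\<^sup>2 M K M K M\<close>.
\<close>

lemma inverse_convexity_pos_def:
  fixes G G' G'' and F :: "(real^'n^'n) \<times> (real^'n) \<times> real \<times> (real^'n) \<Rightarrow> real" and M K :: "real^'n^'n"
  assumes C: "C2_on (UNIV \<times> UNIV \<times> UNIV \<times> \<Omega>) G G' G''"
    and GF: "\<And>M p s x. M \<in> Sym \<Longrightarrow> G (M, p, s, x) = F (M, p, s, x)"
    and lc: "locally_convex_on (Sym_pos \<times> UNIV \<times> \<Omega>) (\<lambda>(M, s, x). F (matrix_inv M, p, s, x))"
    and \<Omega>: "open \<Omega>" "x \<in> \<Omega>" and M: "pos_def M" and K: "K \<in> Sym"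
  shows "0 \<le> G' (M, p, \<sigma>, x) (2 *\<^sub>R (M ** K ** M ** K ** M), 0, 0, 0)
     + G'' (M, p, \<sigma>, x) (- (M ** K ** M), 0, s, w) (- (M ** K ** M), 0, s, w)"
proof -
  define B where "B = matrix_inv M"
  note MB = pos_def_inverse[OF M, folded B_def]
  have iB: "matrix_inv B = M"
  proof -
    have "matrix_inv B = M ** B ** matrix_inv B" by (simp add: MB)
    also have "\<dots> = M ** (B ** matrix_inv B)" by (simp add: matrix_mul_assoc)
    finally show ?thesis by (simp add: pos_def_inverse(1)[OF MB(3)])
  qed
  define f where "f = (\<lambda>(M, s, x). F (matrix_inv M, p, s, x))"
  let ?S = "Sym_pos \<times> UNIV \<times> \<Omega>" and ?q = "(B, \<sigma>, x)" and ?d = "(K, s, w)"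
  have qS: "?q \<in> ?S" using MB(3) \<Omega>(2) by (simp add: Sym_pos_def)
  have "openin (top_of_set ?S) ?S" by simp
  then obtain U V where U: "openin (top_of_set ?S) U" "convex_on V f" "?q \<in> U" "U \<subseteq> V"
    using lc[unfolded locally_convex_on_def locally_def, rule_format, OF conjI[OF _ qS], folded f_def] by blast
  obtain T where T: "open T" "U = ?S \<inter> T" using U(1) by (auto simp: openin_open)
  define t where "t n = inverse (real (Suc n))" for n
  have t: "t \<longlonglongrightarrow> 0" "t n \<noteq> 0" for n unfolding t_def using LIMSEQ_inverse_real_of_nat by auto
  have mt: "(\<lambda>n. - t n) \<longlonglongrightarrow> 0" "- t n \<noteq> 0" for n using tendsto_minus[OF t(1)] t(2) by auto
  have evU: "\<forall>\<^sub>F n in sequentially. ?q + r n *\<^sub>R ?d \<in> U" if r: "r \<longlonglongrightarrow> 0" for r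
  proof -
    have "\<forall>\<^sub>F n in sequentially. pos_def (B + r n *\<^sub>R K)"
      using pos_def_perturb[OF MB(3) K] r by (rule eventually_compose_filterlim)
    moreover have "(\<lambda>n. x + r n *\<^sub>R w) \<longlonglongrightarrow> x + 0 *\<^sub>R w" by (intro tendsto_intros r)
    then have "\<forall>\<^sub>F n in sequentially. x + r n *\<^sub>R w \<in> \<Omega>" using topological_tendstoD \<Omega> by fastforce
    moreover have "(\<lambda>n. ?q + r n *\<^sub>R ?d) \<longlonglongrightarrow> ?q + 0 *\<^sub>R ?d" by (intro tendsto_intros r)
    then have "\<forall>\<^sub>F n in sequentially. ?q + r n *\<^sub>R ?d \<in> T" using topological_tendstoD[OF _ T(1)] U(3) T(2) by fastforce
    ultimately show ?thesis by eventually_elim (simp add: T(2) Sym_pos_def)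
  qed
  define R where "R n = matrix_inv (B + t n *\<^sub>R K)" for n
  define R' where "R' n = matrix_inv (B + (- t n) *\<^sub>R K)" for n
  have pd: "\<forall>\<^sub>F n in sequentially. pos_def (B + r n *\<^sub>R K)" if "r \<longlonglongrightarrow> 0" for r
    using evU[OF that] by eventually_elim (auto simp: T(2) Sym_pos_def)
  have "\<forall>\<^sub>F n in sequentially. (B + t n *\<^sub>R K) ** R n = mat 1"
    using pd[OF t(1)] unfolding R_def by eventually_elim (rule pos_def_inverse(1))
  note RM = inverse_perturb_tendsto[OF MB(1) t(1) this]
  have "\<forall>\<^sub>F n in sequentially. (B + (- t n) *\<^sub>R K) ** R' n = mat 1"
    using pd[OF mt(1)] unfolding R'_def by eventually_elim (rule pos_def_inverse(1))
  note RM' = inverse_perturb_tendsto[OF MB(1) mt(1) this]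
  let ?z = "(M, p, \<sigma>, x)" and ?\<kappa> = "(- (M ** K ** M), 0::real^'n, s, w)"
  have z: "?z \<in> UNIV \<times> UNIV \<times> UNIV \<times> \<Omega>" using \<Omega>(2) by simp
  define k where "k n = (R n - M, 0::real^'n, t n *\<^sub>R s, t n *\<^sub>R w)" for n
  define k' where "k' n = (R' n - M, 0::real^'n, (- t n) *\<^sub>R s, (- t n) *\<^sub>R w)" for n
  have klim: "(\<lambda>n. (Q n - M, 0::real^'n, r n *\<^sub>R s, r n *\<^sub>R w) /\<^sub>R r n) \<longlonglongrightarrow> ?\<kappa>"
    if r: "\<And>n. r n \<noteq> 0" "\<forall>\<^sub>F n in sequentially. Q n = M - r n *\<^sub>R (M ** K ** Q n)" "Q \<longlonglongrightarrow> M" for Q r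
  proof -
    have "(\<lambda>n. (- (M ** K ** Q n), 0::real^'n, s, w)) \<longlonglongrightarrow> ?\<kappa>"
      by (intro tendsto_intros tendsto_matrix_matrix r)
    then show ?thesis
    proof (rule Lim_transform_eventually)
      show "\<forall>\<^sub>F n in sequentially. (- (M ** K ** Q n), 0::real^'n, s, w) = (Q n - M, 0::real^'n, r n *\<^sub>R s, r n *\<^sub>R w) /\<^sub>R r n"
        using r(2)
      proof eventually_elim
        case (elim n)
        then have "Q n - M = - (r n *\<^sub>R (M ** K ** Q n))" by (rule diff_eq_minus)
        then show ?case using r(1)[of n] by simp
      qed
    qed
  qed
  have l1: "(\<lambda>n. (G (?z + k n) - G ?z - G' ?z (k n)) / (t n)\<^sup>2) \<longlonglongrightarrow> G'' ?z ?\<kappa> ?\<kappa> / 2"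
    unfolding k_def by (rule second_order_limit[OF C tendsto_const z t klim[OF t(2) RM]])
  have l2: "(\<lambda>n. (G (?z + k' n) - G ?z - G' ?z (k' n)) / (- t n)\<^sup>2) \<longlonglongrightarrow> G'' ?z ?\<kappa> ?\<kappa> / 2"
    unfolding k'_def by (rule second_order_limit[OF C tendsto_const z mt klim[OF mt(2) RM']])
  have l3: "(\<lambda>n. G' ?z (M ** K ** M ** K ** (R n + R' n), 0, 0, 0)) \<longlonglongrightarrow> G' ?z (M ** K ** M ** K ** (M + M), 0, 0, 0)"
    by (rule C2_on_tendsto(1)[OF C tendsto_const z]) (intro tendsto_intros tendsto_matrix_matrix RM(2) RM'(2))
  have lin: "linear (G' ?z)" by (rule C2_on_linear(1)[OF C z])
  have "\<forall>\<^sub>F n in sequentially. 0 \<le> G' ?z (M ** K ** M ** K ** (R n + R' n), 0, 0, 0)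
     + ((G (?z + k n) - G ?z - G' ?z (k n)) / (t n)\<^sup>2 + (G (?z + k' n) - G ?z - G' ?z (k' n)) / (- t n)\<^sup>2)"
    using RM(1) RM'(1) evU[OF t(1)] evU[OF mt(1)]
  proof eventually_elim
    case (elim n)
    have inV: "?q + t n *\<^sub>R ?d \<in> V" "?q + (- t n) *\<^sub>R ?d \<in> V" using elim U(4) by blast+
    have mid: "(1 - 1/2) *\<^sub>R (?q + t n *\<^sub>R ?d) + (1/2) *\<^sub>R (?q + (- t n) *\<^sub>R ?d) = ?q"
      by (simp add: algebra_simps flip: scaleR_add_left)
    have "f ?q \<le> (1 - 1/2) * f (?q + t n *\<^sub>R ?d) + (1/2) * f (?q + (- t n) *\<^sub>R ?d)"
      using convex_onD[OF U(2), of "1/2" "?q + t n *\<^sub>R ?d" "?q + (- t n) *\<^sub>R ?d"] inV unfolding mid by simp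
    moreover have "f ?q = G ?z" using M by (simp add: f_def iB GF pos_def_def)
    moreover have "f (?q + t n *\<^sub>R ?d) = G (?z + k n)"
    proof -
      have "R n \<in> Sym" using elim(3) pos_def_inverse(3)[of "B + t n *\<^sub>R K"] by (simp add: T(2) Sym_pos_def R_def pos_def_def)
      then show ?thesis by (simp add: f_def k_def GF flip: R_def)
    qed
    moreover have "f (?q + (- t n) *\<^sub>R ?d) = G (?z + k' n)"
    proof -
      have "R' n \<in> Sym" using elim(4) pos_def_inverse(3)[of "B + (- t n) *\<^sub>R K"] by (simp add: T(2) Sym_pos_def R'_def pos_def_def)
      moreover have "matrix_inv (B - t n *\<^sub>R K) = R' n" by (simp add: R'_def)
      ultimately show ?thesis by (simp add: f_def k'_def GF)
    qed
    ultimately have conv: "0 \<le> G (?z + k n) - G ?z + (G (?z + k' n) - G ?z)" by simp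
    have kk: "k n + k' n = (t n)\<^sup>2 *\<^sub>R (M ** K ** M ** K ** (R n + R' n), 0::real^'n, 0::real, 0::real^'n)"
    proof -
      have 1: "R n - M = - (t n *\<^sub>R (M ** K ** R n))" using elim(1) by (rule diff_eq_minus)
      have 2: "R' n - M = t n *\<^sub>R (M ** K ** R' n)" using diff_eq_minus[OF elim(2)] by simp
      have 3: "R' n - R n = t n *\<^sub>R (M ** K ** (R n + R' n))"
      proof -
        have "R' n - R n = (R' n - M) - (R n - M)" by simp
        also have "\<dots> = t n *\<^sub>R (M ** K ** (R n + R' n))"
          unfolding 1 2 by (simp add: matrix_bilinear_simps scaleR_add_right add.commute)
        finally show ?thesis .
      qed
      have "(R n - M) + (R' n - M) = t n *\<^sub>R (M ** K ** (R' n - R n))"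
        unfolding 1 2 by (simp add: matrix_bilinear_simps algebra_simps)
      also have "\<dots> = (t n)\<^sup>2 *\<^sub>R (M ** K ** M ** K ** (R n + R' n))"
        unfolding 3 by (simp add: matrix_bilinear_simps matrix_mul_assoc power2_eq_square)
      finally show ?thesis by (simp add: k_def k'_def)
    qed
    have "G' ?z (k n) + G' ?z (k' n) = (t n)\<^sup>2 * G' ?z (M ** K ** M ** K ** (R n + R' n), 0, 0, 0)"
      unfolding linear_add[OF lin, symmetric] kk linear_cmul[OF lin] by simp
    then have "G' ?z (M ** K ** M ** K ** (R n + R' n), 0, 0, 0) = (G' ?z (k n) + G' ?z (k' n)) / (t n)\<^sup>2"
      using t(2)[of n] by simp
    then have "G' ?z (M ** K ** M ** K ** (R n + R' n), 0, 0, 0)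
     + ((G (?z + k n) - G ?z - G' ?z (k n)) / (t n)\<^sup>2 + (G (?z + k' n) - G ?z - G' ?z (k' n)) / (- t n)\<^sup>2)
      = (G (?z + k n) - G ?z + (G (?z + k' n) - G ?z)) / (t n)\<^sup>2"
      by (simp add: add_divide_distrib diff_divide_distrib)
    then show ?case using conv by simp
  qed
  from tendsto_lowerbound[OF tendsto_add[OF l3 tendsto_add[OF l1 l2]] this]
  show ?thesis by (simp add: matrix_bilinear_simps flip: scaleR_2)
qed

text \<open>
  The inequality is polynomial in \<open>M\<close> apart from the derivatives of \<open>G\<close>, so it passes to the limit in \<open>M + 1/n\<close>. This
  is how the convexity assumption, which concerns positive definite matrices, reaches degenerate Hessians.
\<close>

lemma inverse_convexity_psd:
  fixes G G' G'' and F :: "(real^'n^'n) \<times> (real^'n) \<times> real \<times> (real^'n) \<Rightarrow> real" and M K :: "real^'n^'n"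
  assumes C: "C2_on (UNIV \<times> UNIV \<times> UNIV \<times> \<Omega>) G G' G''"
    and GF: "\<And>M p s x. M \<in> Sym \<Longrightarrow> G (M, p, s, x) = F (M, p, s, x)"
    and lc: "locally_convex_on (Sym_pos \<times> UNIV \<times> \<Omega>) (\<lambda>(M, s, x). F (matrix_inv M, p, s, x))"
    and \<Omega>: "open \<Omega>" "x \<in> \<Omega>" and M: "psd M" and K: "K \<in> Sym"
  shows "0 \<le> G' (M, p, \<sigma>, x) (2 *\<^sub>R (M ** K ** M ** K ** M), 0, 0, 0)
     + G'' (M, p, \<sigma>, x) (M ** K ** M, 0, s, w) (M ** K ** M, 0, s, w)"
proof -
  define N where "N n = M + inverse (real (Suc n)) *\<^sub>R mat 1" for n
  have "N \<longlonglongrightarrow> M + 0 *\<^sub>R mat 1" unfolding N_def by (intro tendsto_intros LIMSEQ_inverse_real_of_nat)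
  then have N: "N \<longlonglongrightarrow> M" by simp
  have pd: "pos_def (N n)" for n
    unfolding pos_def_def
  proof (intro conjI allI impI)
    show "N n \<in> Sym" using M by (simp add: N_def psd_def Sym_def transpose_simps)
    fix v :: "real^'n" assume v: "v \<noteq> 0"
    have "0 < inverse (real (Suc n)) * (v \<bullet> v)" using v by simp
    moreover have "0 \<le> v \<bullet> (M *v v)" using M by (simp add: psd_def)
    ultimately show "0 < v \<bullet> (N n *v v)"
      unfolding N_def matrix_vector_bilinear_simps inner_add_right by simp
  qed
  have mK: "- K \<in> Sym" using K by (simp add: Sym_def transpose_simps)
  have ge: "0 \<le> G' (N n, p, \<sigma>, x) (2 *\<^sub>R (N n ** K ** N n ** K ** N n), 0, 0, 0)
     + G'' (N n, p, \<sigma>, x) (N n ** K ** N n, 0, s, w) (N n ** K ** N n, 0, s, w)" for n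
    using inverse_convexity_pos_def[OF C GF lc \<Omega> pd[of n] mK, of \<sigma> s w] by (simp add: matrix_bilinear_simps)
  have z: "(M, p, \<sigma>, x) \<in> UNIV \<times> UNIV \<times> UNIV \<times> \<Omega>" using \<Omega>(2) by simp
  have zl: "(\<lambda>n. (N n, p, \<sigma>, x)) \<longlonglongrightarrow> (M, p, \<sigma>, x)" by (intro tendsto_intros N)
  have "(\<lambda>n. G' (N n, p, \<sigma>, x) (2 *\<^sub>R (N n ** K ** N n ** K ** N n), 0, 0, 0)
     + G'' (N n, p, \<sigma>, x) (N n ** K ** N n, 0, s, w) (N n ** K ** N n, 0, s, w)) \<longlonglongrightarrow>
     G' (M, p, \<sigma>, x) (2 *\<^sub>R (M ** K ** M ** K ** M), 0, 0, 0)
     + G'' (M, p, \<sigma>, x) (M ** K ** M, 0, s, w) (M ** K ** M, 0, s, w)"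
    by (intro tendsto_add C2_on_tendsto[OF C zl z] tendsto_intros tendsto_matrix_matrix N)
  from LIMSEQ_le_const[OF this] ge show ?thesis by blast
qed

section \<open>Constancy of the rank\<close>

lemma C2_on_cong:
  assumes "C2_on S g g' g''"
    and "\<And>x. x \<in> S \<Longrightarrow> h x = g x" "\<And>x v. x \<in> S \<Longrightarrow> h' x v = g' x v" "\<And>x v w. x \<in> S \<Longrightarrow> h'' x v w = g'' x v w"
  shows "C2_on S h h' h''"
  unfolding C2_on_def
proof (intro conjI ballI allI)
  note o = C2_onD(1)[OF assms(1)]
  show "open S" by (rule o)
  fix x assume x: "x \<in> S"
  have "h' x = g' x" using assms(3)[OF x] by blast
  then show "(h has_derivative h' x) (at x)"
    using has_derivative_transform_within_open[OF C2_onD(2)[OF assms(1) x] o x] assms(2) by metis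
  fix v
  have "h'' x v = g'' x v" using assms(4)[OF x] by blast
  then show "((\<lambda>y. h' y v) has_derivative h'' x v) (at x)"
    using has_derivative_transform_within_open[OF C2_onD(3)[OF assms(1) x, of v] o x, of "\<lambda>y. h' y v"] assms(3) by metis
next
  fix v w
  show "continuous_on S (\<lambda>x. h'' x v w)"
    by (rule continuous_on_eq[OF C2_onD(4)[OF assms(1)]]) (simp add: assms(4))
qed

text \<open>
  Composition with a linear map into \<open>U\<close> trades differentiability within the set \<open>U\<close>, which may have empty interior, for
  differentiability on an open set.
\<close>

lemma C_k_on_2_linear_compose:
  fixes f :: "'a::euclidean_space \<Rightarrow> real" and P :: "'b::euclidean_space \<Rightarrow> 'a"
  assumes f: "C_k_on 2 V U f" and S: "open S" and P: "bounded_linear P" "\<And>z. P z \<in> V" "\<And>z. z \<in> S \<Longrightarrow> P z \<in> U"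
  shows "\<exists>f' g''. (\<forall>x\<in>U. (f has_derivative f' x) (at x within U)) \<and> C2_on S (\<lambda>z. f (P z)) (\<lambda>z v. f' (P z) (P v)) g''"
proof -
  obtain f' where f': "\<And>x. x \<in> U \<Longrightarrow> (f has_derivative f' x) (at x within U)" "\<And>v. v \<in> V \<Longrightarrow> C_k_on (Suc 0) V U (\<lambda>x. f' x v)"
    using f by (auto simp: numeral_2_eq_2)
  have "\<forall>v\<in>V. \<exists>h. (\<forall>x\<in>U. ((\<lambda>x. f' x v) has_derivative h x) (at x within U)) \<and> (\<forall>w\<in>V. continuous_on U (\<lambda>x. h x w))"
    using f'(2) by auto
  from bchoice[OF this] obtain f'' where f'': "\<And>v x. v \<in> V \<Longrightarrow> x \<in> U \<Longrightarrow> ((\<lambda>x. f' x v) has_derivative f'' v x) (at x within U)"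
      "\<And>v w. v \<in> V \<Longrightarrow> w \<in> V \<Longrightarrow> continuous_on U (\<lambda>x. f'' v x w)"
    by blast
  have comp: "((\<lambda>z. h (P z)) has_derivative (\<lambda>v. h' (P v))) (at z)"
    if "z \<in> S" "(h has_derivative h') (at (P z) within U)" for z h h'
  proof -
    have "(h has_derivative h') (at (P z) within P ` S)" using has_derivative_subset[OF that(2)] P(3) by blast
    from has_derivative_in_compose[OF bounded_linear_imp_has_derivative[OF P(1)] this]
    show ?thesis using at_within_open[OF that(1) S] by simp
  qed
  have "C2_on S (\<lambda>z. f (P z)) (\<lambda>z v. f' (P z) (P v)) (\<lambda>z v w. f'' (P v) (P z) (P w))"
    unfolding C2_on_def
  proof (intro conjI ballI allI S)
    fix z assume z: "z \<in> S"
    show "((\<lambda>z. f (P z)) has_derivative (\<lambda>v. f' (P z) (P v))) (at z)" by (rule comp[OF z f'(1)[OF P(3)[OF z]]])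
    fix v
    show "((\<lambda>y. f' (P y) (P v)) has_derivative (\<lambda>w. f'' (P v) (P z) (P w))) (at z)"
      by (rule comp[OF z f''(1)[OF P(2) P(3)[OF z]]])
  next
    fix v w
    show "continuous_on S (\<lambda>x. f'' (P v) (P x) (P w))"
      by (rule continuous_on_compose2[OF f''(2)[OF P(2) P(2)] bounded_linear.continuous_on[OF P(1) continuous_on_id]])
         (use P(3) in auto)
  qed
  then show ?thesis using f'(1) by blast
qed

lemma vec_linear_expand:
  fixes f :: "real^'n \<Rightarrow> real"
  assumes "linear f"
  shows "f v = (\<Sum>j\<in>UNIV. v $ j * f (axis j 1))"
proof -
  have "f v = f (\<Sum>j\<in>UNIV. v $ j *\<^sub>R axis j 1)" by (simp add: basis_expansion[of v, unfolded scalar_mult_eq_scaleR])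
  then show ?thesis by (simp add: linear_sum[OF assms] linear_cmul[OF assms])
qed

text \<open>
  Symmetry of second derivatives, applied to \<open>u\<close> and to each \<open>D\<^sub>v u\<close>, makes the third derivatives symmetric in all three
  indices.
\<close>

lemma C3_derivatives:
  fixes u :: "real^'n \<Rightarrow> real"
  assumes \<Omega>: "open \<Omega>" and u: "C_k_on 3 UNIV \<Omega> u"
  obtains A' where "C2_on \<Omega> u (\<lambda>x v. grad u x \<bullet> v) (\<lambda>x v w. v \<bullet> (hessian u x *v w))"
    "\<And>i. C2_on \<Omega> (\<lambda>x. grad u x $ i) (\<lambda>x v. (hessian u x *v v) $ i) (\<lambda>x v w. (A' x w *v v) $ i)"
    "\<And>x. x \<in> \<Omega> \<Longrightarrow> (hessian u has_derivative A' x) (at x)" "\<And>v. continuous_on \<Omega> (\<lambda>x. A' x v)"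
    "\<And>x. x \<in> \<Omega> \<Longrightarrow> hessian u x \<in> Sym" "\<And>x v. x \<in> \<Omega> \<Longrightarrow> A' x v \<in> Sym" "\<And>x v w. x \<in> \<Omega> \<Longrightarrow> A' x v *v w = A' x w *v v"
proof -
  have s3: "(3::nat) = Suc 2" by simp
  obtain u' where u': "\<And>x. x \<in> \<Omega> \<Longrightarrow> (u has_derivative u' x) (at x within \<Omega>)" "\<And>v. C_k_on 2 UNIV \<Omega> (\<lambda>x. u' x v)"
    using u unfolding s3 C_k_on.simps by auto
  have du: "(u has_derivative u' x) (at x)" if "x \<in> \<Omega>" for x using u'(1)[OF that] at_within_open[OF that \<Omega>] by simp
  have "\<exists>g g2. C2_on \<Omega> (\<lambda>x. u' x v) g g2" for v
    using C_k_on_2_linear_compose[OF u'(2)[of v] \<Omega> bounded_linear_ident] by auto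
  then obtain g1 g2 where g: "\<And>v. C2_on \<Omega> (\<lambda>x. u' x v) (g1 v) (g2 v)" by metis
  have C: "C2_on \<Omega> u u' (\<lambda>x v w. g1 v x w)"
    unfolding C2_on_def using \<Omega> du C2_onD(2)[OF g] C2_on_continuous(2)[OF g] by blast
  have partial_eq: "partial i f x = f' (axis i 1)" if "(f has_derivative f') (at x)" for i and f :: "real^'n \<Rightarrow> real" and f' x
  proof -
    have d: "((\<lambda>t. x + t *\<^sub>R axis i 1) has_derivative (\<lambda>s. s *\<^sub>R axis i (1::real))) (at 0)"
      by (auto intro!: derivative_eq_intros)
    have "(f has_derivative f') (at (x + 0 *\<^sub>R axis i 1))" using that by simp
    from has_derivative_compose[OF d this]
    have "((\<lambda>t. f (x + t *\<^sub>R axis i 1)) has_derivative (\<lambda>s. f' (s *\<^sub>R axis i 1))) (at 0)" .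
    moreover have "(\<lambda>s. f' (s *\<^sub>R axis i 1)) = (*) (f' (axis i 1))"
      using has_derivative_linear[OF that] by (simp add: fun_eq_iff linear_cmul mult.commute)
    ultimately show ?thesis unfolding partial_def by (intro DERIV_imp_deriv) (simp add: has_field_derivative_def)
  qed
  have gr: "grad u x $ i = u' x (axis i 1)" if "x \<in> \<Omega>" for x i
    using partial_eq[OF du[OF that]] by (simp add: grad_def)
  have pd: "(partial j u has_derivative g1 (axis j 1) x) (at x)" if "x \<in> \<Omega>" for x j
    using has_derivative_transform_within_open[OF C2_onD(2)[OF g that, of "axis j 1"] \<Omega> that, of "partial j u"] partial_eq[OF du] by simp
  have he: "hessian u x $ i $ j = g1 (axis j 1) x (axis i 1)" if "x \<in> \<Omega>" for x i j
    using partial_eq[OF pd[OF that]] by (simp add: hessian_def)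
  have sym1: "g1 v x w = g1 w x v" if "x \<in> \<Omega>" for x v w using C2_on_symmetric[OF C that] .
  have sym2: "g2 v x w = g2 w x v" if "x \<in> \<Omega>" for x v w
  proof -
    have "((\<lambda>y. g1 w y v) has_derivative g2 v x w) (at x)"
      by (rule has_derivative_transform_within_open[OF C2_onD(3)[OF g that] \<Omega> that]) (rule sym1)
    then show ?thesis using has_derivative_unique[OF C2_onD(3)[OF g that]] by metis
  qed
  have sym3: "g2 v x w z = g2 v x z w" if "x \<in> \<Omega>" for x v w z using C2_on_symmetric[OF g that] .
  define A' where "A' x w = (\<chi> i j. g2 (axis j 1) x (axis i 1) w)" for x w
  have hv: "(hessian u x *v v) $ i = g1 (axis i 1) x v" if x: "x \<in> \<Omega>" for x v i
  proof -
    have "g1 (axis i 1) x v = (\<Sum>j\<in>UNIV. v $ j * g1 (axis i 1) x (axis j 1))"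
      by (rule vec_linear_expand[OF C2_on_linear(1)[OF g x]])
    then show ?thesis by (simp add: matrix_vector_mult_def he[OF x] sym1[OF x, of "axis i 1"] mult.commute)
  qed
  have Av: "(A' x w *v v) $ i = g2 (axis i 1) x v w" if x: "x \<in> \<Omega>" for x v w i
  proof -
    have "g2 (axis i 1) x v w = (\<Sum>j\<in>UNIV. v $ j * g2 (axis i 1) x (axis j 1) w)"
      by (rule vec_linear_expand[OF C2_on_linear(3)[OF g x]])
    then show ?thesis by (simp add: matrix_vector_mult_def A'_def sym2[OF x, of "axis i 1"] mult.commute)
  qed
  show thesis
  proof (rule that[of A'])
    show "C2_on \<Omega> u (\<lambda>x v. grad u x \<bullet> v) (\<lambda>x v w. v \<bullet> (hessian u x *v w))"
    proof (rule C2_on_cong[OF C])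
      fix x v w assume x: "x \<in> \<Omega>"
      show "grad u x \<bullet> v = u' x v"
        by (subst vec_linear_expand[OF C2_on_linear(1)[OF C x]]) (simp add: inner_vec_def gr[OF x] mult.commute)
      show "v \<bullet> (hessian u x *v w) = g1 v x w"
        by (subst vec_linear_expand[OF C2_on_linear(3)[OF C x], of v]) (simp add: inner_vec_def hv[OF x])
    qed simp
    show "C2_on \<Omega> (\<lambda>x. grad u x $ i) (\<lambda>x v. (hessian u x *v v) $ i) (\<lambda>x v w. (A' x w *v v) $ i)" for i
      by (rule C2_on_cong[OF g[of "axis i 1"]]) (simp_all only: gr hv Av)
    show "(hessian u has_derivative A' x) (at x)" if x: "x \<in> \<Omega>" for x
    proof (subst has_derivative_componentwise_within, rule ballI)
      fix b :: "real^'n^'n" assume "b \<in> Basis"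
      then obtain i j where b: "b = axis i (axis j 1)" by (auto simp: Basis_vec_def)
      have e: "X \<bullet> b = X $ i $ j" for X :: "real^'n^'n" by (simp add: b inner_axis)
      have "((\<lambda>y. hessian u y $ i $ j) has_derivative g2 (axis j 1) x (axis i 1)) (at x)"
        by (rule has_derivative_transform_within_open[OF C2_onD(3)[OF g x] \<Omega> x]) (simp add: he)
      then show "((\<lambda>y. hessian u y \<bullet> b) has_derivative (\<lambda>y. A' x y \<bullet> b)) (at x)"
        unfolding e by (simp add: A'_def)
    qed
    show "continuous_on \<Omega> (\<lambda>x. A' x v)" for v
      unfolding A'_def by (intro continuous_on_vec_lambda C2_onD(4)[OF g])
    show "hessian u x \<in> Sym" if "x \<in> \<Omega>" for x
      by (simp add: Sym_def transpose_def vec_eq_iff he[OF that] sym1[OF that])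
    show "A' x v \<in> Sym" if "x \<in> \<Omega>" for x v
      using sym2[OF that] by (simp add: Sym_def transpose_def vec_eq_iff A'_def)
    show "A' x v *v w = A' x w *v v" if "x \<in> \<Omega>" for x v w
      using sym3[OF that] by (simp add: vec_eq_iff Av[OF that])
  qed
qed

lemma convex_second_derivative_nonneg:
  assumes C: "C2_on S g g' g''" and cv: "convex_fun_on S g" and x: "x \<in> S"
  shows "0 \<le> g'' x v v"
proof -
  obtain e where e: "e > 0" "ball x e \<subseteq> S" using C2_onD(1)[OF C] x openE by blast
  have cb: "convex_on (ball x e) g" using cv e(2) unfolding convex_fun_on_def by simp
  define t where "t n = inverse (real (Suc n))" for n
  have t: "t \<longlonglongrightarrow> 0" "t n \<noteq> 0" for n unfolding t_def using LIMSEQ_inverse_real_of_nat by auto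
  have "(\<lambda>n. x + t n *\<^sub>R v) \<longlonglongrightarrow> x + 0 *\<^sub>R v" "(\<lambda>n. x - t n *\<^sub>R v) \<longlonglongrightarrow> x - 0 *\<^sub>R v"
    by (intro tendsto_intros t)+
  note this[THEN topological_tendstoD[OF _ open_ball, of _ _ _ x e]]
  then have "\<forall>\<^sub>F n in sequentially. x + t n *\<^sub>R v \<in> ball x e \<and> x - t n *\<^sub>R v \<in> ball x e"
    using e(1) by (intro eventually_conj) (simp_all del: mem_ball add: centre_in_ball)
  then have "\<forall>\<^sub>F n in sequentially. 0 \<le> (g (x + t n *\<^sub>R v) + g (x - t n *\<^sub>R v) - 2 * g x) / (t n)\<^sup>2"
  proof eventually_elim
    case (elim n)
    have mid: "(1 - 1/2) *\<^sub>R (x + t n *\<^sub>R v) + (1/2) *\<^sub>R (x - t n *\<^sub>R v) = x"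
      by (simp add: algebra_simps flip: scaleR_add_left)
    have "g x \<le> (1 - 1/2) * g (x + t n *\<^sub>R v) + (1/2) * g (x - t n *\<^sub>R v)"
      using convex_onD[OF cb, of "1/2" "x + t n *\<^sub>R v" "x - t n *\<^sub>R v"] elim unfolding mid by simp
    then show ?case by (intro divide_nonneg_nonneg) auto
  qed
  from tendsto_lowerbound[OF second_difference_limit[OF C tendsto_const x t tendsto_const] this]
  show ?thesis by simp
qed

theorem theorem1p1:
  fixes \<Omega> :: "(real^'n) set"
    and F :: "(real^'n^'n) \<times> (real^'n) \<times> real \<times> (real^'n) \<Rightarrow> real"
    and u :: "real^'n \<Rightarrow> real"
  assumes "open \<Omega>" and "connected \<Omega>"
    and "C_k_on 2 (Sym \<times> UNIV \<times> UNIV \<times> UNIV) (Sym \<times> UNIV \<times> UNIV \<times> \<Omega>) F"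
    and "\<And>p. locally_convex_on (Sym_pos \<times> UNIV \<times> \<Omega>)
              (\<lambda>(A, s, x). F (matrix_inv A, p, s, x))"
    and "C_k_on 3 UNIV \<Omega> u"
    and "convex_fun_on \<Omega> u"
    and "\<And>x. x \<in> \<Omega> \<Longrightarrow> F (hessian u x, grad u x, u x, x) = 0"
    and "\<And>x. x \<in> \<Omega> \<Longrightarrow> pos_def (matrix_deriv F (hessian u x) (grad u x) (u x) x)"
  shows "(\<lambda>x. rank (hessian u x)) constant_on \<Omega>"
proof -
  note \<Omega> = assms(1) and lc = assms(4)
  \<comment> \<open>\<open>F\<close> is extended by symmetrising its matrix argument\<close>
  define sm :: "real^'n^'n \<Rightarrow> real^'n^'n" where "sm Y = (1/2) *\<^sub>R (Y + transpose Y)" for Y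
  define P :: "(real^'n^'n) \<times> (real^'n) \<times> real \<times> (real^'n) \<Rightarrow> _" where "P z = (sm (fst z), snd z)" for z
  have bl_sm: "bounded_linear sm"
    unfolding sm_def
    by (intro bounded_linear_compose[OF bounded_linear_scaleR_right] bounded_linear_add bounded_linear_ident bounded_linear_transpose)
  have blP: "bounded_linear P"
    unfolding P_def
    by (intro bounded_linear_Pair bounded_linear_compose[OF bl_sm] bounded_linear_fst bounded_linear_snd)
  have smS: "sm Y \<in> Sym" for Y by (simp add: sm_def Sym_def transpose_simps add.commute)
  have smid: "sm Y = Y" if "Y \<in> Sym" for Y
    using that by (simp add: sm_def Sym_def flip: scaleR_2)
  have oS: "open (UNIV \<times> UNIV \<times> UNIV \<times> \<Omega> :: ((real^'n^'n) \<times> (real^'n) \<times> real \<times> (real^'n)) set)"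
    by (intro open_Times open_UNIV \<Omega>)
  obtain F' G'' where G: "C2_on (UNIV \<times> UNIV \<times> UNIV \<times> \<Omega>) (\<lambda>z. F (P z)) (\<lambda>z v. F' (P z) (P v)) G''"
    using C_k_on_2_linear_compose[OF assms(3) oS blP] smS by (auto simp: P_def)
  define G where "G z = F (P z)" for z
  define G' where "G' z v = F' (P z) (P v)" for z v
  note G = G[folded G_def G'_def]
  have GF: "G (M, p, s, x) = F (M, p, s, x)" if "M \<in> Sym" for M p s x
    using that by (simp add: G_def P_def smid)
  obtain A' where C: "C2_on \<Omega> u (\<lambda>x v. grad u x \<bullet> v) (\<lambda>x v w. v \<bullet> (hessian u x *v w))"
    and Cg: "\<And>i. C2_on \<Omega> (\<lambda>x. grad u x $ i) (\<lambda>x v. (hessian u x *v v) $ i) (\<lambda>x v w. (A' x w *v v) $ i)"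
    and A': "\<And>x. x \<in> \<Omega> \<Longrightarrow> (hessian u has_derivative A' x) (at x)" "\<And>v. continuous_on \<Omega> (\<lambda>x. A' x v)"
    and hS: "\<And>x. x \<in> \<Omega> \<Longrightarrow> hessian u x \<in> Sym" and A'S: "\<And>x v. x \<in> \<Omega> \<Longrightarrow> A' x v \<in> Sym"
    and A'c: "\<And>x v w. x \<in> \<Omega> \<Longrightarrow> A' x v *v w = A' x w *v v"
    using C3_derivatives[OF \<Omega> assms(5)] by blast
  let ?jet = "\<lambda>x. (hessian u x, grad u x, u x, x)"
  have jet: "?jet x \<in> UNIV \<times> UNIV \<times> UNIV \<times> \<Omega>" if "x \<in> \<Omega>" for x using that by simp
  define a where "a x = (\<chi> i j. G' (?jet x) (axis i (axis j 1), 0, 0, 0))" for x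
  have aY: "G' (?jet x) (Y, 0, 0, 0) = a x \<bullet> Y" if x: "x \<in> \<Omega>" for x Y
  proof -
    note lin = C2_on_linear(1)[OF G jet[OF x]]
    have "Y = (\<Sum>i\<in>UNIV. \<Sum>j\<in>UNIV. Y $ i $ j *\<^sub>R axis i (axis j 1))"
    proof -
      have "(\<Sum>i\<in>UNIV. \<Sum>j\<in>UNIV. Y $ i $ j *\<^sub>R axis i (axis j (1::real))) $ k $ l = Y $ k $ l" for k l
      proof -
        have "(\<Sum>i\<in>UNIV. \<Sum>j\<in>UNIV. Y $ i $ j *\<^sub>R axis i (axis j (1::real))) $ k $ l
            = (\<Sum>i\<in>UNIV. \<Sum>j\<in>UNIV. if k = i then if l = j then Y $ i $ j else 0 else 0)"
          by (simp add: axis_def if_distrib[of "\<lambda>x. x $ _"] if_distrib[of "\<lambda>x. _ * x"] cong: if_cong)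
        also have "\<dots> = (\<Sum>i\<in>UNIV. if k = i then Y $ i $ l else 0)"
          by (rule sum.cong) auto
        finally show ?thesis by simp
      qed
      then show ?thesis by (simp add: vec_eq_iff)
    qed
    then have "(Y, 0, 0, 0) = (\<Sum>i\<in>UNIV. \<Sum>j\<in>UNIV. Y $ i $ j *\<^sub>R (axis i (axis j (1::real)), 0::real^'n, 0::real, 0::real^'n))"
      by (simp add: prod_eq_iff fst_sum snd_sum)
    then have "G' (?jet x) (Y, 0, 0, 0) = (\<Sum>i\<in>UNIV. \<Sum>j\<in>UNIV. Y $ i $ j * G' (?jet x) (axis i (axis j (1::real)), 0, 0, 0))"
      by (simp only: linear_sum[OF lin] linear_cmul[OF lin] real_scaleR_def)
    then show ?thesis by (simp add: inner_matrix_entries a_def mult.commute)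
  qed
  have aS: "a x \<in> Sym" for x
  proof -
    have t: "transpose (axis i (axis j (1::real))) = axis j (axis i 1)" for i j :: 'n
      by (simp add: vec_eq_iff transpose_def axis_def)
    have "P (axis i (axis j 1), 0, 0, 0) = P (axis j (axis i 1), 0, 0, 0)" for i j
      by (simp add: P_def sm_def t add.commute)
    then show ?thesis by (simp add: Sym_def transpose_def vec_eq_iff a_def G'_def)
  qed
  have apos: "pos_def (a x)" if x: "x \<in> \<Omega>" for x
  proof -
    have "has_matrix_deriv F (hessian u x) (grad u x) (u x) x (a x)"
      unfolding has_matrix_deriv_def
    proof (intro conjI ballI aS)
      fix X :: "real^'n^'n" assume X: "X \<in> Sym"
      have d: "((\<lambda>t. (hessian u x + t *\<^sub>R X, grad u x, u x, x)) has_derivative (\<lambda>s. (s *\<^sub>R X, 0, 0, 0))) (at 0)"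
        by (auto intro!: derivative_eq_intros simp: zero_prod_def)
      have z0: "(hessian u x + 0 *\<^sub>R X, grad u x, u x, x) = ?jet x" by simp
      have "(G has_derivative G' (?jet x)) (at (hessian u x + 0 *\<^sub>R X, grad u x, u x, x))"
        unfolding z0 by (rule C2_onD(2)[OF G jet[OF x]])
      from has_derivative_compose[OF d this]
      have "((\<lambda>t. G (hessian u x + t *\<^sub>R X, grad u x, u x, x)) has_derivative (*) (a x \<bullet> X)) (at 0)"
        by (rule has_derivative_eq_rhs) (simp add: aY[OF x] fun_eq_iff)
      moreover have "G (hessian u x + t *\<^sub>R X, grad u x, u x, x) = F (hessian u x + t *\<^sub>R X, grad u x, u x, x)" for t
        using hS[OF x] X by (intro GF) (simp add: Sym_def transpose_simps)
      ultimately show "((\<lambda>t. F (hessian u x + t *\<^sub>R X, grad u x, u x, x)) has_real_derivative (\<Sum>i\<in>UNIV. \<Sum>j\<in>UNIV. a x $ i $ j * X $ i $ j)) (at 0)"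
        unfolding has_field_derivative_def inner_matrix_entries[symmetric] by simp
    qed
    then show ?thesis using assms(8)[OF x] by (simp add: matrix_deriv_eqI)
  qed
  have hpsd: "psd (hessian u x)" if x: "x \<in> \<Omega>" for x
    unfolding psd_def using hS[OF x] convex_second_derivative_nonneg[OF C assms(6) x] by blast
  interpret elliptic_solution \<Omega> u "grad u" "hessian u" A' G G' G'' a
  proof
    fix x s w and K :: "real^'n^'n" assume x: "x \<in> \<Omega>" and K: "K \<in> Sym"
    have "0 \<le> G' (?jet x) (2 *\<^sub>R (hessian u x ** K ** hessian u x ** K ** hessian u x), 0, 0, 0) +
       G'' (?jet x) (hessian u x ** K ** hessian u x, 0, s, w) (hessian u x ** K ** hessian u x, 0, s, w)"
      by (rule inverse_convexity_psd[OF G GF lc \<Omega> x hpsd[OF x] K])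
    then show "0 \<le> 2 * (a x \<bullet> (hessian u x ** K ** hessian u x ** K ** hessian u x)) +
       G'' (?jet x) (hessian u x ** K ** hessian u x, 0, s, w) (hessian u x ** K ** hessian u x, 0, s, w)"
      by (simp add: aY[OF x])
  qed (use \<Omega> C Cg A' A'S A'c hpsd G aY apos assms(7) hS GF in \<open>blast | simp\<close>)+
  show ?thesis by (rule constant_rank[OF assms(2)])
qed

end
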